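(* For all integers $K\ge m\ge 1$, every $M>0$ and every switching vector $\boldsymbol s=(s_1,\dots,s_m)$ of integers with $K=s_1>s_2>\dots>s_m>0$, it holds that $$\mathrm{PoisOPTRe}_K(\boldsymbol s,M)\ \le\ \min_{\boldsymbol G'}\ \max_{(\boldsymbol\tau',\boldsymbol s')\in\Gamma}\mathrm{OP}(\boldsymbol\tau',\boldsymbol s',\boldsymbol G')\ =\ \min_{\boldsymbol G'}\ \max_{(\boldsymbol\tau',\boldsymbol s')\in\Gamma}\mathrm{Dual}(\boldsymbol\tau',\boldsymbol s',\boldsymbol G').$$
   Context: Conventions: $[n]=\{1,\dots,n\}$; $\mathrm{Pois}(c)$ is a Poisson random variable of mean $c\ge 0$ ($\mathrm{Pois}(0)=0$); $\min$/$\max$ of a problem denote its infimum/supremum. $K\ge m\ge1$ and $M>0$ are fixed. **Switching vectors.** A switching vector is $\boldsymbol s=(s_1,\dots,s_m)$ with integers $K=s_1>s_2>\dots>s_m>s_{m+1}:=0$. For $k\in[K]$, $i(k)\in[m]$ is the unique index with $s_{i(k)+1}<k\le s_{i(k)}$. **Environments.** $\boldsymbol G'$ stands for the adversary's choice of measurable arrival rates $\lambda_t\in[0,M]$, $t\in[0,1]$, and distributions $G'_t$ (c.d.f.s) on the type space $[0,1]$ with densities $g_t(q)=dG'_t(q)/dq$ that are jointly measurable and uniformly bounded in $(t,q)$, and such that $\int_0^1\lambda_t g_t(q)\,dt>0$ for $q\in(0,1)$. **Policies.** $\Gamma$ is the set of pairs $(\boldsymbol\tau,\boldsymbol s)$ with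 $\boldsymbol s$ a switching vector and $\boldsymbol\tau=(\tau_1,\dots,\tau_m)$, $0\le\tau_1\le\dots\le\tau_m\le1$. **Primal.** $\mathrm{OP}(\boldsymbol\tau,\boldsymbol s,\boldsymbol G')$ is the minimum of $V_0^K$ over nonnegative measures $dF$ on $[0,1]$ and functions $V^k_t$, subject to, for $t,q\in[0,1]$, $k\in[K]$: $V_1^k=0$, $V_t^0=0$, $$\frac{dV_t^k}{dt}=-\lambda_t\int_{\tau_{i(k)}}^1U_t^k(q)\,dG'_t(q),\qquad U_t^k(q)=\int_{q'=0}^q dF(q')-(V_t^k-V_t^{k-1}),$$ $$\int_{0}^1\mathbb E\Big[\min\Big\{\mathrm{Pois}\Big(\int_0^1(1-G'_t(q))\lambda_t\,dt\Big),K\Big\}\Big]dF(q)=1 .$$ **Dual.** $\mathrm{Dual}(\boldsymbol\tau,\boldsymbol s,\boldsymbol G')$ is the maximum of $\theta$ subject to $$\theta\,\mathbb E\Big[\min\Big\{\mathrm{Pois}\Big(\int_0^1(1-G'_t(q))\lambda_t\,dt\Big),K\Big\}\Big]\le\sum_{k=1}^K\int_0^1\int_q^1y_t^k(q')\,dq'\,dt\quad\forall q\in[0,1],$$ where $y_t^k(q)=g_t(q)\lambda_tx_t^k$ for $q\in[\tau_{i(k)},1]$ and $y_t^k(q)=0$ for $q<\tau_{i(k)}$, $x_0^K=1$, $x_0^k=0$ for $k<K$, and $\frac{dx_t^k}{dt}=-\int_0^1(y_t^k(q)-y_t^{k+1}(q))\,dq$ with $y^{K+1}\equiv0$. **Reduced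 Poisson problem.** $\mathrm{PoisOPTRe}_K(\boldsymbol s,M)$ is the infimum of $\theta$ over $\theta\in\mathbb R$ and measurable functions $\lambda$, $\alpha^i$ ($0\le i\le m$), $\beta^i$ ($1\le i\le m$) on $[0,1]$ such that, for $t\in[0,1]$, $$\alpha_t^m=0,\quad \alpha_t^0=\lambda_t,\quad 0\le\beta^1_t\le\lambda_t\le M,\quad 0\le\beta_t^{i+1}\le\alpha_t^i\le\beta_t^i\le\lambda_t\le M\ (i\in[m-1]),$$ and, with $x$ solving $x_0^K=1$, $x_0^k=0$ ($k<K$), $\frac{dx_t^k}{dt}=-(y_t^k-y_t^{k+1})$, $y_t^k=\beta_t^{i(k)}x_t^k$ ($k\in[K]$), $y_t^{K+1}=0$, $$\theta\Pr\Big[\mathrm{Pois}\Big(\int_0^1\alpha_t^i\,dt\Big)\le K-1\Big]\ge\sum_{k=s_{i+1}+1}^Kx_1^k,\quad i=1,\dots,m,$$ $$\theta\,\mathbb E\Big[\min\Big\{\mathrm{Pois}\Big(\int_0^1\alpha_t^i\,dt\Big),K\Big\}\Big]\ge\sum_{k=1}^{s_{i+1}}\int_0^1\beta_t^{i(k)}x_t^k\,dt+\sum_{k=s_{i+1}+1}^K\int_0^1\alpha_t^ix_t^k\,dt,\quad i=0,\dots,m-1.$$ *)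

theory Defs
  imports "HOL-Probability.Probability"
begin

text \<open>
  Poisson distribution of mean \<open>c \<ge> 0\<close>; the library's \<^const>\<open>poisson_pmf\<close> is only
  specified for positive rates.
\<close>

definition Pois :: "real \<Rightarrow> nat pmf" where
  "Pois c = (if c = 0 then return_pmf 0 else poisson_pmf c)"

definition Pois_min :: "nat \<Rightarrow> real \<Rightarrow> real" where
  "Pois_min K c = measure_pmf.expectation (Pois c) (\<lambda>n. real (min n K))"

text \<open>
  \<open>df/dt = f'\<close> on \<open>[0,1]\<close> in the sense of Caratheodory: \<open>f\<close> is absolutely continuous with
  derivative \<open>f'\<close> almost everywhere. Arrival rates are merely measurable, so the differential
  equations below cannot be required to hold at every \<open>t\<close>.
\<close>

definition has_time_deriv :: "(real \<Rightarrow> real) \<Rightarrow> (real \<Rightarrow> real) \<Rightarrow> bool" where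
  "has_time_deriv f f' \<longleftrightarrow>
     set_integrable lborel {0..1} f' \<and>
     (\<forall>t\<in>{0..1}. f t = f 0 + (LINT u:{0..t}|lborel. f' u))"


text \<open>
  Vectors are functions on \<open>nat\<close> of which only the entries \<open>1, \<dots>, m\<close> matter (for switching
  vectors also the entry \<open>m + 1\<close>, which is \<open>0\<close> by convention).
\<close>

definition switching_vector :: "nat \<Rightarrow> nat \<Rightarrow> (nat \<Rightarrow> nat) \<Rightarrow> bool" where
  "switching_vector K m s \<longleftrightarrow>
     s 1 = K \<and> (\<forall>i\<in>{1..m}. s (Suc i) < s i) \<and> s (Suc m) = 0"

definition seg :: "nat \<Rightarrow> (nat \<Rightarrow> nat) \<Rightarrow> nat \<Rightarrow> nat" where
  "seg m s k = (THE i. i \<in> {1..m} \<and> s (Suc i) < k \<and> k \<le> s i)"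

definition policies :: "nat \<Rightarrow> nat \<Rightarrow> ((nat \<Rightarrow> real) \<times> (nat \<Rightarrow> nat)) set" where
  "policies K m = {(\<tau>, s). switching_vector K m s \<and>
     (\<forall>i\<in>{1..m}. 0 \<le> \<tau> i \<and> \<tau> i \<le> 1) \<and>
     (\<forall>i j. 1 \<le> i \<and> i \<le> j \<and> j \<le> m \<longrightarrow> \<tau> i \<le> \<tau> j)}"


text \<open>
  An environment is given by the rates \<open>\<lambda>\<^sub>t\<close> and the densities \<open>g\<^sub>t\<close>; \<open>type_dist g t\<close> is the
  distribution on \<open>[0,1]\<close> with density \<open>g\<^sub>t\<close>, and its \<^const>\<open>cdf\<close> is \<open>G'\<^sub>t\<close>.
\<close>

definition type_dist :: "(real \<Rightarrow> real \<Rightarrow> real) \<Rightarrow> real \<Rightarrow> real measure" where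
  "type_dist g t = density lborel (\<lambda>q. ennreal (indicator {0..1} q * g t q))"

definition environments :: "real \<Rightarrow> ((real \<Rightarrow> real) \<times> (real \<Rightarrow> real \<Rightarrow> real)) set" where
  "environments M = {(lam, g).
     set_borel_measurable borel {0..1} lam \<and>
     (\<forall>t\<in>{0..1}. 0 \<le> lam t \<and> lam t \<le> M) \<and>
     set_borel_measurable borel ({0..1} \<times> {0..1}) (\<lambda>(t, q). g t q) \<and>
     (\<forall>t\<in>{0..1}. \<forall>q\<in>{0..1}. 0 \<le> g t q) \<and>
     (\<exists>B. \<forall>t\<in>{0..1}. \<forall>q\<in>{0..1}. g t q \<le> B) \<and>
     (\<forall>t\<in>{0..1}. prob_space (type_dist g t)) \<and>
     (\<forall>q\<in>{0<..<1}. 0 < (LINT t:{0..1}|lborel. lam t * g t q))}"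

definition arrivals_above :: "(real \<Rightarrow> real) \<Rightarrow> (real \<Rightarrow> real \<Rightarrow> real) \<Rightarrow> real \<Rightarrow> real" where
  "arrivals_above lam g q = (LINT t:{0..1}|lborel. (1 - cdf (type_dist g t) q) * lam t)"


definition utility :: "real measure \<Rightarrow> (nat \<Rightarrow> real \<Rightarrow> real) \<Rightarrow> nat \<Rightarrow> real \<Rightarrow> real \<Rightarrow> real" where
  "utility F V k t q = measure F {0..q} - (V k t - V (k - 1) t)"

text \<open>
  \<open>F\<close> is a measure on \<open>[0,1]\<close>. It has to be finite for \<open>utility F V k t q\<close> to be a real number
  at \<open>q = 1\<close>.
\<close>

definition primal_feasible ::
  "nat \<Rightarrow> nat \<Rightarrow> (nat \<Rightarrow> real) \<Rightarrow> (nat \<Rightarrow> nat) \<Rightarrow> (real \<Rightarrow> real) \<Rightarrow> (real \<Rightarrow> real \<Rightarrow> real) \<Rightarrow>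
   real measure \<Rightarrow> (nat \<Rightarrow> real \<Rightarrow> real) \<Rightarrow> bool" where
  "primal_feasible K m \<tau> s lam g F V \<longleftrightarrow>
     sets F = sets (restrict_space borel {0..1}) \<and> finite_measure F \<and>
     (\<forall>k\<in>{1..K}. V k 1 = 0) \<and> (\<forall>t\<in>{0..1}. V 0 t = 0) \<and>
     (\<forall>k\<in>{1..K}. has_time_deriv (V k)
        (\<lambda>t. - lam t * (LINT q:{\<tau> (seg m s k)..1}|type_dist g t. utility F V k t q))) \<and>
     (LINT q|F. Pois_min K (arrivals_above lam g q)) = 1"

definition OP ::
  "nat \<Rightarrow> nat \<Rightarrow> (nat \<Rightarrow> real) \<Rightarrow> (nat \<Rightarrow> nat) \<Rightarrow> (real \<Rightarrow> real) \<Rightarrow> (real \<Rightarrow> real \<Rightarrow> real) \<Rightarrow> ereal"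
  where
  "OP K m \<tau> s lam g = (INF (F, V)\<in>{(F, V). primal_feasible K m \<tau> s lam g F V}. ereal (V K 0))"


definition dual_y ::
  "nat \<Rightarrow> nat \<Rightarrow> (nat \<Rightarrow> real) \<Rightarrow> (nat \<Rightarrow> nat) \<Rightarrow> (real \<Rightarrow> real) \<Rightarrow> (real \<Rightarrow> real \<Rightarrow> real) \<Rightarrow>
   (nat \<Rightarrow> real \<Rightarrow> real) \<Rightarrow> nat \<Rightarrow> real \<Rightarrow> real \<Rightarrow> real" where
  "dual_y K m \<tau> s lam g x k t q =
     (if k \<le> K \<and> q \<in> {\<tau> (seg m s k)..1} then g t q * lam t * x k t else 0)"

definition dual_feasible ::
  "nat \<Rightarrow> nat \<Rightarrow> (nat \<Rightarrow> real) \<Rightarrow> (nat \<Rightarrow> nat) \<Rightarrow> (real \<Rightarrow> real) \<Rightarrow> (real \<Rightarrow> real \<Rightarrow> real) \<Rightarrow>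
   real \<Rightarrow> (nat \<Rightarrow> real \<Rightarrow> real) \<Rightarrow> bool" where
  "dual_feasible K m \<tau> s lam g \<theta> x \<longleftrightarrow>
     (let y = dual_y K m \<tau> s lam g x in
       x K 0 = 1 \<and> (\<forall>k\<in>{1..<K}. x k 0 = 0) \<and>
       (\<forall>k\<in>{1..K}. has_time_deriv (x k)
          (\<lambda>t. - (LINT q:{0..1}|lborel. y k t q - y (Suc k) t q))) \<and>
       (\<forall>q\<in>{0..1}. \<theta> * Pois_min K (arrivals_above lam g q) \<le>
          (\<Sum>k=1..K. LINT t:{0..1}|lborel. LINT q':{q..1}|lborel. y k t q')))"

definition Dual ::
  "nat \<Rightarrow> nat \<Rightarrow> (nat \<Rightarrow> real) \<Rightarrow> (nat \<Rightarrow> nat) \<Rightarrow> (real \<Rightarrow> real) \<Rightarrow> (real \<Rightarrow> real \<Rightarrow> real) \<Rightarrow> ereal"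
  where
  "Dual K m \<tau> s lam g = (SUP \<theta>\<in>{\<theta>. \<exists>x. dual_feasible K m \<tau> s lam g \<theta> x}. ereal \<theta>)"


definition pois_y ::
  "nat \<Rightarrow> nat \<Rightarrow> (nat \<Rightarrow> nat) \<Rightarrow> (nat \<Rightarrow> real \<Rightarrow> real) \<Rightarrow> (nat \<Rightarrow> real \<Rightarrow> real) \<Rightarrow>
   nat \<Rightarrow> real \<Rightarrow> real" where
  "pois_y K m s \<beta> x k t = (if k \<le> K then \<beta> (seg m s k) t * x k t else 0)"

definition pois_feasible ::
  "nat \<Rightarrow> nat \<Rightarrow> (nat \<Rightarrow> nat) \<Rightarrow> real \<Rightarrow> real \<Rightarrow> (real \<Rightarrow> real) \<Rightarrow>
   (nat \<Rightarrow> real \<Rightarrow> real) \<Rightarrow> (nat \<Rightarrow> real \<Rightarrow> real) \<Rightarrow> (nat \<Rightarrow> real \<Rightarrow> real) \<Rightarrow> bool" where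
  "pois_feasible K m s M \<theta> lam \<alpha> \<beta> x \<longleftrightarrow>
     set_borel_measurable borel {0..1} lam \<and>
     (\<forall>i\<in>{0..m}. set_borel_measurable borel {0..1} (\<alpha> i)) \<and>
     (\<forall>i\<in>{1..m}. set_borel_measurable borel {0..1} (\<beta> i)) \<and>
     (\<forall>t\<in>{0..1}.
        \<alpha> m t = 0 \<and> \<alpha> 0 t = lam t \<and> 0 \<le> \<beta> 1 t \<and> \<beta> 1 t \<le> lam t \<and> lam t \<le> M \<and>
        (\<forall>i\<in>{1..<m}. 0 \<le> \<beta> (Suc i) t \<and> \<beta> (Suc i) t \<le> \<alpha> i t \<and> \<alpha> i t \<le> \<beta> i t \<and> \<beta> i t \<le> lam t)) \<and>
     x K 0 = 1 \<and> (\<forall>k\<in>{1..<K}. x k 0 = 0) \<and>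
     (\<forall>k\<in>{1..K}. has_time_deriv (x k)
        (\<lambda>t. - (pois_y K m s \<beta> x k t - pois_y K m s \<beta> x (Suc k) t))) \<and>
     (\<forall>i\<in>{1..m}.
        \<theta> * measure_pmf.prob (Pois (LINT t:{0..1}|lborel. \<alpha> i t)) {n. n \<le> K - 1}
          \<ge> (\<Sum>k=s (Suc i) + 1..K. x k 1)) \<and>
     (\<forall>i\<in>{0..<m}.
        \<theta> * Pois_min K (LINT t:{0..1}|lborel. \<alpha> i t)
          \<ge> (\<Sum>k=1..s (Suc i). LINT t:{0..1}|lborel. \<beta> (seg m s k) t * x k t)
            + (\<Sum>k=s (Suc i) + 1..K. LINT t:{0..1}|lborel. \<alpha> i t * x k t))"

definition PoisOPTRe :: "nat \<Rightarrow> nat \<Rightarrow> (nat \<Rightarrow> nat) \<Rightarrow> real \<Rightarrow> ereal" where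
  "PoisOPTRe K m s M =
     (INF \<theta>\<in>{\<theta>. \<exists>lam \<alpha> \<beta> x. pois_feasible K m s M \<theta> lam \<alpha> \<beta> x}. ereal \<theta>)"

end

theory Submission
  imports Defs
begin

text \<open>
  Both claims come from the \<^emph>\<open>demand curve\<close> \<open>N q t = \<lambda>\<^sub>t (1 - G'\<^sub>t(q))\<close>, the arrival rate at time
  \<open>t\<close> of customers of type at least \<open>q\<close>. Under thresholds \<open>\<tau>\<close> the stock is a pure death chain that
  leaves state \<open>k\<close> at rate \<open>N \<tau>\<^bsub>i(k)\<^esub> t\<close>. With \<open>x\<close> its law, let
  \<open>D(q) = (\<Sum>k. \<integral> N (max q \<tau>\<^bsub>i(k)\<^esub>) t * x k t dt)\<close> be the expected sales to types at least \<open>q\<close>, let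
  \<open>P(q)\<close> be the expectation of \<open>min {Pois(\<integral> N q t dt), K}\<close>, and let \<open>R = D / P\<close> on \<open>[0,1)\<close>.

  \<^emph>\<open>Equality.\<close> It holds for each policy and each environment separately. In the derivative of
  \<open>\<Sum>k. x k t * V k t\<close> the terms that link neighbouring states cancel, so every primal solution has
  \<open>V\<^sub>0\<^sup>K = \<integral> D dF\<close> (lemma \<open>value_eq_revenue\<close>). The primal problem therefore minimises \<open>\<integral> D dF\<close>
  under \<open>\<integral> P dF = 1\<close>, and scaled point masses show that its value is the infimum of \<open>R\<close>; the dual
  problem asks for the largest \<open>\<theta>\<close> with \<open>\<theta> P \<le> D\<close>, which is the same number (\<open>strong_duality\<close>).

  \<^emph>\<open>Inequality.\<close> For a fixed environment one looks for thresholds \<open>\<tau>\<close> whose dual value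
  \<open>\<theta> = inf R\<close> is feasible in the reduced problem with \<open>\<beta>\<^sup>i = N \<tau>\<^sub>i\<close> and \<open>\<alpha>\<^sup>i = N q\<^sub>i\<close>, where
  \<open>q\<^sub>i \<in> [\<tau>\<^sub>i, \<tau>\<^sub>i\<^sub>+\<^sub>1]\<close>. The constraint on expectations then reads \<open>R(q\<^sub>i) \<le> \<theta>\<close>, and the constraint on
  probabilities is the first-order condition for a minimum of \<open>R\<close> at \<open>q\<^sub>i\<close>, combined with the fact that
  stock only shrinks over time (\<open>marginal_condition\<close>). So each interval \<open>[\<tau>\<^sub>i, \<tau>\<^sub>i\<^sub>+\<^sub>1]\<close> with \<open>i < m\<close>,
  where \<open>\<tau>\<^sub>0 = 0\<close>, has to contain a global minimiser of \<open>R\<close>. Such thresholds exist by a Poincare--Miranda argument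
  (\<open>equalizing_thresholds\<close>): when a threshold meets its left neighbour, the interval between them is a
  point, on which the minimum is at least that of the next interval, and symmetrically at the right end.

  The last interval is delicate because \<open>R\<close> need not have a limit at \<open>1\<close>. The thresholds are at most
  some \<open>b < 1\<close>, and beyond the last of them \<open>R\<close> is bounded below by the probability that stock remains at
  the end. Either the equalisation succeeds, or the last threshold is \<open>b\<close>; in the latter case the
  last unit is hardly ever sold, and for \<open>b\<close> near \<open>1\<close> the dual value is almost \<open>1\<close> or larger. This is enough, since the
  reduced problem never exceeds \<open>1\<close>: take no arrivals at all (\<open>PoisOPTRe_le_1\<close>).
\<close>

section \<open>Absolutely continuous functions and linear equations on the unit interval\<close>

lemma has_time_derivI:
  assumes "set_integrable lborel {0..1} f'"
    and "\<And>t. t \<in> {0..1} \<Longrightarrow> f t = f 0 + (LINT u:{0..t}|lborel. f' u)"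
  shows "has_time_deriv f f'"
  unfolding has_time_deriv_def using assms by blast

lemma has_time_deriv_integrable_01: "has_time_deriv f f' \<Longrightarrow> set_integrable lborel {0..1} f'"
  unfolding has_time_deriv_def by blast

lemma has_time_deriv_integrable:
  assumes "has_time_deriv f f'" and "t \<le> 1"
  shows "set_integrable lborel {0..t} f'"
  using has_time_deriv_integrable_01[OF assms(1)] assms(2)
  by (auto intro: set_integrable_subset)

lemma has_time_deriv_eq:
  assumes "has_time_deriv f f'" and "t \<in> {0..1}"
  shows "f t = f 0 + (LINT u:{0..t}|lborel. f' u)"
  using assms unfolding has_time_deriv_def by blast

lemma has_time_deriv_cong:
  assumes "has_time_deriv f f'"
    and "\<And>t. t \<in> {0..1} \<Longrightarrow> f t = g t" and "\<And>t. t \<in> {0..1} \<Longrightarrow> f' t = g' t"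
  shows "has_time_deriv g g'"
proof (rule has_time_derivI)
  have "set_integrable lborel {0..1} f' \<longleftrightarrow> set_integrable lborel {0..1} g'"
    using assms(3) by (intro set_integrable_cong) auto
  then show "set_integrable lborel {0..1} g'" using has_time_deriv_integrable_01[OF assms(1)] by blast
  fix t :: real assume t: "t \<in> {0..1}"
  have "(LINT u:{0..t}|lborel. f' u) = (LINT u:{0..t}|lborel. g' u)"
    using assms(3) t by (intro set_lebesgue_integral_cong) auto
  then show "g t = g 0 + (LINT u:{0..t}|lborel. g' u)"
    using has_time_deriv_eq[OF assms(1) t] assms(2)[OF t] assms(2)[of 0] by simp
qed

lemma has_time_deriv_const: "has_time_deriv (\<lambda>_. c) (\<lambda>_. 0)"
  by (simp add: has_time_deriv_def set_integrable_def set_lebesgue_integral_def)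

lemma has_time_deriv_add:
  assumes "has_time_deriv f f'" and "has_time_deriv g g'"
  shows "has_time_deriv (\<lambda>t. f t + g t) (\<lambda>t. f' t + g' t)"
proof (rule has_time_derivI)
  show "set_integrable lborel {0..1} (\<lambda>t. f' t + g' t)"
    using assms by (intro set_integral_add has_time_deriv_integrable_01)
  fix t :: real assume t: "t \<in> {0..1}"
  have "(LINT u:{0..t}|lborel. f' u + g' u) = (LINT u:{0..t}|lborel. f' u) + (LINT u:{0..t}|lborel. g' u)"
    by (rule set_integral_add(2)) (use t in \<open>auto intro: has_time_deriv_integrable assms\<close>)
  then show "f t + g t = f 0 + g 0 + (LINT u:{0..t}|lborel. f' u + g' u)"
    using has_time_deriv_eq[OF assms(1) t] has_time_deriv_eq[OF assms(2) t] by simp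
qed

lemma has_time_deriv_cmult:
  assumes "has_time_deriv f f'"
  shows "has_time_deriv (\<lambda>t. c * f t) (\<lambda>t. c * f' t)"
proof (rule has_time_derivI)
  show "set_integrable lborel {0..1} (\<lambda>t. c * f' t)"
    using has_time_deriv_integrable_01[OF assms] by simp
  fix t :: real assume "t \<in> {0..1}"
  from has_time_deriv_eq[OF assms this]
  show "c * f t = c * f 0 + (LINT u:{0..t}|lborel. c * f' u)" by (simp add: distrib_left)
qed

lemma has_time_deriv_sum:
  assumes "finite I" and "\<And>i. i \<in> I \<Longrightarrow> has_time_deriv (f i) (f' i)"
  shows "has_time_deriv (\<lambda>t. \<Sum>i\<in>I. f i t) (\<lambda>t. \<Sum>i\<in>I. f' i t)"
  using assms by (induction I) (auto intro: has_time_deriv_add has_time_deriv_const)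

lemma has_time_deriv_continuous:
  assumes "has_time_deriv f f'"
  shows "continuous_on {0..1} f"
proof -
  have int: "set_integrable lborel {0..1} f'"
    using has_time_deriv_integrable_01[OF assms] .
  have "continuous_on {0..1} (\<lambda>t. integral {0..t} f')"
    using set_borel_integral_eq_integral(1)[OF int] by (intro indefinite_integral_continuous_1)
  then have "continuous_on {0..1} (\<lambda>t. f 0 + integral {0..t} f')"
    by (intro continuous_intros)
  moreover have "f t = f 0 + integral {0..t} f'" if "t \<in> {0..1}" for t
    using has_time_deriv_eq[OF assms that] has_time_deriv_integrable[OF assms, of t] that
    by (simp add: set_borel_integral_eq_integral)
  ultimately show ?thesis by (metis (no_types, lifting) continuous_on_cong)
qed

lemma set_integrable_bounded:
  fixes f :: "real \<Rightarrow> real"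
  assumes "set_borel_measurable lborel {a..b} f" and "\<And>t. t \<in> {a..b} \<Longrightarrow> \<bar>f t\<bar> \<le> B"
  shows "set_integrable lborel {a..b} f"
  unfolding set_integrable_def
proof (rule Bochner_Integration.integrable_bound)
  show "integrable lborel (\<lambda>t. indicator {a..b} t * B :: real)"
    by (intro integrable_mult_left integrable_real_indicator) (auto simp: emeasure_lborel_Icc_eq)
  show "(\<lambda>x. indicator {a..b} x *\<^sub>R f x) \<in> borel_measurable lborel"
    using assms(1) by (simp add: set_borel_measurable_def)
  show "AE x in lborel. norm (indicator {a..b} x *\<^sub>R f x) \<le> norm (indicator {a..b} x * B)"
    using assms(2) by (intro AE_I2) (force simp: indicator_def)
qed

lemma has_time_deriv_measurable:
  assumes "has_time_deriv f f'"
  shows "set_borel_measurable lborel {0..1} f"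
proof -
  have "set_borel_measurable borel {0..1} f"
    using has_time_deriv_continuous[OF assms] unfolding set_borel_measurable_def
    by (intro borel_measurable_continuous_on_indicator) auto
  then show ?thesis by (simp add: set_borel_measurable_def)
qed

lemma continuous_on_01_bounded:
  fixes f :: "real \<Rightarrow> real"
  assumes "continuous_on {0..1} f"
  shows "\<exists>B\<ge>0. \<forall>t\<in>{0..1}. \<bar>f t\<bar> \<le> B"
proof -
  have "bounded (f ` {0..1})"
    by (rule compact_imp_bounded[OF compact_continuous_image[OF assms]]) simp
  then obtain B where "\<forall>x\<in>f ` {0..1}. norm x \<le> B" unfolding bounded_iff by blast
  then have "\<forall>t\<in>{0..1}. \<bar>f t\<bar> \<le> max 0 B" by force
  then show ?thesis by (intro exI[of _ "max 0 B"]) simp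
qed

lemma set_integrable_mult_continuous:
  fixes f g :: "real \<Rightarrow> real"
  assumes "set_integrable lborel {0..1} f" and "continuous_on {0..1} g"
  shows "set_integrable lborel {0..1} (\<lambda>t. f t * g t)"
proof -
  obtain B where B: "\<forall>t\<in>{0..1}. \<bar>g t\<bar> \<le> B" using continuous_on_01_bounded[OF assms(2)] by auto
  have m1: "(\<lambda>t. indicator {0..1} t *\<^sub>R f t) \<in> borel_measurable lborel"
    using assms(1) unfolding set_integrable_def by auto
  have m2: "(\<lambda>t. indicator {0..1} t *\<^sub>R g t) \<in> borel_measurable lborel"
    using borel_measurable_continuous_on_indicator[OF _ assms(2)] by auto
  show ?thesis unfolding set_integrable_def
  proof (rule Bochner_Integration.integrable_bound)
    show "integrable lborel (\<lambda>t. B *\<^sub>R (indicator {0..1} t *\<^sub>R f t))"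
      using assms(1) unfolding set_integrable_def by (intro integrable_scaleR_right) auto
    have "(\<lambda>t. (indicator {0..1} t *\<^sub>R f t) * (indicator {0..1} t *\<^sub>R g t)) \<in> borel_measurable lborel"
      using m1 m2 by measurable
    then show "(\<lambda>t. indicator {0..1} t *\<^sub>R (f t * g t)) \<in> borel_measurable lborel"
      by (rule measurable_cong[THEN iffD1, rotated]) (auto simp: indicator_def)
    show "AE t in lborel. norm (indicator {0..1} t *\<^sub>R (f t * g t)) \<le> norm (B *\<^sub>R (indicator {0..1} t *\<^sub>R f t))"
    proof (intro AE_I2)
      fix t :: real
      show "norm (indicator {0..1} t *\<^sub>R (f t * g t)) \<le> norm (B *\<^sub>R (indicator {0..1} t *\<^sub>R f t))"
      proof (cases "t \<in> {0..1}")
        case True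
        then have "\<bar>f t\<bar> * \<bar>g t\<bar> \<le> \<bar>f t\<bar> * \<bar>B\<bar>"
          using B by (intro mult_left_mono) force+
        then show ?thesis using True by (simp add: abs_mult mult.commute)
      qed simp
    qed
  qed
qed

text \<open>
  Write both factors as indefinite integrals. The product of the increments is then the integral of
  \<open>f' u * g' v\<close> over the square \<open>[0,t] \<times> [0,t]\<close>, and by Fubini the two triangles of the square give the
  two terms of the product rule.
\<close>

lemma has_time_deriv_mult:
  assumes f: "has_time_deriv f f'" and g: "has_time_deriv g g'"
  shows "has_time_deriv (\<lambda>t. f t * g t) (\<lambda>t. f' t * g t + g' t * f t)"
proof (rule has_time_derivI)
  have i: "set_integrable lborel {0..1} (\<lambda>t. f' t * g t)" "set_integrable lborel {0..1} (\<lambda>t. g' t * f t)"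
    by (rule set_integrable_mult_continuous[OF has_time_deriv_integrable_01[OF f] has_time_deriv_continuous[OF g]],
        rule set_integrable_mult_continuous[OF has_time_deriv_integrable_01[OF g] has_time_deriv_continuous[OF f]])
  show "set_integrable lborel {0..1} (\<lambda>t. f' t * g t + g' t * f t)"
    by (rule set_integral_add(1)[OF i])
  fix t :: real assume t: "t \<in> {0..1}"
  define F where "F u = indicator {0..t} u * f' u" for u :: real
  define G where "G u = indicator {0..t} u * g' u" for u :: real
  have iF: "integrable lborel F" and iG: "integrable lborel G"
    using has_time_deriv_integrable[OF f, of t] has_time_deriv_integrable[OF g, of t] t
    unfolding F_def G_def set_integrable_def by auto
  have mF[measurable]: "F \<in> borel_measurable borel" and mG[measurable]: "G \<in> borel_measurable borel"
    using iF iG by auto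
  have eF: "(LINT u|lborel. F u) = f t - f 0" and eG: "(LINT u|lborel. G u) = g t - g 0"
    using has_time_deriv_eq[OF f t] has_time_deriv_eq[OF g t]
    unfolding set_lebesgue_integral_def F_def G_def by auto
  \<comment> \<open>The inner integrals over the two triangles.\<close>
  have low: "(LINT v|lborel. G v * indicator {..u} v) = g u - g 0" if "u \<in> {0..t}" for u
  proof -
    have "(LINT v|lborel. G v * indicator {..u} v) = (LINT v:{0..u}|lborel. g' v)"
      unfolding set_lebesgue_integral_def G_def using that
      by (intro Bochner_Integration.integral_cong) (auto simp: indicator_def)
    then show ?thesis using has_time_deriv_eq[OF g, of u] that t by auto
  qed
  have up: "(LINT u|lborel. F u * indicator {..<v} u) = f v - f 0" if "v \<in> {0..t}" for v
  proof -
    have "(LINT u|lborel. F u * indicator {..<v} u) = (LINT u|lborel. indicator {0..v} u * f' u)"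
    proof (rule integral_cong_AE)
      show "(\<lambda>u. F u * indicator {..<v} u) \<in> borel_measurable lborel" by measurable
      have "set_integrable lborel {0..v} f'" using has_time_deriv_integrable[OF f, of v] that t by auto
      then show "(\<lambda>u. indicator {0..v} u * f' u) \<in> borel_measurable lborel"
        unfolding set_integrable_def by auto
      show "AE u in lborel. F u * indicator {..<v} u = indicator {0..v} u * f' u"
        using AE_lborel_singleton[of v] by eventually_elim (use that in \<open>auto simp: F_def indicator_def\<close>)
    qed
    then show ?thesis using has_time_deriv_eq[OF f, of v] that t
      by (auto simp: set_lebesgue_integral_def)
  qed
  define J where "J = (\<lambda>(u::real, v::real). F u * G v * indicator {..<v} u)"
  have mJ[measurable]: "J \<in> borel_measurable (lborel \<Otimes>\<^sub>M lborel)"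
  proof -
    have "(\<lambda>(u::real, v::real). F u * G v * (if u < v then 1 else 0 :: real)) \<in> borel_measurable (lborel \<Otimes>\<^sub>M lborel)"
      by measurable
    moreover have "J = (\<lambda>(u::real, v::real). F u * G v * (if u < v then 1 else 0 :: real))"
      by (auto simp: J_def fun_eq_iff indicator_def)
    ultimately show ?thesis by simp
  qed
  have iJ: "integrable (lborel \<Otimes>\<^sub>M lborel) J"
  proof (rule Bochner_Integration.integrable_bound)
    show "integrable (lborel \<Otimes>\<^sub>M lborel) (\<lambda>(u, v). F u * G v)"
    proof (rule lborel_pair.Fubini_integrable)
      show "(\<lambda>(u, v). F u * G v) \<in> borel_measurable (lborel \<Otimes>\<^sub>M lborel)" by measurable
      show "integrable lborel (\<lambda>x. LINT y|lborel. norm (case (x, y) of (u, v) \<Rightarrow> F u * G v))"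
        using iF by (simp add: abs_mult)
      show "AE x in lborel. integrable lborel (\<lambda>y. case (x, y) of (u, v) \<Rightarrow> F u * G v)"
        using iG by simp
    qed
    show "AE x in lborel \<Otimes>\<^sub>M lborel. norm (J x) \<le> norm (case x of (u, v) \<Rightarrow> F u * G v)"
      by (auto simp: J_def indicator_def)
  qed simp
  have swap: "(LINT u|lborel. F u * (LINT v|lborel. G v * indicator {u<..} v))
      = (LINT v|lborel. G v * (LINT u|lborel. F u * indicator {..<v} u))"
  proof -
    have a: "(LINT u|lborel. LINT v|lborel. F u * G v * indicator {..<v} u) = (LINT v|lborel. LINT u|lborel. F u * G v * indicator {..<v} u)"
      using lborel_pair.Fubini_integral[of "\<lambda>u v. F u * G v * indicator {..<v} u"] iJ
      unfolding J_def by simp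
    have b: "(LINT v|lborel. F u * G v * indicator {..<v} u) = F u * (LINT v|lborel. G v * indicator {u<..} v)" for u
    proof -
      have "(LINT v|lborel. F u * G v * indicator {..<v} u) = (LINT v|lborel. F u * (G v * indicator {u<..} v))"
        by (intro Bochner_Integration.integral_cong) (auto simp: indicator_def)
      then show ?thesis by simp
    qed
    have c: "(LINT u|lborel. F u * G v * indicator {..<v} u) = G v * (LINT u|lborel. F u * indicator {..<v} u)" for v
    proof -
      have "(LINT u|lborel. F u * G v * indicator {..<v} u) = (LINT u|lborel. G v * (F u * indicator {..<v} u))"
        by (intro Bochner_Integration.integral_cong) (auto simp: indicator_def)
      then show ?thesis by simp
    qed
    show ?thesis using a unfolding b c .
  qed
  have split: "(LINT v|lborel. G v * indicator {u<..} v) = (LINT v|lborel. G v) - (LINT v|lborel. G v * indicator {..u} v)" for u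
  proof -
    have 1: "integrable lborel (\<lambda>v. G v * indicator {u<..} v)" "integrable lborel (\<lambda>v. G v * indicator {..u} v)"
      using iG by (auto intro!: integrable_real_mult_indicator)
    have "(LINT v|lborel. G v) = (LINT v|lborel. G v * indicator {u<..} v + G v * indicator {..u} v)"
      by (intro Bochner_Integration.integral_cong) (auto simp: indicator_def)
    then show ?thesis using 1 by simp
  qed
  have l: "(LINT u|lborel. F u * (LINT v|lborel. G v * indicator {u<..} v)) = (LINT u|lborel. F u * g t - indicator {0..t} u *\<^sub>R (f' u * g u))"
  proof (intro Bochner_Integration.integral_cong refl)
    fix u
    show "F u * (LINT v|lborel. G v * indicator {u<..} v) = F u * g t - indicator {0..t} u *\<^sub>R (f' u * g u)"
      unfolding split eG by (cases "u \<in> {0..t}", simp only: low) (simp_all add: F_def algebra_simps)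
  qed
  have r: "(LINT v|lborel. G v * (LINT u|lborel. F u * indicator {..<v} u)) = (LINT v|lborel. indicator {0..t} v *\<^sub>R (g' v * f v) - G v * f 0)"
  proof (intro Bochner_Integration.integral_cong refl)
    fix v
    show "G v * (LINT u|lborel. F u * indicator {..<v} u) = indicator {0..t} v *\<^sub>R (g' v * f v) - G v * f 0"
      by (cases "v \<in> {0..t}", simp only: up) (simp_all add: G_def algebra_simps)
  qed
  have it: "set_integrable lborel {0..t} (\<lambda>t. f' t * g t)" "set_integrable lborel {0..t} (\<lambda>t. g' t * f t)"
    using i t by (auto intro: set_integrable_subset)
  have l': "(LINT u|lborel. F u * g t - indicator {0..t} u *\<^sub>R (f' u * g u)) = (f t - f 0) * g t - (LINT u:{0..t}|lborel. f' u * g u)"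
    using iF it eF by (subst Bochner_Integration.integral_diff) (auto simp: set_integrable_def set_lebesgue_integral_def)
  have r': "(LINT v|lborel. indicator {0..t} v *\<^sub>R (g' v * f v) - G v * f 0) = (LINT u:{0..t}|lborel. g' u * f u) - (g t - g 0) * f 0"
    using iG it eG by (subst Bochner_Integration.integral_diff) (auto simp: set_integrable_def set_lebesgue_integral_def)
  have "(LINT u:{0..t}|lborel. f' u * g u + g' u * f u) = (LINT u:{0..t}|lborel. f' u * g u) + (LINT u:{0..t}|lborel. g' u * f u)"
    by (rule set_integral_add(2)[OF it])
  then show "f t * g t = f 0 * g 0 + (LINT u:{0..t}|lborel. f' u * g u + g' u * f u)"
    using swap unfolding l r l' r' by (simp add: algebra_simps)
qed

lemma set_borel_measurable_mult:
  fixes f g :: "'a \<Rightarrow> real"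
  assumes "set_borel_measurable M A f" and "set_borel_measurable M A g"
  shows "set_borel_measurable M A (\<lambda>t. f t * g t)"
proof -
  have "(\<lambda>t. (indicator A t *\<^sub>R f t) * (indicator A t *\<^sub>R g t)) \<in> borel_measurable M"
    using assms unfolding set_borel_measurable_def by (rule borel_measurable_times)
  then show ?thesis unfolding set_borel_measurable_def
    by (rule measurable_cong[THEN iffD1, rotated]) (auto simp: indicator_def)
qed

lemma set_integral_bounded_convergence:
  fixes f :: "nat \<Rightarrow> real \<Rightarrow> real"
  assumes meas: "\<And>n. set_borel_measurable lborel {a..b} (f n)"
    and bnd: "\<And>n t. t \<in> {a..b} \<Longrightarrow> \<bar>f n t\<bar> \<le> B"
    and lim: "\<And>t. t \<in> {a..b} \<Longrightarrow> (\<lambda>n. f n t) \<longlonglongrightarrow> g t"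
  shows "(\<lambda>n. LINT t:{a..b}|lborel. f n t) \<longlonglongrightarrow> (LINT t:{a..b}|lborel. g t)"
  unfolding set_lebesgue_integral_def
proof (rule integral_dominated_convergence)
  have l: "(\<lambda>n. indicator {a..b} t *\<^sub>R f n t) \<longlonglongrightarrow> indicator {a..b} t *\<^sub>R g t" for t
    using lim[of t] by (cases "t \<in> {a..b}") auto
  show "(\<lambda>t. indicator {a..b} t *\<^sub>R g t) \<in> borel_measurable lborel"
    using meas l unfolding set_borel_measurable_def by (rule borel_measurable_LIMSEQ_real[rotated])
  show "(\<lambda>t. indicator {a..b} t *\<^sub>R f n t) \<in> borel_measurable lborel" for n
    using meas unfolding set_borel_measurable_def .
  show "integrable lborel (\<lambda>t. indicator {a..b} t * B :: real)"
    by (intro integrable_mult_left integrable_real_indicator) (auto simp: emeasure_lborel_Icc_eq)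
  show "AE x in lborel. (\<lambda>i. indicator {a..b} x *\<^sub>R f i x) \<longlonglongrightarrow> indicator {a..b} x *\<^sub>R g x"
    using l by (intro AE_I2)
  show "AE x in lborel. norm (indicator {a..b} x *\<^sub>R f n x) \<le> indicator {a..b} x * B" for n
    using bnd by (intro AE_I2) (auto simp: indicator_def)
qed

lemma set_integral_singleton [simp]:
  fixes f :: "real \<Rightarrow> real"
  shows "(LINT u:{c}|lborel. f u) = 0"
  unfolding set_lebesgue_integral_def
proof (rule integral_eq_zero_AE)
  show "AE x in lborel. indicat_real {c} x *\<^sub>R f x = 0"
    using AE_lborel_singleton[of c] by eventually_elim (auto simp: indicator_def)
qed

lemma has_time_deriv_indefinite:
  assumes "set_integrable lborel {0..1} f"
  shows "has_time_deriv (\<lambda>t. c + (LINT u:{0..t}|lborel. f u)) f"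
  by (rule has_time_derivI[OF assms]) simp

lemma has_time_deriv_power:
  assumes "has_time_deriv A a"
  shows "has_time_deriv (\<lambda>t. A t ^ n) (\<lambda>t. a t * (real n * A t ^ (n - 1)))"
proof (induction n)
  case 0
  show ?case using has_time_deriv_const[of 1] by simp
next
  case (Suc n)
  show ?case
    by (rule has_time_deriv_cong[OF has_time_deriv_mult[OF assms Suc]], simp)
       (cases n; simp add: algebra_simps)
qed

lemma exp_partial_sum_le:
  fixes x :: real
  shows "\<bar>\<Sum>n<N. x ^ n / fact n\<bar> \<le> exp \<bar>x\<bar>"
proof -
  have "\<bar>\<Sum>n<N. x ^ n / fact n\<bar> \<le> (\<Sum>n<N. \<bar>x\<bar> ^ n / fact n)"
    by (rule order_trans[OF sum_abs]) (simp add: power_abs)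
  also have "\<dots> \<le> (\<Sum>n. \<bar>x\<bar> ^ n / fact n)"
    using summable_exp[of "\<bar>x\<bar>"] by (intro sum_le_suminf) (auto simp: field_simps)
  also have "\<dots> = exp \<bar>x\<bar>" by (simp add: exp_def field_simps)
  finally show ?thesis .
qed

text \<open>
  The exponential series is differentiated term by term; its partial sums are dominated by
  \<open>exp \<bar>A t\<bar>\<close>, which is bounded, so the integral form of the derivative passes to the limit.
\<close>

lemma has_time_deriv_exp:
  assumes A: "has_time_deriv A a"
  shows "has_time_deriv (\<lambda>t. exp (A t)) (\<lambda>t. a t * exp (A t))"
proof (rule has_time_derivI)
  have exp_cont: "continuous_on {0..1} (\<lambda>t. exp (A t))" if "continuous_on {0..1} A" for A :: "real \<Rightarrow> real"
    using that by (intro continuous_intros)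
  show "set_integrable lborel {0..1} (\<lambda>t. a t * exp (A t))"
    by (rule set_integrable_mult_continuous[OF has_time_deriv_integrable_01[OF A]
          exp_cont[OF has_time_deriv_continuous[OF A]]])
  fix t :: real assume t: "t \<in> {0..1}"
  have lim: "(\<lambda>N. \<Sum>n<N. x ^ n / fact n) \<longlonglongrightarrow> exp x" for x :: real
    using exp_converges[of x] unfolding sums_def by (simp add: field_simps)
  have S: "has_time_deriv (\<lambda>t. \<Sum>n<N. A t ^ n / fact n)
      (\<lambda>t. a t * (\<Sum>n<N - 1. A t ^ n / fact n))" for N
  proof (rule has_time_deriv_cong[OF has_time_deriv_sum[OF _ has_time_deriv_cmult[OF has_time_deriv_power[OF A]]], of "{..<N}"])
    fix t :: real
    show "(\<Sum>i<N. 1 / fact i * A t ^ i) = (\<Sum>n<N. A t ^ n / fact n)" by simp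
    have "(\<Sum>i<N. 1 / fact i * (a t * (real i * A t ^ (i - 1)))) = a t * (\<Sum>n<N - 1. A t ^ n / fact n)"
    proof (cases N)
      case (Suc M)
      have "(\<Sum>i<Suc M. 1 / fact i * (a t * (real i * A t ^ (i - 1)))) = (\<Sum>i<M. a t * (A t ^ i / fact i))"
        unfolding sum.lessThan_Suc_shift
        by (auto simp: fact_Suc field_simps intro!: sum.cong simp del: of_nat_Suc)
      then show ?thesis by (simp add: Suc sum_distrib_left)
    qed simp
    then show "(\<Sum>i<N. 1 / fact i * (a t * (real i * A t ^ (i - 1)))) = a t * (\<Sum>n<N - 1. A t ^ n / fact n)" .
  qed auto
  have conv: "(\<lambda>N. LINT u:{0..t}|lborel. a u * (\<Sum>n<N - 1. A u ^ n / fact n))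
      \<longlonglongrightarrow> (LINT u:{0..t}|lborel. a u * exp (A u))"
    unfolding set_lebesgue_integral_def
  proof (rule integral_dominated_convergence[where w="\<lambda>u. indicator {0..t} u *\<^sub>R \<bar>a u * exp \<bar>A u\<bar>\<bar>"])
    have i: "set_integrable lborel {0..t} (\<lambda>u. a u * exp (A u))"
      using set_integrable_mult_continuous[OF has_time_deriv_integrable_01[OF A]
          exp_cont[OF has_time_deriv_continuous[OF A]]] t by (auto intro: set_integrable_subset)
    have "continuous_on {0..1} (\<lambda>u. \<bar>A u\<bar>)"
      using has_time_deriv_continuous[OF A] by (intro continuous_intros)
    from set_integrable_mult_continuous[OF has_time_deriv_integrable_01[OF A] exp_cont[OF this]]
    have j: "set_integrable lborel {0..t} (\<lambda>u. a u * exp \<bar>A u\<bar>)"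
      using t by (auto intro: set_integrable_subset)
    show "(\<lambda>u. indicator {0..t} u *\<^sub>R (a u * exp (A u))) \<in> borel_measurable lborel"
      using i unfolding set_integrable_def by auto
    show "integrable lborel (\<lambda>u. indicator {0..t} u *\<^sub>R \<bar>a u * exp \<bar>A u\<bar>\<bar>)"
      using set_integrable_abs[OF j] unfolding set_integrable_def .
    show "(\<lambda>u. indicator {0..t} u *\<^sub>R (a u * (\<Sum>n<N - 1. A u ^ n / fact n))) \<in> borel_measurable lborel" for N
      using has_time_deriv_integrable[OF S[of N], of t] t unfolding set_integrable_def by auto
    show "AE u in lborel. (\<lambda>N. indicator {0..t} u *\<^sub>R (a u * (\<Sum>n<N - 1. A u ^ n / fact n)))
        \<longlonglongrightarrow> indicator {0..t} u *\<^sub>R (a u * exp (A u))"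
    proof (intro AE_I2 tendsto_scaleR tendsto_mult tendsto_const)
      fix u
      show "(\<lambda>N. \<Sum>n<N - 1. A u ^ n / fact n) \<longlonglongrightarrow> exp (A u)"
        by (rule LIMSEQ_imp_Suc) (simp add: lim)
    qed
    show "AE u in lborel. norm (indicator {0..t} u *\<^sub>R (a u * (\<Sum>n<N - 1. A u ^ n / fact n)))
        \<le> indicator {0..t} u *\<^sub>R \<bar>a u * exp \<bar>A u\<bar>\<bar>" for N
      using exp_partial_sum_le by (intro AE_I2) (auto simp: abs_mult intro!: mult_left_mono)
  qed
  have "(\<lambda>N. (\<Sum>n<N. A t ^ n / fact n) - (\<Sum>n<N. A 0 ^ n / fact n)) \<longlonglongrightarrow> exp (A t) - exp (A 0)"
    by (intro tendsto_diff lim)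
  moreover have "(\<Sum>n<N. A t ^ n / fact n) - (\<Sum>n<N. A 0 ^ n / fact n)
      = (LINT u:{0..t}|lborel. a u * (\<Sum>n<N - 1. A u ^ n / fact n))" for N
    using has_time_deriv_eq[OF S t] by simp
  ultimately have "exp (A t) - exp (A 0) = (LINT u:{0..t}|lborel. a u * exp (A u))"
    using LIMSEQ_unique[OF _ conv] by simp
  then show "exp (A t) = exp (A 0) + (LINT u:{0..t}|lborel. a u * exp (A u))" by simp
qed

text \<open>
  Variation of constants: the solution of \<open>x' = - a x + b\<close> with \<open>x 0 = z\<close>.
\<close>

definition lin_sol :: "(real \<Rightarrow> real) \<Rightarrow> (real \<Rightarrow> real) \<Rightarrow> real \<Rightarrow> real \<Rightarrow> real" where
  "lin_sol a b z t = exp (- (LINT u:{0..t}|lborel. a u)) *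
     (z + (LINT u:{0..t}|lborel. exp (LINT v:{0..u}|lborel. a v) * b u))"

lemma lin_sol_0 [simp]: "lin_sol a b z 0 = z"
  unfolding lin_sol_def by simp

lemma exp_indefinite:
  assumes "set_integrable lborel {0..1} a"
  shows "has_time_deriv (\<lambda>t. exp (LINT u:{0..t}|lborel. a u)) (\<lambda>t. a t * exp (LINT u:{0..t}|lborel. a u))"
  using has_time_deriv_exp[OF has_time_deriv_indefinite[OF assms, of 0]] by simp

lemma has_time_deriv_lin_sol:
  assumes a: "set_integrable lborel {0..1} a" and b: "set_integrable lborel {0..1} b"
  shows "has_time_deriv (lin_sol a b z) (\<lambda>t. - a t * lin_sol a b z t + b t)"
proof -
  have E: "has_time_deriv (\<lambda>t. exp (- (LINT u:{0..t}|lborel. a u))) (\<lambda>t. - a t * exp (- (LINT u:{0..t}|lborel. a u)))"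
    using has_time_deriv_exp[OF has_time_deriv_cmult[OF has_time_deriv_indefinite[OF a, of 0], of "-1"]] by simp
  have "set_integrable lborel {0..1} (\<lambda>u. b u * exp (LINT v:{0..u}|lborel. a v))"
    by (rule set_integrable_mult_continuous[OF b has_time_deriv_continuous[OF exp_indefinite[OF a]]])
  then have Z: "has_time_deriv (\<lambda>t. z + (LINT u:{0..t}|lborel. exp (LINT v:{0..u}|lborel. a v) * b u)) (\<lambda>u. exp (LINT v:{0..u}|lborel. a v) * b u)"
    by (intro has_time_deriv_indefinite) (simp add: mult.commute)
  show ?thesis
    by (rule has_time_deriv_cong[OF has_time_deriv_mult[OF E Z]])
       (simp_all add: lin_sol_def algebra_simps flip: exp_add)
qed

lemma lin_sol_nonneg:
  assumes "0 \<le> z" and "\<And>t. t \<in> {0..1} \<Longrightarrow> 0 \<le> b t" and "t \<in> {0..1}"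
  shows "0 \<le> lin_sol a b z t"
  unfolding lin_sol_def set_lebesgue_integral_def using assms
  by (intro mult_nonneg_nonneg add_nonneg_nonneg Bochner_Integration.integral_nonneg)
     (auto simp: indicator_def)

lemma set_integral_abs_le:
  fixes f :: "real \<Rightarrow> real"
  assumes "\<And>u. u \<in> {0..t} \<Longrightarrow> \<bar>f u\<bar> \<le> B" and "t \<in> {0..1}" and "0 \<le> B"
  shows "\<bar>LINT u:{0..t}|lborel. f u\<bar> \<le> B"
proof (cases "set_integrable lborel {0..t} f")
  case True
  have "\<bar>LINT u:{0..t}|lborel. f u\<bar> \<le> (LINT u:{0..t}|lborel. \<bar>f u\<bar>)"
    unfolding set_lebesgue_integral_def
    by (rule order_trans[OF integral_abs_bound]) (auto simp: abs_mult)
  also have "\<dots> \<le> (LINT u:{0..t}|lborel. B)"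
  proof (rule set_integral_mono)
    show "set_integrable lborel {0..t} (\<lambda>u. B)"
      by (rule set_integrable_bounded[where B="\<bar>B\<bar>"]) (auto simp: set_borel_measurable_def)
  qed (use assms True in \<open>auto intro: set_integrable_abs\<close>)
  also have "\<dots> = B * t" using assms by (simp add: set_lebesgue_integral_def)
  also have "\<dots> \<le> B" using assms by (simp add: mult_left_le)
  finally show ?thesis .
next
  case False
  then show ?thesis using assms
    by (simp add: set_integrable_def set_lebesgue_integral_def not_integrable_integral_eq)
qed

text \<open>
  Pointwise convergence of the coefficients suffices, because all integrands in the formula stay
  bounded. This makes the state probabilities continuous in the thresholds.
\<close>

lemma lin_sol_tendsto:
  assumes ma: "\<And>n. set_borel_measurable lborel {0..1} (a n)"
    and mb: "\<And>n. set_borel_measurable lborel {0..1} (b n)"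
    and ba: "\<And>n t. t \<in> {0..1} \<Longrightarrow> \<bar>a n t\<bar> \<le> B" and bb: "\<And>n t. t \<in> {0..1} \<Longrightarrow> \<bar>b n t\<bar> \<le> B"
    and la: "\<And>t. t \<in> {0..1} \<Longrightarrow> (\<lambda>n. a n t) \<longlonglongrightarrow> a' t"
    and lb: "\<And>t. t \<in> {0..1} \<Longrightarrow> (\<lambda>n. b n t) \<longlonglongrightarrow> b' t"
    and t: "t \<in> {0..1}"
  shows "(\<lambda>n. lin_sol (a n) (b n) z t) \<longlonglongrightarrow> lin_sol a' b' z t"
proof -
  have "\<bar>a 0 0\<bar> \<le> B" by (rule ba) simp
  then have B0: "0 \<le> B" by linarith
  have sub: "set_borel_measurable lborel {0..u} f" if "set_borel_measurable lborel {0..1} f" "u \<in> {0..1}"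
    for u :: real and f :: "real \<Rightarrow> real"
    using that by (intro set_borel_measurable_subset[OF that(1)]) auto
  have A: "(\<lambda>n. LINT v:{0..u}|lborel. a n v) \<longlonglongrightarrow> (LINT v:{0..u}|lborel. a' v)" if "u \<in> {0..1}" for u
    using that ba la by (intro set_integral_bounded_convergence[where B=B] sub[OF ma]) auto
  have "(\<lambda>n. LINT u:{0..t}|lborel. exp (LINT v:{0..u}|lborel. a n v) * b n u)
      \<longlonglongrightarrow> (LINT u:{0..t}|lborel. exp (LINT v:{0..u}|lborel. a' v) * b' u)"
  proof (rule set_integral_bounded_convergence[where B="exp B * B"])
    fix n
    have "set_integrable lborel {0..1} (a n)" using ma ba by (rule set_integrable_bounded)
    then have "set_borel_measurable lborel {0..1} (\<lambda>u. exp (LINT v:{0..u}|lborel. a n v))"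
      by (rule has_time_deriv_measurable[OF exp_indefinite])
    then show "set_borel_measurable lborel {0..t} (\<lambda>u. exp (LINT v:{0..u}|lborel. a n v) * b n u)"
      using t by (intro sub[OF set_borel_measurable_mult[OF _ mb]]) auto
    fix u assume u: "u \<in> {0..t}"
    then have "\<bar>LINT v:{0..u}|lborel. a n v\<bar> \<le> B" using ba t B0 by (intro set_integral_abs_le) auto
    then show "\<bar>exp (LINT v:{0..u}|lborel. a n v) * b n u\<bar> \<le> exp B * B"
      using bb[of u n] u t by (auto simp: abs_mult intro!: mult_mono)
  next
    fix u assume "u \<in> {0..t}"
    then show "(\<lambda>n. exp (LINT v:{0..u}|lborel. a n v) * b n u) \<longlonglongrightarrow> exp (LINT v:{0..u}|lborel. a' v) * b' u"
      using t by (intro tendsto_intros A lb) auto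
  qed
  then show ?thesis unfolding lin_sol_def using A[OF t] by (intro tendsto_intros)
qed

lemma set_integral_sum:
  fixes f :: "'i \<Rightarrow> 'a \<Rightarrow> real"
  assumes "\<And>i. i \<in> I \<Longrightarrow> set_integrable M A (f i)"
  shows "set_integrable M A (\<lambda>x. \<Sum>i\<in>I. f i x)"
    and "(LINT x:A|M. \<Sum>i\<in>I. f i x) = (\<Sum>i\<in>I. LINT x:A|M. f i x)"
  using assms unfolding set_integrable_def set_lebesgue_integral_def
  by (simp_all add: sum_distrib_left Bochner_Integration.integral_sum)

lemma set_integral_mono_interval:
  fixes f :: "real \<Rightarrow> real"
  assumes "set_integrable lborel {0..1} f" and "\<And>t. t \<in> {0..1} \<Longrightarrow> 0 \<le> f t" and "s \<le> t" and "t \<le> 1"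
  shows "(LINT u:{0..s}|lborel. f u) \<le> (LINT u:{0..t}|lborel. f u)"
  unfolding set_lebesgue_integral_def
proof (rule integral_mono)
  have *: "set_integrable lborel {0..r} f" if "r \<le> 1" for r
    using assms(1) that by (auto intro: set_integrable_subset)
  show "integrable lborel (\<lambda>x. indicat_real {0..s} x *\<^sub>R f x)" "integrable lborel (\<lambda>x. indicat_real {0..t} x *\<^sub>R f x)"
    using *[of s] *[of t] assms(3,4) unfolding set_integrable_def by auto
  show "indicat_real {0..s} x *\<^sub>R f x \<le> indicat_real {0..t} x *\<^sub>R f x" for x
    using assms(2)[of x] assms(3,4) by (auto simp: indicator_def)
qed

text \<open>
  The solution of \<open>x' = a x + b\<close> with \<open>x 1 = 0\<close>; its initial value cancels the integral in
  \<open>lin_sol\<close> at time \<open>1\<close>.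
\<close>

definition back_sol :: "(real \<Rightarrow> real) \<Rightarrow> (real \<Rightarrow> real) \<Rightarrow> real \<Rightarrow> real" where
  "back_sol a b = lin_sol (\<lambda>t. - a t) b
     (- (LINT u:{0..1}|lborel. exp (LINT v:{0..u}|lborel. - a v) * b u))"

lemma back_sol_1: "back_sol a b 1 = 0"
  by (simp add: back_sol_def lin_sol_def)

lemma has_time_deriv_back_sol:
  assumes a: "set_integrable lborel {0..1} a" and b: "set_integrable lborel {0..1} b"
  shows "has_time_deriv (back_sol a b) (\<lambda>t. a t * back_sol a b t + b t)"
proof -
  have "set_integrable lborel {0..1} (\<lambda>t. - a t)"
    using a by (simp add: set_integrable_def)
  from has_time_deriv_lin_sol[OF this b] show ?thesis unfolding back_sol_def by simp
qed

section \<open>The truncated Poisson mean\<close>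

text \<open>
  Closed form of \<open>P(N < K)\<close> for a Poisson variable \<open>N\<close> of mean \<open>c\<close>. As a formula it can be
  differentiated at every real \<open>c\<close>, including the boundary point \<open>0\<close>.
\<close>

definition Pois_below :: "nat \<Rightarrow> real \<Rightarrow> real" where
  "Pois_below K c = (\<Sum>j<K. c ^ j / fact j * exp (- c))"

lemma pmf_Pois:
  assumes "0 \<le> c"
  shows "pmf (Pois c) n = c ^ n / fact n * exp (- c)"
  using assms by (cases "c = 0") (auto simp: Pois_def indicator_def power_0_left)

lemma prob_Pois_less: 
  assumes "0 \<le> c"
  shows "measure_pmf.prob (Pois c) {..<K} = Pois_below K c"
  unfolding Pois_below_def by (subst measure_measure_pmf_finite) (simp_all add: pmf_Pois assms)

lemma prob_Pois_le:
  assumes "0 \<le> c" and "1 \<le> K"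
  shows "measure_pmf.prob (Pois c) {n. n \<le> K - 1} = Pois_below K c"
proof -
  have "{n. n \<le> K - 1} = {..<K}" using assms(2) by auto
  then show ?thesis using prob_Pois_less[OF assms(1)] by simp
qed

lemma Pois_below_le_1: "0 \<le> c \<Longrightarrow> Pois_below K c \<le> 1"
  by (metis prob_Pois_less measure_pmf.prob_le_1)

lemma Pois_below_pos:
  assumes "0 \<le> c" and "1 \<le> K"
  shows "0 < Pois_below K c"
  unfolding Pois_below_def
  by (rule sum_pos2[of _ 0]) (use assms in auto)

lemma Pois_below_0 [simp]: "1 \<le> K \<Longrightarrow> Pois_below K 0 = 1"
  by (cases K) (auto simp: Pois_below_def sum.lessThan_Suc_shift simp del: sum.lessThan_Suc)

lemma continuous_Pois_below: "isCont (Pois_below K) c"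
  unfolding Pois_below_def by (intro continuous_intros) auto

text \<open>
  Summing the tails \<open>P(N > j)\<close> over \<open>j < K\<close> gives the expectation of \<open>min N K\<close>.
\<close>

lemma Pois_min_eq:
  assumes "0 \<le> c"
  shows "Pois_min K c = (\<Sum>j<K. 1 - Pois_below (Suc j) c)"
proof -
  have min_eq: "real (min n K) = (\<Sum>j<K. 1 - indicator {..<Suc j} n)" for n
    by (induction K) (auto simp: indicator_def min_def)
  have int: "integrable (measure_pmf (Pois c)) (indicat_real {..<Suc j})" for j
    by (intro integrable_real_indicator) (auto simp: less_top[symmetric])
  have "Pois_min K c = (\<Sum>j<K. measure_pmf.expectation (Pois c) (\<lambda>n. 1 - indicator {..<Suc j} n))"
    unfolding Pois_min_def min_eq
    by (intro Bochner_Integration.integral_sum Bochner_Integration.integrable_diff int) auto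
  also have "\<dots> = (\<Sum>j<K. 1 - Pois_below (Suc j) c)"
  proof (intro sum.cong refl)
    fix j
    have "measure_pmf.expectation (Pois c) (\<lambda>n. 1 - indicator {..<Suc j} n) = 1 - measure_pmf.prob (Pois c) {..<Suc j}"
      by (subst Bochner_Integration.integral_diff[OF _ int]) auto
    then show "measure_pmf.expectation (Pois c) (\<lambda>n. 1 - indicator {..<Suc j} n) = 1 - Pois_below (Suc j) c"
      using prob_Pois_less[OF assms] by simp
  qed
  finally show ?thesis .
qed

text \<open>
  Differentiating a Poisson weight gives the difference of two neighbouring weights, so that only the
  last weight survives in the sum.
\<close>

lemma Pois_below_deriv:
  "((Pois_below (Suc j)) has_real_derivative - (c ^ j / fact j * exp (- c))) (at c)"
proof (induction j)
  case 0
  then show ?case unfolding Pois_below_def by (auto intro!: derivative_eq_intros)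
next
  case (Suc j)
  have eq: "Pois_below (Suc (Suc j)) = (\<lambda>c. Pois_below (Suc j) c + c ^ Suc j / fact (Suc j) * exp (- c))"
    by (auto simp: Pois_below_def)
  have "((\<lambda>c. c ^ Suc j / fact (Suc j) * exp (- c)) has_real_derivative
      (c ^ j / fact j - c ^ Suc j / fact (Suc j)) * exp (- c)) (at c)"
    by (rule derivative_eq_intros refl | simp)+ (simp add: field_simps del: of_nat_Suc)
  from DERIV_add[OF Suc this] show ?case unfolding eq by (simp add: algebra_simps)
qed

lemma Pois_min_sum_deriv:
  "((\<lambda>c. \<Sum>j<K. 1 - Pois_below (Suc j) c) has_real_derivative Pois_below K c) (at c)"
  unfolding Pois_below_def[of K]
  by (rule derivative_eq_intros Pois_below_deriv refl | simp)+

text \<open>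
  One more expected arrival is worth the probability that fewer than \<open>K\<close> others arrive.
\<close>

lemma Pois_min_mvt:
  assumes "0 \<le> a" and "a < b"
  obtains c where "a < c" and "c < b" and "Pois_min K b - Pois_min K a = (b - a) * Pois_below K c"
proof -
  from MVT2[OF assms(2) Pois_min_sum_deriv[of K]] show ?thesis
    using that assms by (auto simp: Pois_min_eq)
qed

lemma Pois_min_0 [simp]: "Pois_min K 0 = 0"
  by (simp add: Pois_min_def Pois_def)

lemma Pois_min_le:
  assumes "0 \<le> c"
  shows "Pois_min K c \<le> c"
proof (cases "c = 0")
  case False
  then obtain d where "0 < d" "Pois_min K c = c * Pois_below K d"
    using Pois_min_mvt[of 0 c K] assms by auto
  then show ?thesis using Pois_below_le_1[of d K] assms by (simp add: mult_left_le)
qed simp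

lemma Pois_min_pos:
  assumes "0 < c" and "1 \<le> K"
  shows "0 < Pois_min K c"
proof -
  obtain d where "0 < d" "Pois_min K c = c * Pois_below K d"
    using Pois_min_mvt[of 0 c K] assms by auto
  then show ?thesis using Pois_below_pos[of d K] assms by simp
qed

lemma Pois_min_mono:
  assumes "0 \<le> a" and "a \<le> b"
  shows "Pois_min K a \<le> Pois_min K b"
proof (cases "a = b")
  case False
  then obtain c where "a < c" "Pois_min K b - Pois_min K a = (b - a) * Pois_below K c"
    using Pois_min_mvt[of a b K] assms by auto
  moreover have "0 \<le> Pois_below K c" using \<open>a < c\<close> assms unfolding Pois_below_def by (auto intro!: sum_nonneg)
  ultimately show ?thesis using assms by (metis diff_ge_0_iff_ge mult_nonneg_nonneg)
qed simp

lemma continuous_on_Pois_min: "continuous_on {0..} (Pois_min K)"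
proof -
  have "continuous_on {0..} (\<lambda>c. \<Sum>j<K. 1 - Pois_below (Suc j) c)"
    by (intro continuous_at_imp_continuous_on ballI DERIV_isCont[OF Pois_min_sum_deriv])
  then show ?thesis by (rule continuous_on_eq) (simp add: Pois_min_eq)
qed

section \<open>Closed covers of cubes, and infima of continuous families\<close>

text \<open>
  Tychonoff's theorem. The points are sequences rather than vectors of a Euclidean space because the
  number of relevant coordinates will be the number \<open>m\<close> of thresholds, which is a variable.
\<close>

lemma compact_cube_fun:
  fixes b :: real
  shows "compact {x :: nat \<Rightarrow> real. \<forall>i. x i \<in> {0..b}}"
proof -
  have "compactin (product_topology (\<lambda>_::nat. euclidean :: real topology) UNIV) (PiE UNIV (\<lambda>_. {0..b}))"
    by (subst compactin_PiE) auto
  moreover have "PiE UNIV (\<lambda>_. {0..b}) = {x :: nat \<Rightarrow> real. \<forall>i. x i \<in> {0..b}}"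
    by (auto simp: PiE_def)
  ultimately show ?thesis
    by (simp add: euclidean_product_topology)
qed

text \<open>
  A Poincare--Miranda theorem for closed covers. Label the points of a fine grid, in each coordinate
  \<open>i\<close>, by whether they lie in \<open>A i\<close>. Kuhn's combinatorial lemma gives a grid cell in which every
  coordinate \<open>i\<close> shows both labels, so the cell has a corner in \<open>A i\<close> and a corner in \<open>B i\<close>. As the
  mesh tends to \<open>0\<close>, the cells accumulate at a point, and this point lies in all the closed sets.
\<close>

theorem closed_cover_poincare_miranda:
  fixes A B :: "nat \<Rightarrow> (nat \<Rightarrow> real) set" and b :: real and n :: nat
  defines "C \<equiv> {x :: nat \<Rightarrow> real. \<forall>i. x i \<in> {0..b}}"
  assumes b: "0 < b"
    and closed: "\<And>i. i < n \<Longrightarrow> closed (A i)" "\<And>i. i < n \<Longrightarrow> closed (B i)"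
    and cover: "\<And>i x. i < n \<Longrightarrow> x \<in> C \<Longrightarrow> x \<in> A i \<or> x \<in> B i"
    and low: "\<And>i x. i < n \<Longrightarrow> x \<in> C \<Longrightarrow> x i = 0 \<Longrightarrow> x \<in> A i"
    and high: "\<And>i x. i < n \<Longrightarrow> x \<in> C \<Longrightarrow> x i = b \<Longrightarrow> x \<in> B i"
  shows "\<exists>x\<in>C. \<forall>i<n. x \<in> A i \<and> x \<in> B i"
proof -
  \<comment> \<open>Coordinates beyond \<open>n\<close> are frozen at \<open>0\<close> to stay in the cube.\<close>
  define pt where "pt p z = (\<lambda>i. if i < n then b * real (z i) / real p else 0)" for p and z :: "nat \<Rightarrow> nat"
  define label where "label p z i = (if z i = p then 1 else if pt p z \<in> A i then 0 else (1::nat))"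
    for p :: nat and z :: "nat \<Rightarrow> nat" and i
  have ptC: "pt p z \<in> C" if "0 < p" "\<forall>i<n. z i \<le> p" for p z
    using that b unfolding C_def pt_def by (auto simp: field_simps)
  have lab0: "pt p z \<in> A i" if "label p z i = 0" for p z i
    using that by (auto simp: label_def split: if_splits)
  have lab1: "pt p z \<in> B i" if "label p z i \<noteq> 0" "i < n" "0 < p" "\<forall>i<n. z i \<le> p" for p z i
  proof (cases "z i = p")
    case True
    then have "pt p z i = b" using that by (simp add: pt_def)
    then show ?thesis using high[OF that(2) ptC[OF that(3,4)]] by simp
  next
    case False
    then have "pt p z \<notin> A i" using that(1) by (auto simp: label_def split: if_splits)
    then show ?thesis using cover[OF that(2) ptC[OF that(3,4)]] by simp
  qed
  have "\<exists>q. (\<forall>i<n. q i < Suc p) \<and> (\<forall>i<n. \<exists>r s. (\<forall>j<n. q j \<le> r j \<and> r j \<le> q j + 1) \<and>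
      (\<forall>j<n. q j \<le> s j \<and> s j \<le> q j + 1) \<and> label (Suc p) r i \<noteq> label (Suc p) s i)" for p
  proof -
    have k0: "0 < Suc p" by simp
    have k1: "\<forall>x. (\<forall>i<n. x i \<le> Suc p) \<longrightarrow> (\<forall>i<n. label (Suc p) x i = 0 \<or> label (Suc p) x i = 1)"
      by (simp add: label_def)
    have k2: "\<forall>x. (\<forall>i<n. x i \<le> Suc p) \<longrightarrow> (\<forall>i<n. x i = 0 \<longrightarrow> label (Suc p) x i = 0)"
    proof (intro allI impI)
      fix x :: "nat \<Rightarrow> nat" and i assume x: "\<forall>i<n. x i \<le> Suc p" "i < n" "x i = 0"
      have "pt (Suc p) x i = 0" using x by (simp add: pt_def)
      then show "label (Suc p) x i = 0" using low[OF x(2) ptC[OF k0 x(1)]] x(3) by (simp add: label_def)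
    qed
    have k3: "\<forall>x. (\<forall>i<n. x i \<le> Suc p) \<longrightarrow> (\<forall>i<n. x i = Suc p \<longrightarrow> label (Suc p) x i = 1)"
      by (simp add: label_def)
    show ?thesis by (rule kuhn_lemma[OF k0 k1 k2 k3]) blast
  qed
  then have "\<exists>q. \<forall>p. (\<forall>i<n. q p i < Suc p) \<and> (\<forall>i<n. \<exists>r s. (\<forall>j<n. q p j \<le> r j \<and> r j \<le> q p j + 1) \<and>
      (\<forall>j<n. q p j \<le> s j \<and> s j \<le> q p j + 1) \<and> label (Suc p) r i \<noteq> label (Suc p) s i)"
    by (intro choice allI)
  then obtain q where q: "\<And>p i. i < n \<Longrightarrow> q p i < Suc p"
    and cell: "\<And>p i. i < n \<Longrightarrow> \<exists>r s. (\<forall>j<n. q p j \<le> r j \<and> r j \<le> q p j + 1) \<and>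
      (\<forall>j<n. q p j \<le> s j \<and> s j \<le> q p j + 1) \<and> label (Suc p) r i \<noteq> label (Suc p) s i"
    by blast
  have near: "\<exists>u v. u \<in> A i \<and> v \<in> B i \<and> (\<forall>j. \<bar>u j - pt (Suc p) (q p) j\<bar> \<le> b / real (Suc p))
      \<and> (\<forall>j. \<bar>v j - pt (Suc p) (q p) j\<bar> \<le> b / real (Suc p))" if i: "i < n" for p i
  proof -
    have close: "\<bar>pt (Suc p) r j - pt (Suc p) (q p) j\<bar> \<le> b / real (Suc p)"
      if "\<forall>j<n. q p j \<le> r j \<and> r j \<le> q p j + 1" for r j
    proof (cases "j < n")
      case True
      then have "\<bar>real (r j) - real (q p j)\<bar> \<le> 1" using that by force
      moreover have "pt (Suc p) r j - pt (Suc p) (q p) j = b * (real (r j) - real (q p j)) / real (Suc p)"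
        using True by (simp add: pt_def right_diff_distrib diff_divide_distrib)
      ultimately show ?thesis using b by (simp add: abs_mult divide_right_mono mult_left_le)
    qed (use b in \<open>simp add: pt_def\<close>)
    have bound: "\<forall>i<n. r i \<le> Suc p" if "\<forall>j<n. q p j \<le> r j \<and> r j \<le> q p j + 1" for r
      using that q[of _ p] by fastforce
    obtain r s where rs: "\<forall>j<n. q p j \<le> r j \<and> r j \<le> q p j + 1" "\<forall>j<n. q p j \<le> s j \<and> s j \<le> q p j + 1"
      and ne: "label (Suc p) r i \<noteq> label (Suc p) s i" using cell[OF i] by blast
    show ?thesis
    proof (cases "label (Suc p) r i = 0")
      case True
      then have ns: "label (Suc p) s i \<noteq> 0" using ne by simp
      show ?thesis
        using lab0[OF True] lab1[OF ns i _ bound[OF rs(2)]] close[OF rs(1)] close[OF rs(2)]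
        by (intro exI[of _ "pt (Suc p) r"] exI[of _ "pt (Suc p) s"]) simp
    next
      case False
      then have "label (Suc p) s i = 0" using ne by (auto simp: label_def split: if_splits)
      then show ?thesis using lab0 lab1[OF False i _ bound[OF rs(1)]] close[OF rs(1)] close[OF rs(2)]
        by (intro exI[of _ "pt (Suc p) s"] exI[of _ "pt (Suc p) r"]) simp
    qed
  qed
  have "\<forall>p. pt (Suc p) (q p) \<in> C"
    by (intro allI ptC) (use q in \<open>auto intro: less_imp_le\<close>)
  then have "\<exists>l\<in>C. \<exists>h. strict_mono h \<and> ((\<lambda>p. pt (Suc p) (q p)) \<circ> h) \<longlonglongrightarrow> l"
    by (rule mp[OF spec[OF compact_cube_fun[of b, folded C_def, unfolded compact_def], of "\<lambda>p. pt (Suc p) (q p)"]])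
  then obtain x h where x: "x \<in> C" and h: "strict_mono h"
    and lim: "((\<lambda>p. pt (Suc p) (q p)) \<circ> h) \<longlonglongrightarrow> x"
    by blast
  have lim_j: "(\<lambda>p. pt (Suc (h p)) (q (h p)) j) \<longlonglongrightarrow> x j" for j
    using continuous_on_tendsto_compose[OF continuous_on_product_coordinates[of j] lim]
    by (simp add: o_def)
  have "(\<lambda>p. b / real (Suc p)) \<longlonglongrightarrow> 0"
    using tendsto_mult_right_zero[OF LIMSEQ_inverse_real_of_nat, of b] by (simp add: field_simps)
  from LIMSEQ_subseq_LIMSEQ[OF this h] have lim0: "(\<lambda>p. b / real (Suc (h p))) \<longlonglongrightarrow> 0"
    by (simp add: o_def)
  have mem: "x \<in> S" if S: "closed S" "\<And>p. u p \<in> S"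
      "\<And>p j. \<bar>u p j - pt (Suc (h p)) (q (h p)) j\<bar> \<le> b / real (Suc (h p))"
    for S and u :: "nat \<Rightarrow> nat \<Rightarrow> real"
  proof -
    have "(\<lambda>p. u p j) \<longlonglongrightarrow> x j" for j
    proof -
      have "(\<lambda>p. u p j - pt (Suc (h p)) (q (h p)) j) \<longlonglongrightarrow> 0"
        by (rule Lim_null_comparison[OF _ lim0]) (use S(3) in auto)
      from tendsto_add[OF this lim_j[of j]] show ?thesis by simp
    qed
    then have "u \<longlonglongrightarrow> x"
      using limitin_componentwise[of "\<lambda>_. euclidean" UNIV u x sequentially]
      by (simp add: euclidean_product_topology)
    then show ?thesis using closed_sequentially[OF S(1)] S(2) by blast
  qed
  show ?thesis
  proof (intro bexI[OF _ x] allI impI)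
    fix i assume i: "i < n"
    let ?close = "\<lambda>p u. \<forall>j. \<bar>u j - pt (Suc p) (q p) j\<bar> \<le> b / real (Suc p)"
    have "\<exists>u. \<forall>p. \<exists>v. u p \<in> A i \<and> v \<in> B i \<and> ?close p (u p) \<and> ?close p v"
      by (intro choice allI near[OF i])
    then obtain u where "\<forall>p. \<exists>v. u p \<in> A i \<and> v \<in> B i \<and> ?close p (u p) \<and> ?close p v" ..
    then have "\<exists>v. \<forall>p. u p \<in> A i \<and> v p \<in> B i \<and> ?close p (u p) \<and> ?close p (v p)"
      by (rule choice)
    then obtain v where "\<forall>p. u p \<in> A i \<and> v p \<in> B i \<and> ?close p (u p) \<and> ?close p (v p)" ..
    then show "x \<in> A i \<and> x \<in> B i"
      using mem[OF closed(1)[OF i], of "\<lambda>p. u (h p)"] mem[OF closed(2)[OF i], of "\<lambda>p. v (h p)"] by auto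
  qed
qed

text \<open>
  By uniform continuity on the compact product, all values \<open>f x u\<close> change by at most \<open>e / 2\<close>
  simultaneously, and then so does their infimum.
\<close>

lemma continuous_on_INF_interval:
  fixes f :: "'a::metric_space \<Rightarrow> real \<Rightarrow> real"
  assumes S: "compact S" and f: "continuous_on (S \<times> {0..1}) (\<lambda>(x, u). f x u)"
  shows "continuous_on S (\<lambda>x. INF u\<in>{0..1}. f x u)"
  unfolding continuous_on_iff
proof (intro ballI allI impI)
  fix x and e :: real assume x: "x \<in> S" and e: "0 < e"
  have "uniformly_continuous_on (S \<times> {0..1}) (\<lambda>(x, u). f x u)"
    by (rule compact_uniformly_continuous[OF f]) (intro compact_Times S compact_Icc)
  then have "\<exists>d>0. \<forall>p\<in>S \<times> {0..1}. \<forall>p'\<in>S \<times> {0..1}. dist p' p < d \<longrightarrow>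
      dist ((\<lambda>(x, u). f x u) p') ((\<lambda>(x, u). f x u) p) < e / 2"
    using e unfolding uniformly_continuous_on_def by (metis half_gt_zero)
  then obtain d where d: "0 < d" and
    close: "\<And>p p'. p \<in> S \<times> {0..1} \<Longrightarrow> p' \<in> S \<times> {0..1} \<Longrightarrow> dist p' p < d \<Longrightarrow>
      dist ((\<lambda>(x, u). f x u) p') ((\<lambda>(x, u). f x u) p) < e / 2" by blast
  have bdd: "bdd_below ((\<lambda>u. f y u) ` {0..1})" if "y \<in> S" for y
  proof -
    have "continuous_on {0..1} (\<lambda>u. (\<lambda>(x, u). f x u) (y, u))"
      by (rule continuous_on_compose2[OF f]) (use that in \<open>auto intro!: continuous_intros\<close>)
    then have "compact ((\<lambda>u. f y u) ` {0..1})" by (intro compact_continuous_image) auto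
    then show ?thesis by (intro bounded_imp_bdd_below compact_imp_bounded)
  qed
  have one: "(INF u\<in>{0..1}. f y u) \<le> (INF u\<in>{0..1}. f z u) + e / 2"
    if y: "y \<in> S" and z: "z \<in> S" and yz: "dist y z < d" for y z
  proof -
    have "(INF u\<in>{0..1}. f y u) - e / 2 \<le> (INF u\<in>{0..1}. f z u)"
    proof (rule cINF_greatest)
      fix u :: real assume u: "u \<in> {0..1}"
      have "dist (f y u) (f z u) < e / 2"
        using close[of "(z, u)" "(y, u)"] y z u yz by (simp add: dist_Pair_Pair)
      moreover have "(INF u\<in>{0..1}. f y u) \<le> f y u" by (rule cINF_lower[OF bdd[OF y] u])
      ultimately show "(INF u\<in>{0..1}. f y u) - e / 2 \<le> f z u" unfolding dist_real_def by linarith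
    qed simp
    then show ?thesis by simp
  qed
  show "\<exists>d>0. \<forall>x'\<in>S. dist x' x < d \<longrightarrow> dist (INF u\<in>{0..1}. f x' u) (INF u\<in>{0..1}. f x u) < e"
  proof (intro exI[of _ d] conjI ballI impI d)
    fix y assume y: "y \<in> S" "dist y x < d"
    show "dist (INF u\<in>{0..1}. f y u) (INF u\<in>{0..1}. f x u) < e"
      using one[OF y(1) x y(2)] one[OF x y(1)] y(2) e unfolding dist_real_def
      by (simp add: dist_commute dist_real_def abs_less_iff)
  qed
qed

section \<open>Pure death chains\<close>

text \<open>
  Each state of the chain is fed by the next higher one, hence the recursion over the number of steps
  below the initial state \<open>K\<close>.
\<close>

primrec chain_down :: "nat \<Rightarrow> (nat \<Rightarrow> real \<Rightarrow> real) \<Rightarrow> nat \<Rightarrow> real \<Rightarrow> real" where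
  "chain_down K a 0 = lin_sol (a K) (\<lambda>_. 0) 1"
| "chain_down K a (Suc n) = lin_sol (a (K - Suc n)) (\<lambda>t. a (K - n) t * chain_down K a n t) 0"

text \<open>
  The probability of state \<open>k\<close> at time \<open>t\<close>, for the pure death chain that starts in state \<open>K\<close> and
  leaves state \<open>j\<close> at rate \<open>a j t\<close>.
\<close>

definition death :: "nat \<Rightarrow> (nat \<Rightarrow> real \<Rightarrow> real) \<Rightarrow> nat \<Rightarrow> real \<Rightarrow> real" where
  "death K a k = chain_down K a (K - k)"

lemma death_top: "death K a K = lin_sol (a K) (\<lambda>_. 0) 1"
  by (simp add: death_def)

lemma death_step:
  assumes "k < K"
  shows "death K a k = lin_sol (a k) (\<lambda>t. a (Suc k) t * death K a (Suc k) t) 0"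
proof -
  have "K - k = Suc (K - Suc k)" "K - Suc (K - Suc k) = k" "K - (K - Suc k) = Suc k" using assms by auto
  then show ?thesis by (simp add: death_def)
qed

locale death_rates =
  fixes K :: nat and M :: real and a :: "nat \<Rightarrow> real \<Rightarrow> real"
  assumes K_pos: "1 \<le> K"
    and rate_meas: "\<And>k. k \<in> {1..K} \<Longrightarrow> set_borel_measurable lborel {0..1} (a k)"
    and rate_nonneg: "\<And>k t. k \<in> {1..K} \<Longrightarrow> t \<in> {0..1} \<Longrightarrow> 0 \<le> a k t"
    and rate_le: "\<And>k t. k \<in> {1..K} \<Longrightarrow> t \<in> {0..1} \<Longrightarrow> a k t \<le> M"
begin

lemma rate_integrable:
  assumes "k \<in> {1..K}"
  shows "set_integrable lborel {0..1} (a k)"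
  by (rule set_integrable_bounded[where B=M]) (use rate_meas rate_nonneg rate_le assms in auto)

definition exit_flow :: "nat \<Rightarrow> real \<Rightarrow> real" where
  "exit_flow k t = (if k \<le> K then a k t * death K a k t else 0)"

lemma death_0: "k \<in> {1..K} \<Longrightarrow> death K a k 0 = (if k = K then 1 else 0)"
  by (cases "k = K") (auto simp: death_top death_step)

lemma death_deriv_nonneg:
  assumes "k \<in> {1..K}"
  shows "has_time_deriv (death K a k) (\<lambda>t. - (exit_flow k t - exit_flow (Suc k) t)) \<and> (\<forall>t\<in>{0..1}. 0 \<le> death K a k t)"
proof -
  have "1 \<le> k \<longrightarrow> has_time_deriv (death K a k) (\<lambda>t. - (exit_flow k t - exit_flow (Suc k) t)) \<and> (\<forall>t\<in>{0..1}. 0 \<le> death K a k t)"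
    if "k \<le> K"
    using that
  proof (induction rule: inc_induct)
    case base
    have "has_time_deriv (death K a K) (\<lambda>t. - (exit_flow K t - exit_flow (Suc K) t))"
      by (rule has_time_deriv_cong[OF has_time_deriv_lin_sol[OF rate_integrable[of K], of "\<lambda>_. 0" 1]])
         (use K_pos in \<open>auto simp: death_top exit_flow_def set_integrable_def\<close>)
    then show ?case by (auto simp: death_top intro!: lin_sol_nonneg)
  next
    case (step k)
    show ?case
    proof
      assume k: "1 \<le> k"
      then have IH: "has_time_deriv (death K a (Suc k)) (\<lambda>t. - (exit_flow (Suc k) t - exit_flow (Suc (Suc k)) t))"
        "\<And>t. t \<in> {0..1} \<Longrightarrow> 0 \<le> death K a (Suc k) t" using step by auto
      have int: "set_integrable lborel {0..1} (\<lambda>t. a (Suc k) t * death K a (Suc k) t)"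
        by (rule set_integrable_mult_continuous[OF rate_integrable has_time_deriv_continuous[OF IH(1)]])
           (use step in auto)
      have "has_time_deriv (death K a k) (\<lambda>t. - (exit_flow k t - exit_flow (Suc k) t))"
        by (rule has_time_deriv_cong[OF has_time_deriv_lin_sol[OF rate_integrable[of k] int, of 0]])
           (use step k in \<open>auto simp: death_step exit_flow_def\<close>)
      moreover have "0 \<le> death K a k t" if "t \<in> {0..1}" for t
        unfolding death_step[OF step(2)]
        by (rule lin_sol_nonneg) (use that IH(2) step rate_nonneg in auto)
      ultimately show "has_time_deriv (death K a k) (\<lambda>t. - (exit_flow k t - exit_flow (Suc k) t)) \<and> (\<forall>t\<in>{0..1}. 0 \<le> death K a k t)"
        by blast
    qed
  qed
  then show ?thesis using assms by simp
qed

lemma death_deriv: "k \<in> {1..K} \<Longrightarrow> has_time_deriv (death K a k) (\<lambda>t. - (exit_flow k t - exit_flow (Suc k) t))"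
  using death_deriv_nonneg by blast

lemma death_nonneg: "k \<in> {1..K} \<Longrightarrow> t \<in> {0..1} \<Longrightarrow> 0 \<le> death K a k t"
  using death_deriv_nonneg by blast

definition mass_above :: "nat \<Rightarrow> real \<Rightarrow> real" where
  "mass_above l t = (\<Sum>k=Suc l..K. death K a k t)"

text \<open>
  Flows between states above \<open>l\<close> cancel; mass is lost through state \<open>l + 1\<close> only.
\<close>

lemma mass_above_deriv:
  assumes "l < K"
  shows "has_time_deriv (mass_above l) (\<lambda>t. - exit_flow (Suc l) t)"
proof (rule has_time_deriv_cong)
  show "has_time_deriv (\<lambda>t. \<Sum>k=Suc l..K. death K a k t)
      (\<lambda>t. \<Sum>k=Suc l..K. - (exit_flow k t - exit_flow (Suc k) t))"
    by (intro has_time_deriv_sum death_deriv) auto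
  fix t
  have "(\<Sum>k=Suc l..K. exit_flow (Suc k) t - exit_flow k t) = exit_flow (Suc K) t - exit_flow (Suc l) t"
    using assms by (intro sum_Suc_diff) auto
  then show "(\<Sum>k=Suc l..K. - (exit_flow k t - exit_flow (Suc k) t)) = - exit_flow (Suc l) t"
    by (simp add: exit_flow_def)
qed (simp add: mass_above_def)

lemma exit_flow_nonneg: "1 \<le> k \<Longrightarrow> t \<in> {0..1} \<Longrightarrow> 0 \<le> exit_flow k t"
  unfolding exit_flow_def using rate_nonneg death_nonneg by auto

lemma exit_flow_integrable:
  assumes "1 \<le> k"
  shows "set_integrable lborel {0..1} (exit_flow k)"
proof (cases "k \<le> K")
  case True
  then have "set_integrable lborel {0..1} (\<lambda>t. a k t * death K a k t)"
    using assms by (intro set_integrable_mult_continuous rate_integrable has_time_deriv_continuous[OF death_deriv]) auto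
  then show ?thesis using True by (simp add: exit_flow_def[abs_def])
next
  case False
  then show ?thesis by (simp add: exit_flow_def[abs_def] set_integrable_def)
qed

lemma mass_above_antimono:
  assumes "l < K" and "0 \<le> s" and "s \<le> t" and "t \<le> 1"
  shows "mass_above l t \<le> mass_above l s"
proof -
  have eq: "mass_above l u = mass_above l 0 - (LINT v:{0..u}|lborel. exit_flow (Suc l) v)" if "u \<in> {0..1}" for u
    using has_time_deriv_eq[OF mass_above_deriv[OF assms(1)] that] has_time_deriv_integrable[OF mass_above_deriv[OF assms(1)], of u] that
    by (simp add: set_lebesgue_integral_def)
  show ?thesis
    using set_integral_mono_interval[OF exit_flow_integrable[of "Suc l"], of s t] exit_flow_nonneg assms
      eq[of s] eq[of t] by simp
qed

lemma mass_above_0: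
  assumes "l < K"
  shows "mass_above l 0 = 1"
proof -
  have "mass_above l 0 = (\<Sum>k=Suc l..K. if k = K then 1 else 0)"
    unfolding mass_above_def by (intro sum.cong refl) (auto simp: death_0)
  then show ?thesis using assms by simp
qed

lemma death_le_mass: "k \<in> {Suc l..K} \<Longrightarrow> t \<in> {0..1} \<Longrightarrow> death K a k t \<le> mass_above l t"
  unfolding mass_above_def by (rule member_le_sum) (auto intro: death_nonneg)

lemma death_le_1:
  assumes "k \<in> {1..K}" and "t \<in> {0..1}"
  shows "death K a k t \<le> 1"
  using death_le_mass[of k 0 t] mass_above_antimono[of 0 0 t] mass_above_0[of 0] K_pos assms by auto

lemma death_measurable: "k \<in> {1..K} \<Longrightarrow> set_borel_measurable lborel {0..1} (death K a k)"
  using has_time_deriv_measurable[OF death_deriv] .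

text \<open>
  State \<open>1\<close> is the only exit from the positive states, and its probability is at most \<open>1\<close>.
\<close>

lemma total_mass_ge: "mass_above 0 1 \<ge> 1 - (LINT t:{0..1}|lborel. a 1 t)"
proof -
  have "mass_above 0 1 = mass_above 0 0 - (LINT v:{0..1}|lborel. exit_flow (Suc 0) v)"
    using has_time_deriv_eq[OF mass_above_deriv[of 0], of 1] K_pos by (simp add: set_lebesgue_integral_def)
  moreover have "(LINT v:{0..1}|lborel. exit_flow (Suc 0) v) \<le> (LINT t:{0..1}|lborel. a 1 t)"
  proof (rule set_integral_mono[OF exit_flow_integrable rate_integrable])
    fix t :: real assume "t \<in> {0..1}"
    then show "exit_flow (Suc 0) t \<le> a 1 t"
      using death_le_1[of 1 t] rate_nonneg[of 1 t] K_pos by (auto simp: exit_flow_def mult_left_le)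
  qed (use K_pos in auto)
  ultimately show ?thesis using mass_above_0[of 0] K_pos by simp
qed

end

lemma death_tendsto:
  assumes rn: "\<And>n. death_rates K M (r n)"
    and lim: "\<And>k t. k \<in> {1..K} \<Longrightarrow> t \<in> {0..1} \<Longrightarrow> (\<lambda>n. r n k t) \<longlonglongrightarrow> a k t"
    and k: "k \<in> {1..K}" and t: "t \<in> {0..1}"
  shows "(\<lambda>n. death K (r n) k t) \<longlonglongrightarrow> death K a k t"
proof -
  have M0: "0 \<le> M"
    using death_rates.rate_nonneg[OF rn k, of 0 0] death_rates.rate_le[OF rn k, of 0 0] by simp
  have "1 \<le> k \<longrightarrow> (\<forall>t\<in>{0..1}. (\<lambda>n. death K (r n) k t) \<longlonglongrightarrow> death K a k t)" if "k \<le> K" for k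
    using that
  proof (induction rule: inc_induct)
    case base
    have "(\<lambda>n. lin_sol (r n K) (\<lambda>_. 0) 1 t) \<longlonglongrightarrow> lin_sol (a K) (\<lambda>_. 0) 1 t" if "1 \<le> K" "t \<in> {0..1}" for t
      using that death_rates.rate_meas[OF rn, of K] death_rates.rate_nonneg[OF rn, of K] death_rates.rate_le[OF rn, of K] lim M0
      by (intro lin_sol_tendsto[where B=M]) (auto simp: set_borel_measurable_def intro: order_trans)
    then show ?case by (simp add: death_top)
  next
    case (step j)
    have "(\<lambda>n. lin_sol (r n j) (\<lambda>t. r n (Suc j) t * death K (r n) (Suc j) t) 0 t)
        \<longlonglongrightarrow> lin_sol (a j) (\<lambda>t. a (Suc j) t * death K a (Suc j) t) 0 t" if j: "1 \<le> j" and t: "t \<in> {0..1}" for t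
    proof (rule lin_sol_tendsto[where B=M, OF _ _ _ _ _ _ t])
      have mem: "j \<in> {1..K}" "Suc j \<in> {1..K}" using j step by auto
      show "set_borel_measurable lborel {0..1} (r n j)" for n
        using death_rates.rate_meas[OF rn mem(1)] .
      show "set_borel_measurable lborel {0..1} (\<lambda>t. r n (Suc j) t * death K (r n) (Suc j) t)" for n
        by (intro set_borel_measurable_mult death_rates.rate_meas[OF rn mem(2)] death_rates.death_measurable[OF rn mem(2)])
      fix n and s :: real assume s: "s \<in> {0..1}"
      show "\<bar>r n j s\<bar> \<le> M"
        using death_rates.rate_nonneg[OF rn mem(1) s, of n] death_rates.rate_le[OF rn mem(1) s, of n] by simp
      have b: "0 \<le> r n (Suc j) s" "r n (Suc j) s \<le> M" "0 \<le> death K (r n) (Suc j) s" "death K (r n) (Suc j) s \<le> 1"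
        using death_rates.rate_nonneg[OF rn mem(2) s] death_rates.rate_le[OF rn mem(2) s]
          death_rates.death_nonneg[OF rn mem(2) s] death_rates.death_le_1[OF rn mem(2) s] by auto
      have "r n (Suc j) s * death K (r n) (Suc j) s \<le> r n (Suc j) s * 1" using b by (intro mult_left_mono) auto
      then show "\<bar>r n (Suc j) s * death K (r n) (Suc j) s\<bar> \<le> M" using b by simp
    next
      fix s :: real assume s: "s \<in> {0..1}"
      show "(\<lambda>n. r n j s) \<longlonglongrightarrow> a j s" using lim[of j s] s j step by simp
      show "(\<lambda>n. r n (Suc j) s * death K (r n) (Suc j) s) \<longlonglongrightarrow> a (Suc j) s * death K a (Suc j) s"
        using lim[of "Suc j" s] s j step by (intro tendsto_mult) auto
    qed
    then show ?case using step by (simp add: death_step)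
  qed
  then show ?thesis using k t by simp
qed

section \<open>Switching vectors\<close>

lemma switching_vector_antimono:
  assumes "switching_vector K m s" and "1 \<le> i" and "i \<le> j" and "j \<le> Suc m"
  shows "s j \<le> s i"
  using assms(3,4)
proof (induction j rule: dec_induct)
  case (step n)
  then have "s (Suc n) < s n" using assms unfolding switching_vector_def by auto
  then show ?case using step by auto
qed simp

lemma seg_props:
  assumes sv: "switching_vector K m s" and k: "k \<in> {1..K}"
  shows "seg m s k \<in> {1..m}" and "s (Suc (seg m s k)) < k" and "k \<le> s (seg m s k)"
proof -
  have s1: "s 1 = K" and sm: "s (Suc m) = 0" using sv unfolding switching_vector_def by auto
  define i where "i = Max {i \<in> {1..m}. k \<le> s i}"
  have m1: "1 \<le> m" using s1 sm k by (cases m) auto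
  then have ne: "{i \<in> {1..m}. k \<le> s i} \<noteq> {}" using s1 k by force
  then have i: "i \<in> {1..m}" "k \<le> s i" using Max_in[OF _ ne] unfolding i_def by auto
  have "s (Suc i) < k"
  proof (rule ccontr)
    assume "\<not> s (Suc i) < k"
    then have "k \<le> s (Suc i)" "Suc i \<in> {1..m}" using i sm k by (cases "i = m"; auto)+
    then have "Suc i \<le> i" unfolding i_def by (intro Max_ge) auto
    then show False by simp
  qed
  moreover have "j = i" if "j \<in> {1..m}" "s (Suc j) < k" "k \<le> s j" for j
  proof (rule antisym)
    show "j \<le> i" using that unfolding i_def by (intro Max_ge) auto
    show "i \<le> j"
    proof (rule ccontr)
      assume "\<not> i \<le> j"
      then have "s i \<le> s (Suc j)" using switching_vector_antimono[OF sv, of "Suc j" i] i by auto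
      then show False using that(2) i(2) by simp
    qed
  qed
  ultimately have "\<exists>!i. i \<in> {1..m} \<and> s (Suc i) < k \<and> k \<le> s i" using i by blast
  from theI'[OF this] show "seg m s k \<in> {1..m}" and "s (Suc (seg m s k)) < k" and "k \<le> s (seg m s k)"
    unfolding seg_def by auto
qed

lemma le_switch_iff:
  assumes sv: "switching_vector K m s" and k: "k \<in> {1..K}" and i: "i \<le> m"
  shows "k \<le> s (Suc i) \<longleftrightarrow> i < seg m s k"
proof
  assume k': "k \<le> s (Suc i)"
  show "i < seg m s k"
  proof (rule ccontr)
    assume "\<not> i < seg m s k"
    then have "s (Suc i) \<le> s (Suc (seg m s k))"
      using switching_vector_antimono[OF sv, of "Suc (seg m s k)" "Suc i"] i by auto
    then show False using k' seg_props(2)[OF sv k] by simp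
  qed
next
  assume "i < seg m s k"
  then have "s (seg m s k) \<le> s (Suc i)"
    using switching_vector_antimono[OF sv, of "Suc i" "seg m s k"] seg_props(1)[OF sv k] by auto
  then show "k \<le> s (Suc i)" using seg_props(3)[OF sv k] by simp
qed

section \<open>Sales and benchmark of a demand curve\<close>

text \<open>
  The argument for the inequality sees an environment only through its demand curve: \<open>N q t\<close> is the
  rate at which customers of type at least \<open>q\<close> arrive at time \<open>t\<close>. It is a function of all real \<open>q\<close>,
  vanishing from \<open>q = 1\<close> on.
\<close>

locale demand =
  fixes K m :: nat and M :: real and s :: "nat \<Rightarrow> nat" and N :: "real \<Rightarrow> real \<Rightarrow> real"
  assumes K_pos: "1 \<le> K" and m_pos: "1 \<le> m" and switching: "switching_vector K m s"
    and N_meas: "\<And>q. set_borel_measurable borel {0..1} (N q)"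
    and N_nonneg: "\<And>q t. t \<in> {0..1} \<Longrightarrow> 0 \<le> N q t"
    and N_le: "\<And>q t. t \<in> {0..1} \<Longrightarrow> N q t \<le> M"
    and N_antimono: "\<And>q q' t. t \<in> {0..1} \<Longrightarrow> q \<le> q' \<Longrightarrow> N q' t \<le> N q t"
    and N_cont: "\<And>t. t \<in> {0..1} \<Longrightarrow> continuous_on UNIV (\<lambda>q. N q t)"
    and N_1: "\<And>t. t \<in> {0..1} \<Longrightarrow> N 1 t = 0"
    and N_strict: "\<And>q q'. 0 \<le> q \<Longrightarrow> q < q' \<Longrightarrow> q' \<le> 1 \<Longrightarrow>
      (LINT t:{0..1}|lborel. N q' t) < (LINT t:{0..1}|lborel. N q t)"
begin

definition total :: "real \<Rightarrow> real" where
  "total q = (LINT t:{0..1}|lborel. N q t)"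

definition rate :: "(nat \<Rightarrow> real) \<Rightarrow> nat \<Rightarrow> real \<Rightarrow> real" where
  "rate \<tau> k = N (\<tau> (seg m s k))"

abbreviation occ :: "(nat \<Rightarrow> real) \<Rightarrow> nat \<Rightarrow> real \<Rightarrow> real" where
  "occ \<tau> \<equiv> death K (rate \<tau>)"

text \<open>
  Expected number of sales to customers of type at least \<open>q\<close> under the thresholds \<open>\<tau>\<close>.
\<close>

definition sales :: "(nat \<Rightarrow> real) \<Rightarrow> real \<Rightarrow> real" where
  "sales \<tau> q = (\<Sum>k=1..K. LINT t:{0..1}|lborel. N (max q (\<tau> (seg m s k))) t * occ \<tau> k t)"

text \<open>
  The expected number of customers of type at least \<open>q\<close> that \<open>K\<close> units can serve when no unit is
  ever given to a lower type.
\<close>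

definition bench :: "real \<Rightarrow> real" where
  "bench q = Pois_min K (total q)"

lemma N_meas': "set_borel_measurable lborel {0..1} (N q)"
  using N_meas[of q] by (simp add: set_borel_measurable_def)

lemma death_rates_rate: "death_rates K M (rate \<tau>)"
  using K_pos by unfold_locales (auto simp: rate_def N_meas' intro: N_nonneg N_le)

lemma N_integrable: "set_integrable lborel {0..1} (N q)"
  by (rule set_integrable_bounded[where B=M, OF N_meas']) (use N_nonneg N_le in auto)

lemma M_nonneg: "0 \<le> M"
  using N_nonneg[of 0 0] N_le[of 0 0] by simp

lemma total_1: "total 1 = 0"
proof -
  have "total 1 = (LINT t:{0..1::real}|lborel. (0::real))"
    unfolding total_def by (rule set_lebesgue_integral_cong) (auto simp: N_1)
  then show ?thesis by simp
qed

lemma total_less: "0 \<le> q \<Longrightarrow> q < q' \<Longrightarrow> q' \<le> 1 \<Longrightarrow> total q' < total q"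
  unfolding total_def by (rule N_strict)

lemma total_pos: "0 \<le> q \<Longrightarrow> q < 1 \<Longrightarrow> 0 < total q"
  using total_less[of q 1] total_1 by simp

lemma total_nonneg: "0 \<le> q \<Longrightarrow> q \<le> 1 \<Longrightarrow> 0 \<le> total q"
  using total_pos[of q] total_1 by (cases "q = 1") auto

lemma bench_pos: "0 \<le> q \<Longrightarrow> q < 1 \<Longrightarrow> 0 < bench q"
  unfolding bench_def by (intro Pois_min_pos total_pos K_pos)

lemma bench_1 [simp]: "bench 1 = 0"
  by (simp add: bench_def total_1)

lemma N_tendsto:
  assumes "t \<in> {0..1}" and "q \<longlonglongrightarrow> q'"
  shows "(\<lambda>n. N (q n) t) \<longlonglongrightarrow> N q' t"
  using continuous_on_tendsto_compose[OF N_cont[OF assms(1)] assms(2)] by simp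

lemma total_tendsto:
  assumes "q \<longlonglongrightarrow> q'"
  shows "(\<lambda>n. total (q n)) \<longlonglongrightarrow> total q'"
  unfolding total_def
  by (rule set_integral_bounded_convergence[where B=M])
     (use N_meas' N_tendsto[OF _ assms] N_nonneg N_le in auto)

lemma bench_tendsto:
  assumes "q \<longlonglongrightarrow> q'" and "\<And>n. q n \<in> {0..1}" and "q' \<in> {0..1}"
  shows "(\<lambda>n. bench (q n)) \<longlonglongrightarrow> bench q'"
  unfolding bench_def
  by (rule continuous_on_tendsto_compose[OF continuous_on_Pois_min total_tendsto[OF assms(1)]])
     (use assms total_nonneg in auto)

lemma occ_props:
  assumes "k \<in> {1..K}"
  shows "set_borel_measurable lborel {0..1} (occ \<tau> k)"
    and "t \<in> {0..1} \<Longrightarrow> 0 \<le> occ \<tau> k t" and "t \<in> {0..1} \<Longrightarrow> occ \<tau> k t \<le> 1"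
  using death_rates.death_measurable[OF death_rates_rate assms] death_rates.death_nonneg[OF death_rates_rate assms]
    death_rates.death_le_1[OF death_rates_rate assms] by auto

lemma flow_bound:
  assumes "k \<in> {1..K}" and "t \<in> {0..1}"
  shows "0 \<le> N q t * occ \<tau> k t" and "N q t * occ \<tau> k t \<le> M"
proof -
  have "N q t * occ \<tau> k t \<le> N q t * 1" "0 \<le> N q t"
    using occ_props(3)[OF assms(1), of t \<tau>] assms(2) N_nonneg[of t q] by (auto intro: mult_left_le)
  then show "0 \<le> N q t * occ \<tau> k t" and "N q t * occ \<tau> k t \<le> M"
    using occ_props(2)[OF assms] N_le[OF assms(2), of q] by auto
qed

lemma flow_integrable:
  assumes "k \<in> {1..K}"
  shows "set_integrable lborel {0..1} (\<lambda>t. N q t * occ \<tau> k t)"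
  by (rule set_integrable_bounded[where B=M, OF set_borel_measurable_mult[OF N_meas' occ_props(1)[OF assms]]])
     (use flow_bound[OF assms] in auto)

lemma sales_nonneg: "0 \<le> sales \<tau> q"
  unfolding sales_def set_lebesgue_integral_def
  by (intro sum_nonneg Bochner_Integration.integral_nonneg) (use flow_bound(1) in \<open>force simp: indicator_def\<close>)

lemma occ_tendsto:
  assumes "\<And>i. i \<in> {1..m} \<Longrightarrow> (\<lambda>n. \<tau> n i) \<longlonglongrightarrow> \<tau>' i" and "k \<in> {1..K}" and "t \<in> {0..1}"
  shows "(\<lambda>n. occ (\<tau> n) k t) \<longlonglongrightarrow> occ \<tau>' k t"
proof (rule death_tendsto[OF death_rates_rate _ assms(2,3)])
  fix j :: nat and u :: real assume "j \<in> {1..K}" "u \<in> {0..1}"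
  then show "(\<lambda>n. rate (\<tau> n) j u) \<longlonglongrightarrow> rate \<tau>' j u"
    unfolding rate_def using seg_props(1)[OF switching] by (intro N_tendsto assms(1))
qed

lemma sales_tendsto:
  assumes \<tau>: "\<And>i. i \<in> {1..m} \<Longrightarrow> (\<lambda>n. \<tau> n i) \<longlonglongrightarrow> \<tau>' i" and q: "q \<longlonglongrightarrow> q'"
  shows "(\<lambda>n. sales (\<tau> n) (q n)) \<longlonglongrightarrow> sales \<tau>' q'"
  unfolding sales_def
proof (intro tendsto_sum set_integral_bounded_convergence[where B=M])
  fix k assume k: "k \<in> {1..K}"
  show "set_borel_measurable lborel {0..1} (\<lambda>t. N (max (q n) (\<tau> n (seg m s k))) t * occ (\<tau> n) k t)" for n
    by (intro set_borel_measurable_mult N_meas' occ_props(1)[OF k])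
  fix t :: real assume t: "t \<in> {0..1}"
  show "\<bar>N (max (q n) (\<tau> n (seg m s k))) t * occ (\<tau> n) k t\<bar> \<le> M" for n
    using flow_bound[OF k t] by auto
  show "(\<lambda>n. N (max (q n) (\<tau> n (seg m s k))) t * occ (\<tau> n) k t)
      \<longlonglongrightarrow> N (max q' (\<tau>' (seg m s k))) t * occ \<tau>' k t"
    by (intro tendsto_mult N_tendsto[OF t] tendsto_max q \<tau> seg_props(1)[OF switching k] occ_tendsto k t)
qed

text \<open>
  The probability that more than \<open>l\<close> units remain at the end.
\<close>

definition survivors :: "(nat \<Rightarrow> real) \<Rightarrow> nat \<Rightarrow> real" where
  "survivors \<tau> l = (\<Sum>k=Suc l..K. occ \<tau> k 1)"

lemma survivors_le_mass:
  assumes "l < K" and "t \<in> {0..1}"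
  shows "survivors \<tau> l \<le> (\<Sum>k=Suc l..K. occ \<tau> k t)"
  using death_rates.mass_above_antimono[OF death_rates_rate, of l t 1 \<tau>] assms
  unfolding survivors_def death_rates.mass_above_def[OF death_rates_rate] by auto

lemma survivors_nonneg: "0 \<le> survivors \<tau> l"
  unfolding survivors_def by (rule sum_nonneg) (auto intro: occ_props(2))

lemma survivors_tendsto:
  assumes "\<And>i. i \<in> {1..m} \<Longrightarrow> (\<lambda>n. \<tau> n i) \<longlonglongrightarrow> \<tau>' i"
  shows "(\<lambda>n. survivors (\<tau> n) l) \<longlonglongrightarrow> survivors \<tau>' l"
  unfolding survivors_def by (intro tendsto_sum occ_tendsto assms) auto

text \<open>
  Raising \<open>q\<close> to \<open>q'\<close> loses the sales to types in between. The states above \<open>l\<close> all accept these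
  types, and their joint mass never falls below its final value.
\<close>

lemma sales_diff_ge:
  assumes l: "l < K" and acc: "\<And>k. k \<in> {Suc l..K} \<Longrightarrow> \<tau> (seg m s k) \<le> q" and qq: "q \<le> q'"
  shows "survivors \<tau> l * (total q - total q') \<le> sales \<tau> q - sales \<tau> q'"
proof -
  let ?I = "\<lambda>q k. LINT t:{0..1}|lborel. N q t * occ \<tau> k t"
  have intl: "set_integrable lborel {0..1} (\<lambda>t. \<Sum>k=Suc l..K. (N q t - N q' t) * occ \<tau> k t)"
    by (intro set_integral_sum(1)) (auto simp: left_diff_distrib intro!: set_integral_diff(1) flow_integrable)
  have "survivors \<tau> l * (total q - total q') = (LINT t:{0..1}|lborel. survivors \<tau> l * (N q t - N q' t))"
    unfolding total_def using N_integrable by (simp add: set_integral_diff(2))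
  also have "\<dots> \<le> (LINT t:{0..1}|lborel. \<Sum>k=Suc l..K. (N q t - N q' t) * occ \<tau> k t)"
  proof (rule set_integral_mono[OF _ intl])
    show "set_integrable lborel {0..1} (\<lambda>t. survivors \<tau> l * (N q t - N q' t))"
      using N_integrable by (intro set_integrable_mult_right set_integral_diff(1))
    fix t :: real assume t: "t \<in> {0..1}"
    have "survivors \<tau> l * (N q t - N q' t) \<le> (\<Sum>k=Suc l..K. occ \<tau> k t) * (N q t - N q' t)"
      using survivors_le_mass[OF l t] N_antimono[OF t qq] by (intro mult_right_mono) auto
    then show "survivors \<tau> l * (N q t - N q' t) \<le> (\<Sum>k=Suc l..K. (N q t - N q' t) * occ \<tau> k t)"
      by (simp add: sum_distrib_left mult.commute)
  qed
  also have "\<dots> = (\<Sum>k=Suc l..K. LINT t:{0..1}|lborel. (N q t - N q' t) * occ \<tau> k t)"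
    by (rule set_integral_sum(2)) (auto simp: left_diff_distrib intro!: set_integral_diff(1) flow_integrable)
  also have "\<dots> = (\<Sum>k=Suc l..K. ?I (max q (\<tau> (seg m s k))) k - ?I (max q' (\<tau> (seg m s k))) k)"
  proof (rule sum.cong[OF refl])
    fix k assume k: "k \<in> {Suc l..K}"
    have "max q (\<tau> (seg m s k)) = q" "max q' (\<tau> (seg m s k)) = q'" using acc[OF k] qq by auto
    moreover have "(LINT t:{0..1}|lborel. (N q t - N q' t) * occ \<tau> k t) = ?I q k - ?I q' k"
      unfolding left_diff_distrib using k by (intro set_integral_diff(2) flow_integrable) auto
    ultimately show "(LINT t:{0..1}|lborel. (N q t - N q' t) * occ \<tau> k t)
        = ?I (max q (\<tau> (seg m s k))) k - ?I (max q' (\<tau> (seg m s k))) k" by simp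
  qed
  also have "\<dots> \<le> (\<Sum>k=1..K. ?I (max q (\<tau> (seg m s k))) k - ?I (max q' (\<tau> (seg m s k))) k)"
  proof (rule sum_mono2)
    fix k assume "k \<in> {1..K} - {Suc l..K}"
    then have k: "k \<in> {1..K}" by auto
    have "?I (max q' (\<tau> (seg m s k))) k \<le> ?I (max q (\<tau> (seg m s k))) k"
      using qq k by (intro set_integral_mono flow_integrable mult_right_mono N_antimono occ_props(2)) auto
    then show "0 \<le> ?I (max q (\<tau> (seg m s k))) k - ?I (max q' (\<tau> (seg m s k))) k" by simp
  qed auto
  also have "\<dots> = sales \<tau> q - sales \<tau> q'" by (simp add: sales_def sum_subtractf)
  finally show ?thesis .
qed

lemma sales_1:
  assumes "\<And>i. i \<in> {1..m} \<Longrightarrow> \<tau> i \<le> 1"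
  shows "sales \<tau> 1 = 0"
proof -
  have "(LINT t:{0..1}|lborel. N (max 1 (\<tau> (seg m s k))) t * occ \<tau> k t) = 0" if "k \<in> {1..K}" for k
  proof -
    have "max 1 (\<tau> (seg m s k)) = 1" using assms[OF seg_props(1)[OF switching that]] by auto
    then have "(LINT t:{0..1}|lborel. N (max 1 (\<tau> (seg m s k))) t * occ \<tau> k t) = (LINT t:{0..1::real}|lborel. (0::real))"
      by (intro set_lebesgue_integral_cong) (auto simp: N_1)
    then show ?thesis by simp
  qed
  then show ?thesis unfolding sales_def by (intro sum.neutral) auto
qed

text \<open>
  Above all thresholds, customers are served as long as there is stock, which at every time is at least
  as likely as at the end; and the benchmark is at most the expected number of these customers.
\<close>

lemma sales_ge_survivors:
  assumes "\<And>i. i \<in> {1..m} \<Longrightarrow> \<tau> i \<le> q" and "0 \<le> q" and "q \<le> 1"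
  shows "survivors \<tau> 0 * bench q \<le> sales \<tau> q"
proof -
  have "survivors \<tau> 0 * (total q - total 1) \<le> sales \<tau> q - sales \<tau> 1"
    using assms seg_props(1)[OF switching] K_pos by (intro sales_diff_ge) auto
  moreover have "sales \<tau> 1 = 0" using assms by (intro sales_1) (auto intro: order_trans)
  moreover have "survivors \<tau> 0 * bench q \<le> survivors \<tau> 0 * total q"
    unfolding bench_def using assms by (intro mult_left_mono survivors_nonneg Pois_min_le total_nonneg)
  ultimately show ?thesis by (simp add: total_1)
qed

lemma sales_split:
  assumes i: "i < m" and mono: "\<And>i j. 1 \<le> i \<Longrightarrow> i \<le> j \<Longrightarrow> j \<le> m \<Longrightarrow> \<tau> i \<le> \<tau> j"
    and q: "1 \<le> i \<Longrightarrow> \<tau> i \<le> q" "q \<le> \<tau> (Suc i)"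
  shows "sales \<tau> q = (\<Sum>k=1..s (Suc i). LINT t:{0..1}|lborel. N (\<tau> (seg m s k)) t * occ \<tau> k t)
    + (\<Sum>k=s (Suc i) + 1..K. LINT t:{0..1}|lborel. N q t * occ \<tau> k t)"
proof -
  have sK: "s (Suc i) \<le> K"
    using switching_vector_antimono[OF switching, of 1 "Suc i"] switching i unfolding switching_vector_def by auto
  have "{1..K} = {1..s (Suc i)} \<union> {s (Suc i) + 1..K}" using sK by auto
  then have "sales \<tau> q = (\<Sum>k=1..s (Suc i). LINT t:{0..1}|lborel. N (max q (\<tau> (seg m s k))) t * occ \<tau> k t)
    + (\<Sum>k=s (Suc i) + 1..K. LINT t:{0..1}|lborel. N (max q (\<tau> (seg m s k))) t * occ \<tau> k t)"
    unfolding sales_def by (simp add: sum.union_disjoint)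
  moreover have "max q (\<tau> (seg m s k)) = \<tau> (seg m s k)" if "k \<in> {1..s (Suc i)}" for k
  proof -
    have "k \<in> {1..K}" using that sK by auto
    then have "\<tau> (Suc i) \<le> \<tau> (seg m s k)"
      using le_switch_iff[OF switching, of k i] seg_props(1)[OF switching, of k] i that by (intro mono) auto
    then show ?thesis using q by simp
  qed
  moreover have "max q (\<tau> (seg m s k)) = q" if "k \<in> {s (Suc i) + 1..K}" for k
  proof -
    have k: "k \<in> {1..K}" using that by auto
    then have "seg m s k \<le> i" "1 \<le> seg m s k"
      using le_switch_iff[OF switching k, of i] seg_props(1)[OF switching k] i that by auto
    then have "\<tau> (seg m s k) \<le> \<tau> i" "1 \<le> i" using i by (auto intro: mono)
    then show ?thesis using q by simp
  qed
  ultimately show ?thesis by simp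
qed

end

section \<open>Thresholds with equal minimal ratios\<close>

text \<open>
  Thresholds read off an arbitrary point of a cube. They are automatically increasing, and a coordinate
  \<open>0\<close> makes the corresponding interval between neighbouring thresholds degenerate, which is the
  boundary condition for \<open>closed_cover_poincare_miranda\<close>.
\<close>

primrec running_max :: "(nat \<Rightarrow> real) \<Rightarrow> nat \<Rightarrow> real" where
  "running_max x 0 = 0"
| "running_max x (Suc j) = max (running_max x j) (x j)"

lemma running_max_mono: "i \<le> j \<Longrightarrow> running_max x i \<le> running_max x j"
  by (induction rule: dec_induct) auto

lemma running_max_nonneg: "0 \<le> running_max x i"
  using running_max_mono[of 0 i x] by simp

lemma running_max_le: "0 \<le> b \<Longrightarrow> (\<And>i. x i \<le> b) \<Longrightarrow> running_max x i \<le> b"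
  by (induction i) auto

lemma running_max_tendsto:
  assumes "f \<longlonglongrightarrow> x"
  shows "(\<lambda>n. running_max (f n) i) \<longlonglongrightarrow> running_max x i"
proof (induction i)
  case (Suc i)
  have "(\<lambda>n. f n i) \<longlonglongrightarrow> x i"
    using continuous_on_tendsto_compose[OF continuous_on_product_coordinates[of i] assms] by simp
  with Suc show ?case by (simp add: tendsto_max)
qed simp

lemma between_running_max:
  assumes "0 \<le> q" and "q \<le> running_max x n" and "1 \<le> n"
  shows "\<exists>i<n. running_max x i \<le> q \<and> q \<le> running_max x (Suc i)"
  using assms(3,2)
proof (induction n rule: dec_induct)
  case base
  then show ?case using assms(1) by auto
next
  case (step n)
  show ?case
  proof (cases "q \<le> running_max x n")
    case True
    then show ?thesis using step by (meson less_SucI)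
  next
    case False
    then show ?thesis using step by (intro exI[of _ n]) auto
  qed
qed

context demand begin

definition ratio :: "(nat \<Rightarrow> real) \<Rightarrow> real \<Rightarrow> real" where
  "ratio \<tau> q = sales \<tau> q / bench q"

lemma ratio_tendsto:
  assumes "\<And>i. i \<in> {1..m} \<Longrightarrow> (\<lambda>n. \<tau> n i) \<longlonglongrightarrow> \<tau>' i" and "q \<longlonglongrightarrow> q'"
    and "\<And>n. 0 \<le> q n" "\<And>n. q n < 1" "0 \<le> q'" "q' < 1"
  shows "(\<lambda>n. ratio (\<tau> n) (q n)) \<longlonglongrightarrow> ratio \<tau>' q'"
  unfolding ratio_def
  by (intro tendsto_divide sales_tendsto bench_tendsto assms)
     (use assms bench_pos[of q'] in \<open>auto intro: less_imp_le\<close>)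

lemma le_ratio_iff: "0 \<le> q \<Longrightarrow> q < 1 \<Longrightarrow> \<theta> \<le> ratio \<tau> q \<longleftrightarrow> \<theta> * bench q \<le> sales \<tau> q"
  unfolding ratio_def using bench_pos[of q] by (simp add: pos_le_divide_eq)

text \<open>
  Let \<open>r i\<close> be the minimal ratio on the interval between the thresholds \<open>i\<close> and \<open>i + 1\<close>, for \<open>i < m\<close>.
  Moving threshold \<open>i + 1\<close> trades \<open>r i\<close> against \<open>r (i + 1)\<close>: at its lowest position the left interval is
  a point that also belongs to the right one, at its highest position the roles are exchanged. The last
  threshold trades \<open>r (m - 1)\<close> against the ratios on \<open>[\<tau> m, 1)\<close>. Since these may fail to converge at
  \<open>1\<close>, the set that stands for \<open>r (m - 1)\<close> being the larger side is defined through their lower bound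
  \<open>survivors \<tau> 0\<close>, which keeps it closed; and \<open>\<tau> m = b\<close> has to be allowed as an outcome, because at this position
  nothing forces the ratios on \<open>[b, 1)\<close> to be the larger ones.
\<close>

theorem equalizing_thresholds:
  assumes b: "0 < b" "b < 1"
  shows "\<exists>\<tau> \<theta>. \<tau> 0 = 0 \<and> (\<forall>i j. i \<le> j \<longrightarrow> \<tau> i \<le> \<tau> j) \<and> (\<forall>i. \<tau> i \<le> b) \<and>
    (\<forall>i<m. \<exists>q\<in>{\<tau> i..\<tau> (Suc i)}. ratio \<tau> q = \<theta>) \<and> (\<forall>q\<in>{0..\<tau> m}. \<theta> \<le> ratio \<tau> q) \<and>
    survivors \<tau> 0 \<le> \<theta> \<and> (\<tau> m = b \<or> (\<forall>q. \<tau> m \<le> q \<longrightarrow> q < 1 \<longrightarrow> \<theta> \<le> ratio \<tau> q))"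
proof -
  define C where "C = {x :: nat \<Rightarrow> real. \<forall>i. x i \<in> {0..b}}"
  have compact_C: "compact C" unfolding C_def by (rule compact_cube_fun)
  then have closed_C: "closed C" by (rule compact_imp_closed)
  \<comment> \<open>Parametrising every interval by \<open>[0,1]\<close> turns the minima into infima over a fixed set.\<close>
  define pt where "pt x i u = running_max x i + u * (running_max x (Suc i) - running_max x i)"
    for x and i :: nat and u :: real
  have max_b: "running_max x i \<le> b" if "x \<in> C" for x i
    using that b unfolding C_def by (intro running_max_le) auto
  have pt_range: "running_max x i \<le> pt x i u \<and> pt x i u \<le> running_max x (Suc i)" if "u \<in> {0..1}" for x i u
  proof -
    define d where "d = running_max x (Suc i) - running_max x i"
    have "0 \<le> d" by (simp add: d_def)
    then have "0 \<le> u * d" "u * d \<le> d" using that by (auto intro: mult_left_le_one_le)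
    moreover have "pt x i u = running_max x i + u * d" "running_max x (Suc i) = running_max x i + d"
      by (simp_all add: pt_def d_def)
    ultimately show ?thesis by linarith
  qed
  have pt_01: "0 \<le> pt x i u" "pt x i u \<le> b" if "u \<in> {0..1}" "x \<in> C" for x i u
    using pt_range[OF that(1), of x i] running_max_nonneg[of x i] max_b[OF that(2), of "Suc i"] by auto
  have cont: "continuous_on (C \<times> {0..1::real}) (\<lambda>(x, u). ratio (running_max x) (pt x i u))" for i
    unfolding continuous_on_sequentially
  proof (intro allI ballI impI)
    fix f :: "nat \<Rightarrow> (nat \<Rightarrow> real) \<times> real" and a assume a: "a \<in> C \<times> {0..1}" and f: "(\<forall>n. f n \<in> C \<times> {0..1}) \<and> f \<longlonglongrightarrow> a"
    have f1: "(\<lambda>n. fst (f n)) \<longlonglongrightarrow> fst a" and f2: "(\<lambda>n. snd (f n)) \<longlonglongrightarrow> snd a"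
      using f by (auto intro: tendsto_fst tendsto_snd)
    have mem: "fst (f n) \<in> C" "snd (f n) \<in> {0..1}" "fst a \<in> C" "snd a \<in> {0..1}" for n
      using f a by (auto simp: mem_Times_iff)
    have "(\<lambda>n. ratio (running_max (fst (f n))) (pt (fst (f n)) i (snd (f n)))) \<longlonglongrightarrow>
        ratio (running_max (fst a)) (pt (fst a) i (snd a))"
    proof (rule ratio_tendsto)
      show "(\<lambda>n. pt (fst (f n)) i (snd (f n))) \<longlonglongrightarrow> pt (fst a) i (snd a)"
        unfolding pt_def by (intro tendsto_add tendsto_mult tendsto_diff running_max_tendsto f1 f2)
      show "pt (fst (f n)) i (snd (f n)) < 1" for n using pt_01(2)[OF mem(2)[of n] mem(1)[of n], of i] b by linarith
      show "pt (fst a) i (snd a) < 1" using pt_01(2)[OF mem(4,3), of i] b by linarith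
    qed (use pt_01(1) mem running_max_tendsto[OF f1] in auto)
    then show "((\<lambda>(x, u). ratio (running_max x) (pt x i u)) \<circ> f) \<longlonglongrightarrow> (case a of (x, u) \<Rightarrow> ratio (running_max x) (pt x i u))"
      by (simp add: o_def case_prod_beta)
  qed
  define r where "r i x = (INF u\<in>{0..1}. ratio (running_max x) (pt x i u))" for i :: nat and x
  have r_cont: "continuous_on C (r i)" for i
    unfolding r_def by (rule continuous_on_INF_interval[OF compact_C cont])
  have r_attained: "\<exists>q\<in>{running_max x i..running_max x (Suc i)}. ratio (running_max x) q = r i x"
    and r_le: "running_max x i \<le> q \<Longrightarrow> q \<le> running_max x (Suc i) \<Longrightarrow> r i x \<le> ratio (running_max x) q"
    if x: "x \<in> C" for x i q
  proof -
    have cu: "continuous_on {0..1} (\<lambda>u. ratio (running_max x) (pt x i u))"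
    proof -
      have "continuous_on {0..1} (\<lambda>u::real. (x, u))" by (intro continuous_intros)
      from continuous_on_compose2[OF cont[of i] this] x show ?thesis by auto
    qed
    obtain u where u: "u \<in> {0..1}" "\<And>v. v \<in> {0..1} \<Longrightarrow> ratio (running_max x) (pt x i u) \<le> ratio (running_max x) (pt x i v)"
      using continuous_attains_inf[OF compact_Icc _ cu] by auto
    have "r i x = ratio (running_max x) (pt x i u)"
      unfolding r_def by (rule cInf_eq_minimum) (use u in auto)
    then show "\<exists>q\<in>{running_max x i..running_max x (Suc i)}. ratio (running_max x) q = r i x"
      using pt_range[OF u(1), of x i] by auto
    assume q: "running_max x i \<le> q" "q \<le> running_max x (Suc i)"
    have "\<exists>v\<in>{0..1}. q = pt x i v"
    proof (cases "running_max x i = running_max x (Suc i)")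
      case True
      then show ?thesis using q by (intro bexI[of _ 0]) (auto simp: pt_def)
    next
      case False
      then have "running_max x i < running_max x (Suc i)" using running_max_mono[of i "Suc i" x] by auto
      then show ?thesis using q unfolding pt_def
        by (intro bexI[of _ "(q - running_max x i) / (running_max x (Suc i) - running_max x i)"]) (auto simp del: running_max.simps)
    qed
    then show "r i x \<le> ratio (running_max x) q"
      using u(2) \<open>r i x = ratio (running_max x) (pt x i u)\<close> by auto
  qed
  have surv_cont: "continuous_on C (\<lambda>x. survivors (running_max x) 0)"
    unfolding continuous_on_sequentially
    by (auto simp: o_def intro!: survivors_tendsto running_max_tendsto)
  have surv_le: "survivors (running_max x) 0 \<le> ratio (running_max x) q"
    if "running_max x m \<le> q" "0 \<le> q" "q < 1" for x q
    using sales_ge_survivors[of "running_max x" q] that running_max_mono[of _ m x] le_ratio_iff[of q]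
    by (auto intro: order_trans)
  have tail_cont: "continuous_on C (\<lambda>x. ratio (running_max x) (max q (running_max x m)))" if q: "0 \<le> q" "q < 1" for q
    unfolding continuous_on_sequentially
  proof (intro allI ballI impI)
    fix f a assume a: "a \<in> C" and f: "(\<forall>n. f n \<in> C) \<and> f \<longlonglongrightarrow> a"
    have lt: "max q (running_max x m) < 1" if "x \<in> C" for x using max_b[OF that, of m] q b by auto
    show "((\<lambda>x. ratio (running_max x) (max q (running_max x m))) \<circ> f) \<longlonglongrightarrow> ratio (running_max a) (max q (running_max a m))"
      unfolding o_def using f a q
      by (intro ratio_tendsto running_max_tendsto tendsto_max tendsto_const lt) auto
  qed
  define A where "A i = (if Suc i < m then {x\<in>C. r (Suc i) x \<le> r i x}
      else {x\<in>C. survivors (running_max x) 0 \<le> r i x})" for i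
  define B where "B i = (if Suc i < m then {x\<in>C. r i x \<le> r (Suc i) x}
      else {x\<in>C. b \<le> running_max x m} \<union>
        (\<Inter>q\<in>{0..<1}. {x\<in>C. r i x \<le> ratio (running_max x) (max q (running_max x m))}))" for i
  have "\<exists>x\<in>C. \<forall>i<m. x \<in> A i \<and> x \<in> B i"
    unfolding C_def
  proof (rule closed_cover_poincare_miranda[OF b(1)], fold C_def)
    fix i assume i: "i < m"
    show "closed (A i)"
      unfolding A_def by (auto intro!: continuous_on_closed_Collect_le r_cont surv_cont closed_C)
    have "continuous_on C (\<lambda>x. running_max x m)"
      unfolding continuous_on_sequentially by (auto simp: o_def intro: running_max_tendsto)
    then show "closed (B i)"
      unfolding B_def
      by (auto intro!: continuous_on_closed_Collect_le r_cont tail_cont closed_C closed_Un closed_INT continuous_on_const)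
    fix x assume x: "x \<in> C"
    show "x \<in> A i \<or> x \<in> B i"
    proof (cases "Suc i < m")
      case False
      then have im: "Suc i = m" using i by simp
      show ?thesis
      proof (rule disjCI)
        assume "x \<notin> B i"
        then obtain q where q: "0 \<le> q" "q < 1" "\<not> r i x \<le> ratio (running_max x) (max q (running_max x m))"
          using x False by (auto simp: B_def)
        have "survivors (running_max x) 0 \<le> ratio (running_max x) (max q (running_max x m))"
          using q max_b[OF x, of m] b by (intro surv_le) auto
        then show "x \<in> A i" using q(3) x False by (auto simp: A_def)
      qed
    qed (use x in \<open>auto simp: A_def B_def\<close>)
    {
      assume "x i = 0"
      then have same: "running_max x (Suc i) = running_max x i"
        using running_max_nonneg[of x i] by simp
      obtain q where q: "q \<in> {running_max x i..running_max x (Suc i)}" "ratio (running_max x) q = r i x"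
        using r_attained[OF x, of i] by blast
      then have qe: "q = running_max x (Suc i)" using same by simp
      show "x \<in> A i"
      proof (cases "Suc i < m")
        case True
        have "r (Suc i) x \<le> ratio (running_max x) q"
          by (rule r_le[OF x]) (simp_all add: qe)
        then show ?thesis using q(2) x True by (simp add: A_def)
      next
        case False
        then have "Suc i = m" using i by simp
        then have "survivors (running_max x) 0 \<le> ratio (running_max x) q"
          using qe running_max_nonneg[of x m] max_b[OF x, of m] b by (intro surv_le) auto
        then show ?thesis using q(2) x False by (simp add: A_def)
      qed
    }
    {
      assume xb: "x i = b"
      then have top: "running_max x (Suc i) = b" using max_b[OF x, of i] by simp
      show "x \<in> B i"
      proof (cases "Suc i < m")
        case True
        have top2: "running_max x (Suc (Suc i)) = b" using top max_b[OF x, of "Suc (Suc i)"] by auto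
        obtain q where q: "q \<in> {running_max x (Suc i)..running_max x (Suc (Suc i))}" "ratio (running_max x) q = r (Suc i) x"
          using r_attained[OF x, of "Suc i"] by blast
        then have "q = running_max x (Suc i)" unfolding top top2 by simp
        then have "r i x \<le> ratio (running_max x) q" by (intro r_le[OF x]) simp_all
        then show ?thesis using q(2) x True by (simp add: B_def)
      next
        case False
        then have "Suc i = m" using i by simp
        then show ?thesis using top x False by (auto simp: B_def)
      qed
    }
  qed
  then obtain x where x: "x \<in> C" and AB: "\<And>i. i < m \<Longrightarrow> x \<in> A i \<and> x \<in> B i" by blast
  have eq_step: "r (Suc i) x = r i x" if "Suc i < m" for i
    using AB[of i] that by (auto simp: A_def B_def)
  have eq: "r i x = r 0 x" if "i < m" for i
    using that by (induction i) (auto simp: eq_step)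
  have last: "m - 1 < m" "\<not> Suc (m - 1) < m" using m_pos by auto
  show ?thesis
  proof (intro exI[of _ "running_max x"] exI[of _ "r 0 x"] conjI allI impI ballI)
    show "running_max x i \<le> running_max x j" if "i \<le> j" for i j using running_max_mono[OF that] .
    show "running_max x i \<le> b" for i using max_b[OF x] .
    show "\<exists>q\<in>{running_max x i..running_max x (Suc i)}. ratio (running_max x) q = r 0 x" if "i < m" for i
      using r_attained[OF x, of i] eq[OF that] by simp
    show "r 0 x \<le> ratio (running_max x) q" if "q \<in> {0..running_max x m}" for q
    proof -
      have q: "0 \<le> q" "q \<le> running_max x m" using that by auto
      obtain i where "i < m" "running_max x i \<le> q" "q \<le> running_max x (Suc i)"
        using between_running_max[OF q m_pos] by blast
      then show ?thesis using r_le[OF x, of i q] eq[of i] by simp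
    qed
    show "survivors (running_max x) 0 \<le> r 0 x"
      using AB[OF last(1)] last(2) eq[OF last(1)] by (simp add: A_def)
    have "b \<le> running_max x m \<or> (\<forall>q\<in>{0..<1}. r 0 x \<le> ratio (running_max x) (max q (running_max x m)))"
      using AB[OF last(1)] last(2) eq[OF last(1)] by (auto simp: B_def)
    then show "running_max x m = b \<or> (\<forall>q. running_max x m \<le> q \<longrightarrow> q < 1 \<longrightarrow> r 0 x \<le> ratio (running_max x) q)"
    proof
      assume "b \<le> running_max x m"
      then show ?thesis using max_b[OF x, of m] by simp
    next
      assume *: "\<forall>q\<in>{0..<1}. r 0 x \<le> ratio (running_max x) (max q (running_max x m))"
      have "r 0 x \<le> ratio (running_max x) q" if "running_max x m \<le> q" "q < 1" for q
        using bspec[OF *, of q] that running_max_nonneg[of x m] by (simp add: max_absorb1)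
      then show ?thesis by blast
    qed
  qed simp
qed

end

section \<open>Feasibility in the reduced Poisson problem\<close>

lemma PoisOPTRe_le: "pois_feasible K m s M \<theta> lam \<alpha> \<beta> x \<Longrightarrow> PoisOPTRe K m s M \<le> ereal \<theta>"
  unfolding PoisOPTRe_def by (rule INF_lower) blast

text \<open>
  Without arrivals nothing is sold and all stock survives, which makes \<open>\<theta> = 1\<close> feasible.
\<close>

lemma PoisOPTRe_le_1:
  assumes K: "1 \<le> K" and M: "0 \<le> M" and sv: "switching_vector K m s"
  shows "PoisOPTRe K m s M \<le> 1"
proof -
  let ?x = "\<lambda>k (t::real). if k = K then 1 else 0 :: real"
  have surv: "(\<Sum>k=s (Suc i) + 1..K. ?x k 1) = 1" if "i \<in> {1..m}" for i
  proof -
    have "s (Suc i) < s i" "s i \<le> s 1" using sv that switching_vector_antimono[OF sv, of 1 i]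
      unfolding switching_vector_def by auto
    then have "s (Suc i) < K" using sv unfolding switching_vector_def by simp
    then show ?thesis by simp
  qed
  have "pois_feasible K m s M 1 (\<lambda>_. 0) (\<lambda>_ _. 0) (\<lambda>_ _. 0) ?x"
    unfolding pois_feasible_def
  proof (intro conjI ballI)
    fix k
    show "has_time_deriv (?x k) (\<lambda>t. - (pois_y K m s (\<lambda>_ _. 0) ?x k t - pois_y K m s (\<lambda>_ _. 0) ?x (Suc k) t))"
      using has_time_deriv_const by (simp add: pois_y_def)
  next
    fix i assume "i \<in> {1..m}"
    then show "(\<Sum>k=s (Suc i) + 1..K. ?x k 1)
        \<le> 1 * measure_pmf.prob (Pois (LINT t:{0..1}|lborel. 0)) {n. n \<le> K - 1}"
      using surv K by (simp add: prob_Pois_le del: One_nat_def)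
  qed (use M in \<open>auto simp: set_borel_measurable_def set_lebesgue_integral_def\<close>)
  from PoisOPTRe_le[OF this] show ?thesis by (simp add: one_ereal_def)
qed

context demand begin

text \<open>
  Compare \<open>q\<close> with a slightly larger \<open>q'\<close>. The sales lost are at least \<open>survivors\<close> times the lost
  arrivals, since all states above \<open>s (i + 1)\<close> serve the types in between; \<open>\<theta>\<close> times the loss of the
  benchmark is no smaller, as \<open>q\<close> attains the ratio \<open>\<theta>\<close>. Divide by the lost arrivals and let \<open>q'\<close>
  tend to \<open>q\<close>. Only larger types are compared, so \<open>q\<close> may be an endpoint of its interval.
\<close>

lemma marginal_condition:
  assumes q: "0 \<le> q" "q < 1" and i: "1 \<le> i" "i \<le> m" and acc: "\<And>j. 1 \<le> j \<Longrightarrow> j \<le> i \<Longrightarrow> \<tau> j \<le> q"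
    and contact: "sales \<tau> q = \<theta> * bench q"
    and above: "\<And>q'. 0 \<le> q' \<Longrightarrow> q' < 1 \<Longrightarrow> \<theta> * bench q' \<le> sales \<tau> q'"
  shows "survivors \<tau> (s (Suc i)) \<le> \<theta> * Pois_below K (total q)"
proof -
  have sK: "s (Suc i) < K"
    using switching i switching_vector_antimono[OF switching, of 1 i] unfolding switching_vector_def by force
  have step: "\<exists>c. total q' < c \<and> c < total q \<and> survivors \<tau> (s (Suc i)) \<le> \<theta> * Pois_below K c"
    if q': "q < q'" "q' < 1" for q'
  proof -
    have lt: "total q' < total q" using total_less[of q q'] q q' by simp
    obtain c where c: "total q' < c" "c < total q"
      "bench q - bench q' = (total q - total q') * Pois_below K c"
      using Pois_min_mvt[OF total_nonneg lt, of K] q q' unfolding bench_def by auto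
    have "survivors \<tau> (s (Suc i)) * (total q - total q') \<le> sales \<tau> q - sales \<tau> q'"
    proof (rule sales_diff_ge[OF sK])
      fix k assume k: "k \<in> {Suc (s (Suc i))..K}"
      then have k1: "k \<in> {1..K}" by auto
      then have "seg m s k \<le> i" "1 \<le> seg m s k"
        using le_switch_iff[OF switching k1, of i] seg_props(1)[OF switching k1] i k by auto
      then show "\<tau> (seg m s k) \<le> q" by (intro acc)
    qed (use q' in simp)
    also have "\<dots> \<le> \<theta> * (bench q - bench q')"
      using contact above[of q'] q q' by (simp add: right_diff_distrib)
    also have "\<dots> = \<theta> * Pois_below K c * (total q - total q')" using c(3) by simp
    finally have "survivors \<tau> (s (Suc i)) \<le> \<theta> * Pois_below K c" using lt by simp
    then show ?thesis using c by blast
  qed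
  \<comment> \<open>Any sequence in \<open>(q,1)\<close> with limit \<open>q\<close> will do; the shift by two keeps it below \<open>1\<close>.\<close>
  define p where "p n = q + (1 - q) / real (Suc (Suc n))" for n
  have p: "q < p n" "p n < 1" for n
  proof -
    show "q < p n" using q by (simp add: p_def)
    have "(1 - q) / real (Suc (Suc n)) < (1 - q) / 1" using q by (intro divide_strict_left_mono) auto
    then show "p n < 1" by (simp add: p_def)
  qed
  have "\<forall>n. \<exists>c. total (p n) < c \<and> c < total q \<and> survivors \<tau> (s (Suc i)) \<le> \<theta> * Pois_below K c"
    using step p by blast
  from choice[OF this] obtain c
    where c: "\<forall>n. total (p n) < c n \<and> c n < total q \<and> survivors \<tau> (s (Suc i)) \<le> \<theta> * Pois_below K (c n)" ..
  have "(\<lambda>n. inverse (real (Suc (Suc n)))) \<longlonglongrightarrow> 0"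
    using LIMSEQ_Suc[OF LIMSEQ_inverse_real_of_nat] .
  from tendsto_add[OF tendsto_const[of q] tendsto_mult_right_zero[OF this, of "1 - q"]]
  have "p \<longlonglongrightarrow> q" unfolding p_def[abs_def] by (simp add: divide_inverse)
  then have "(\<lambda>n. total (p n)) \<longlonglongrightarrow> total q" by (rule total_tendsto)
  then have "c \<longlonglongrightarrow> total q"
    by (rule tendsto_sandwich[rotated 2, OF _ tendsto_const]) (use c in \<open>auto intro!: always_eventually less_imp_le\<close>)
  from tendsto_mult[OF tendsto_const isCont_tendsto_compose[OF continuous_Pois_below this]]
  have "(\<lambda>n. \<theta> * Pois_below K (c n)) \<longlonglongrightarrow> \<theta> * Pois_below K (total q)" .
  then show ?thesis by (rule LIMSEQ_le_const) (use c in blast)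
qed

text \<open>
  Take \<open>\<beta>\<^sup>i = N \<tau>\<^sub>i\<close> and \<open>\<alpha>\<^sup>i = N q\<^sub>i\<close> for a point \<open>q\<^sub>i\<close> of the \<open>i\<close>-th interval with ratio \<open>\<theta>\<close>. The
  boundary conditions on \<open>\<alpha>\<close> prescribe \<open>q\<^sub>0 = 0\<close>, and \<open>\<alpha>\<^sup>m = 0\<close> turns the last constraint on
  probabilities into \<open>survivors \<tau> 0 \<le> \<theta>\<close>.
\<close>

lemma equalized_feasible:
  assumes t0: "\<tau> 0 = 0" and mono: "\<And>i j. i \<le> j \<Longrightarrow> \<tau> i \<le> \<tau> j" and lt: "\<And>i. \<tau> i < 1"
    and contact: "\<And>i. i < m \<Longrightarrow> \<exists>q\<in>{\<tau> i..\<tau> (Suc i)}. ratio \<tau> q = \<theta>"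
    and above: "\<And>q. 0 \<le> q \<Longrightarrow> q < 1 \<Longrightarrow> \<theta> \<le> ratio \<tau> q"
    and surv: "survivors \<tau> 0 \<le> \<theta>"
  shows "PoisOPTRe K m s M \<le> ereal \<theta>"
proof -
  have t_nonneg: "0 \<le> \<tau> i" for i using mono[of 0 i] t0 by simp
  have "\<forall>i\<in>{..<m}. \<exists>q. q \<in> {\<tau> i..\<tau> (Suc i)} \<and> ratio \<tau> q = \<theta>" using contact by blast
  from bchoice[OF this] obtain p
    where p: "\<And>i. i < m \<Longrightarrow> p i \<in> {\<tau> i..\<tau> (Suc i)}" "\<And>i. i < m \<Longrightarrow> ratio \<tau> (p i) = \<theta>"
    by blast
  define z where "z i = (if i = 0 then 0 else p i)" for i
  have z_range: "\<tau> i \<le> z i" "z i \<le> \<tau> (Suc i)" if "i < m" for i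
    using p(1)[OF that] t0 t_nonneg[of "Suc i"] by (auto simp: z_def)
  have z01: "0 \<le> z i" "z i < 1" if "i < m" for i
    using z_range[OF that] t_nonneg[of i] lt[of "Suc i"] by auto
  \<comment> \<open>Types below \<open>\<tau> 1\<close> are never served, so sales are constant on \<open>[0, \<tau> 1]\<close> and the ratio is
    smallest where the benchmark is largest, at \<open>0\<close>.\<close>
  have z_contact: "sales \<tau> (z i) = \<theta> * bench (z i)" if i: "i < m" for i
  proof -
    have "ratio \<tau> (z i) = \<theta>"
    proof (cases "i = 0")
      case True
      have p0: "0 \<le> p 0" "p 0 \<le> \<tau> 1" "p 0 < 1" using p(1)[of 0] m_pos t0 lt[of 1] by auto
      have "sales \<tau> (p 0) = sales \<tau> 0"
      proof -
        have "\<tau> 1 \<le> \<tau> (seg m s k)" if "k \<in> {1..K}" for k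
          using seg_props(1)[OF switching that] by (intro mono) auto
        then have "max (p 0) (\<tau> (seg m s k)) = max 0 (\<tau> (seg m s k))" if "k \<in> {1..K}" for k
          using p0 t_nonneg[of "seg m s k"] that by (force simp: max_def)
        then show ?thesis unfolding sales_def by (intro sum.cong refl) simp
      qed
      moreover have "bench (p 0) \<le> bench 0"
        unfolding bench_def using p0 total_less[of 0 "p 0"]
        by (intro Pois_min_mono total_nonneg) (cases "p 0 = 0"; auto)+
      ultimately have "ratio \<tau> 0 \<le> ratio \<tau> (p 0)"
        unfolding ratio_def using bench_pos[of "p 0"] p0 sales_nonneg by (simp add: divide_left_mono)
      then show ?thesis using above[of 0] p(2)[of 0] m_pos True by (simp add: z_def)
    qed (use p(2)[OF i] in \<open>simp add: z_def\<close>)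
    then show ?thesis using bench_pos[OF z01[OF i]] by (simp add: ratio_def field_simps)
  qed
  have above': "\<theta> * bench q \<le> sales \<tau> q" if "0 \<le> q" "q < 1" for q
    using above[OF that] le_ratio_iff[OF that] by simp
  define \<alpha> where "\<alpha> i = (if i = m then (\<lambda>_. 0) else N (z i))" for i
  have \<alpha>_total: "(LINT t:{0..1}|lborel. \<alpha> i t) = (if i = m then 0 else total (z i))" for i
    by (simp add: \<alpha>_def total_def)
  interpret death_rates K M "rate \<tau>" by (rule death_rates_rate)
  have y_eq: "pois_y K m s (\<lambda>i. N (\<tau> i)) (occ \<tau>) k t = exit_flow k t" for k t
    by (simp add: pois_y_def exit_flow_def rate_def)
  have "pois_feasible K m s M \<theta> (N 0) \<alpha> (\<lambda>i. N (\<tau> i)) (occ \<tau>)"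
    unfolding pois_feasible_def y_eq
  proof (intro conjI ballI)
    show "set_borel_measurable borel {0..1} (\<alpha> i)" for i
      using N_meas by (auto simp: \<alpha>_def set_borel_measurable_def)
    fix t :: real assume t: "t \<in> {0..1}"
    show "\<alpha> m t = 0" by (simp add: \<alpha>_def)
    show "\<alpha> 0 t = N 0 t" using m_pos by (simp add: \<alpha>_def z_def)
    show "0 \<le> N (\<tau> 1) t" by (rule N_nonneg[OF t])
    show "N (\<tau> 1) t \<le> N 0 t" by (rule N_antimono[OF t t_nonneg])
    show "N 0 t \<le> M" by (rule N_le[OF t])
    fix i assume i: "i \<in> {1..<m}"
    show "0 \<le> N (\<tau> (Suc i)) t" by (rule N_nonneg[OF t])
    show "N (\<tau> (Suc i)) t \<le> \<alpha> i t" using i z_range[of i] by (auto simp: \<alpha>_def intro!: N_antimono[OF t])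
    show "\<alpha> i t \<le> N (\<tau> i) t" using i z_range[of i] by (auto simp: \<alpha>_def intro!: N_antimono[OF t])
    show "N (\<tau> i) t \<le> N 0 t" by (rule N_antimono[OF t t_nonneg])
  next
    show "occ \<tau> K 0 = 1" using death_0[of K] K_pos by simp
    show "occ \<tau> k 0 = 0" if "k \<in> {1..<K}" for k using death_0[of k] that by simp
    show "has_time_deriv (occ \<tau> k) (\<lambda>t. - (exit_flow k t - exit_flow (Suc k) t))" if "k \<in> {1..K}" for k
      by (rule death_deriv[OF that])
  next
    fix i assume i: "i \<in> {1..m}"
    show "(\<Sum>k=s (Suc i) + 1..K. occ \<tau> k 1)
        \<le> \<theta> * measure_pmf.prob (Pois (LINT t:{0..1}|lborel. \<alpha> i t)) {n. n \<le> K - 1}"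
    proof (cases "i = m")
      case True
      have "s (Suc m) = 0" using switching unfolding switching_vector_def by simp
      moreover have "measure_pmf.prob (Pois 0) {n. n \<le> K - 1} = 1"
        using prob_Pois_le[of 0 K] K_pos by simp
      ultimately show ?thesis using surv unfolding \<alpha>_total by (simp add: True survivors_def)
    next
      case False
      then have im: "i < m" using i by simp
      have "survivors \<tau> (s (Suc i)) \<le> \<theta> * Pois_below K (total (z i))"
        using z01[OF im] i z_contact[OF im] above' z_range(1)[OF im]
        by (intro marginal_condition) (auto intro: order_trans[OF mono])
      moreover have "measure_pmf.prob (Pois (total (z i))) {n. n \<le> K - 1} = Pois_below K (total (z i))"
        using z01[OF im] K_pos by (intro prob_Pois_le total_nonneg) auto
      ultimately show ?thesis unfolding \<alpha>_total using False by (simp add: survivors_def)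
    qed
  next
    fix i assume "i \<in> {0..<m}"
    then have i: "i < m" by simp
    have "sales \<tau> (z i) = (\<Sum>k=1..s (Suc i). LINT t:{0..1}|lborel. N (\<tau> (seg m s k)) t * occ \<tau> k t)
        + (\<Sum>k=s (Suc i) + 1..K. LINT t:{0..1}|lborel. N (z i) t * occ \<tau> k t)"
      by (rule sales_split[OF i mono z_range[OF i]])
    then show "(\<Sum>k=1..s (Suc i). LINT t:{0..1}|lborel. N (\<tau> (seg m s k)) t * occ \<tau> k t)
        + (\<Sum>k=s (Suc i) + 1..K. LINT t:{0..1}|lborel. \<alpha> i t * occ \<tau> k t)
        \<le> \<theta> * Pois_min K (LINT t:{0..1}|lborel. \<alpha> i t)"
      using z_contact[OF i] i unfolding \<alpha>_total by (simp add: \<alpha>_def bench_def)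
  qed (use N_meas in auto)
  then show ?thesis by (rule PoisOPTRe_le)
qed

text \<open>
  Let \<open>w\<close> bound all ratios that some policy guarantees for every \<open>q\<close>. Only the case \<open>w < 1\<close> needs
  thresholds, and then \<open>b\<close> is chosen so close to \<open>1\<close> that thresholds with \<open>\<tau> m = b\<close> would guarantee more
  than \<open>w\<close>.
\<close>

theorem PoisOPTRe_le_policy_bound:
  assumes w: "\<And>\<tau> \<theta>. (\<And>i. i \<in> {1..m} \<Longrightarrow> 0 \<le> \<tau> i \<and> \<tau> i \<le> 1) \<Longrightarrow>
      (\<And>i j. 1 \<le> i \<Longrightarrow> i \<le> j \<Longrightarrow> j \<le> m \<Longrightarrow> \<tau> i \<le> \<tau> j) \<Longrightarrow>
      (\<And>q. q \<in> {0..1} \<Longrightarrow> \<theta> * bench q \<le> sales \<tau> q) \<Longrightarrow> ereal \<theta> \<le> w"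
  shows "PoisOPTRe K m s M \<le> w"
proof (cases "1 \<le> w")
  case True
  then show ?thesis using PoisOPTRe_le_1[OF K_pos M_nonneg switching] by (rule order_trans[rotated])
next
  case False
  then obtain v where v: "w < ereal v" "ereal v < 1" using ereal_dense2[of w 1] by (auto simp: not_le)
  have "(\<lambda>n. total (1 - 1 / real (Suc (Suc n)))) \<longlonglongrightarrow> total (1 - 0)"
    by (intro total_tendsto tendsto_diff tendsto_const LIMSEQ_Suc[OF LIMSEQ_inverse_real_of_nat[unfolded inverse_eq_divide]])
  then have "eventually (\<lambda>n. total (1 - 1 / real (Suc (Suc n))) < 1 - v) sequentially"
    using v(2) by (intro order_tendstoD(2)) (auto simp: total_1 one_ereal_def)
  then obtain n where n: "total (1 - 1 / real (Suc (Suc n))) < 1 - v"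
    unfolding eventually_sequentially by blast
  define b where "b = 1 - 1 / real (Suc (Suc n))"
  have b: "0 < b" "b < 1" "total b < 1 - v" using n by (auto simp: b_def)
  obtain \<tau> \<theta> where t0: "\<tau> 0 = 0" and mono': "\<forall>i j. i \<le> j \<longrightarrow> \<tau> i \<le> \<tau> j" and tb': "\<forall>i. \<tau> i \<le> b"
    and contact': "\<forall>i<m. \<exists>q\<in>{\<tau> i..\<tau> (Suc i)}. ratio \<tau> q = \<theta>"
    and below': "\<forall>q\<in>{0..\<tau> m}. \<theta> \<le> ratio \<tau> q"
    and surv: "survivors \<tau> 0 \<le> \<theta>"
    and tail: "\<tau> m = b \<or> (\<forall>q. \<tau> m \<le> q \<longrightarrow> q < 1 \<longrightarrow> \<theta> \<le> ratio \<tau> q)"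
    using equalizing_thresholds[OF b(1,2)] by (elim exE conjE)
  have mono: "\<tau> i \<le> \<tau> j" if "i \<le> j" for i j using mono' that by blast
  have tb: "\<tau> i \<le> b" for i using tb' by blast
  have contact: "\<exists>q\<in>{\<tau> i..\<tau> (Suc i)}. ratio \<tau> q = \<theta>" if "i < m" for i using contact' that by blast
  have below: "\<theta> \<le> ratio \<tau> q" if "0 \<le> q" "q \<le> \<tau> m" for q using below' that by simp
  have t_nonneg: "0 \<le> \<tau> i" for i using mono[of 0 i] t0 by simp
  have bound: "ereal \<eta> \<le> w" if \<eta>: "\<And>q. 0 \<le> q \<Longrightarrow> q < 1 \<Longrightarrow> \<eta> \<le> ratio \<tau> q" for \<eta>
  proof (rule w)
    show "0 \<le> \<tau> i \<and> \<tau> i \<le> 1" for i using t_nonneg[of i] tb[of i] b by simp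
    show "\<tau> i \<le> \<tau> j" if "i \<le> j" for i j using mono[OF that] .
    show "\<eta> * bench q \<le> sales \<tau> q" if "q \<in> {0..1}" for q
      using \<eta>[of q] le_ratio_iff[of q] sales_nonneg that by (cases "q = 1") auto
  qed
  from tail show ?thesis
  proof
    assume "\<tau> m = b"
    \<comment> \<open>The last unit is sold above \<open>b\<close> only, so it is unlikely to be sold at all.\<close>
    have seg1: "seg m s 1 = m"
    proof -
      have one: "1 \<in> {1..K}" using K_pos by simp
      have "s (Suc m) < s m" using switching m_pos unfolding switching_vector_def by force
      then have "1 \<le> s (Suc (m - 1))" using m_pos by simp
      then have "m - 1 < seg m s 1" using le_switch_iff[OF switching one, of "m - 1"] by simp
      then show ?thesis using seg_props(1)[OF switching one] by simp
    qed
    have "survivors \<tau> 0 \<ge> 1 - total b"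
      using death_rates.total_mass_ge[OF death_rates_rate, of \<tau>] \<open>\<tau> m = b\<close>
      unfolding survivors_def death_rates.mass_above_def[OF death_rates_rate] total_def
      by (simp only: rate_def seg1)
    then have "ereal v < ereal (survivors \<tau> 0)" using b(3) by simp
    also have "\<dots> \<le> w"
    proof (rule bound)
      fix q :: real assume q: "0 \<le> q" "q < 1"
      show "survivors \<tau> 0 \<le> ratio \<tau> q"
      proof (cases "q \<le> \<tau> m")
        case True
        then show ?thesis using below[OF q(1)] surv by simp
      next
        case False
        then have "survivors \<tau> 0 * bench q \<le> sales \<tau> q"
          using q by (intro sales_ge_survivors) (auto intro: order_trans[OF mono])
        then show ?thesis using le_ratio_iff[OF q] by simp
      qed
    qed
    finally have "ereal v < w" .
    then show ?thesis using v(1) by simp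
  next
    assume *: "\<forall>q. \<tau> m \<le> q \<longrightarrow> q < 1 \<longrightarrow> \<theta> \<le> ratio \<tau> q"
    have all: "\<theta> \<le> ratio \<tau> q" if "0 \<le> q" "q < 1" for q
      using below[OF that(1)] * that by (cases "q \<le> \<tau> m") auto
    have "PoisOPTRe K m s M \<le> ereal \<theta>"
      using b(2) tb by (intro equalized_feasible[OF t0 mono _ contact all surv]) (auto intro: le_less_trans)
    also have "\<dots> \<le> w" by (rule bound[OF all])
    finally show ?thesis .
  qed
qed

end

section \<open>The demand curve of an environment\<close>

locale market =
  fixes M :: real and lam :: "real \<Rightarrow> real" and g :: "real \<Rightarrow> real \<Rightarrow> real"
  assumes env: "(lam, g) \<in> environments M"
begin

lemma lam_meas: "set_borel_measurable borel {0..1} lam"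
  and lam_range: "t \<in> {0..1} \<Longrightarrow> 0 \<le> lam t" "t \<in> {0..1} \<Longrightarrow> lam t \<le> M"
  and g_meas: "set_borel_measurable borel ({0..1} \<times> {0..1}) (\<lambda>(t, q). g t q)"
  and g_nonneg: "t \<in> {0..1} \<Longrightarrow> q \<in> {0..1} \<Longrightarrow> 0 \<le> g t q"
  and g_bounded: "\<exists>B. \<forall>t\<in>{0..1}. \<forall>q\<in>{0..1}. g t q \<le> B"
  and g_prob: "t \<in> {0..1} \<Longrightarrow> prob_space (type_dist g t)"
  and demand_pos: "q \<in> {0<..<1} \<Longrightarrow> 0 < (LINT t:{0..1}|lborel. lam t * g t q)"
  using env unfolding environments_def by auto

text \<open>
  Extension by \<open>0\<close> beyond the unit interval, which makes the rates measurable on the whole line;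
  likewise \<open>g0\<close> for the densities.
\<close>

definition lam0 :: "real \<Rightarrow> real" where
  "lam0 t = indicator {0..1} t * lam t"

definition g0 :: "real \<Rightarrow> real \<Rightarrow> real" where
  "g0 t q = indicator {0..1} t * indicator {0..1} q * g t q"

lemma lam0_meas [measurable]: "lam0 \<in> borel_measurable borel"
  using lam_meas unfolding set_borel_measurable_def lam0_def[abs_def] by simp

lemma g0_meas [measurable]: "(\<lambda>p. g0 (fst p) (snd p)) \<in> borel_measurable (borel \<Otimes>\<^sub>M borel)"
proof -
  have "(\<lambda>p. indicator ({0..1} \<times> {0..1}) p *\<^sub>R (\<lambda>(t, q). g t q) p) \<in> borel_measurable (borel \<Otimes>\<^sub>M borel)"
    using g_meas unfolding set_borel_measurable_def borel_prod .
  then show ?thesis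
    by (rule measurable_cong[THEN iffD1, rotated]) (auto simp: g0_def indicator_def split: prod.splits)
qed

lemma g0_meas' [measurable (raw)]:
  assumes "f \<in> borel_measurable Q" and "h \<in> borel_measurable Q"
  shows "(\<lambda>x. g0 (f x) (h x)) \<in> borel_measurable Q"
  using measurable_compose[OF measurable_Pair[OF assms] g0_meas] by simp

lemma lam0_nonneg: "0 \<le> lam0 t"
  using lam_range by (auto simp: lam0_def indicator_def)

lemma lam0_le: "t \<in> {0..1} \<Longrightarrow> lam0 t \<le> M"
  using lam_range by (auto simp: lam0_def)

lemma g0_nonneg: "0 \<le> g0 t q"
  using g_nonneg by (auto simp: g0_def indicator_def)

definition gbound :: real where
  "gbound = (SOME B. 0 \<le> B \<and> (\<forall>t q. g0 t q \<le> B))"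

lemma gbound: "0 \<le> gbound" "g0 t q \<le> gbound"
proof -
  obtain B where B: "\<forall>t\<in>{0..1}. \<forall>q\<in>{0..1}. g t q \<le> B" using g_bounded by blast
  have "g0 t q \<le> max 0 B" for t q
    using B by (cases "t \<in> {0..1} \<and> q \<in> {0..1}") (auto simp: g0_def le_max_iff_disj)
  then have "0 \<le> max 0 B \<and> (\<forall>t q. g0 t q \<le> max 0 B)" by simp
  then have "0 \<le> gbound \<and> (\<forall>t q. g0 t q \<le> gbound)"
    unfolding gbound_def by (rule someI)
  then show "0 \<le> gbound" "g0 t q \<le> gbound" by auto
qed

lemma g0_integrable: "integrable lborel (g0 t)"
proof -
  have "integrable lborel (\<lambda>q. indicator {0..1} q *\<^sub>R g0 t q)"
    using set_integrable_bounded[of 0 1 "g0 t" gbound] gbound g0_nonneg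
    unfolding set_integrable_def set_borel_measurable_def by auto
  moreover have "(\<lambda>q. indicator {0..1} q *\<^sub>R g0 t q) = g0 t"
    by (auto simp: g0_def indicator_def)
  ultimately show ?thesis by (simp only:)
qed

lemma type_dist_eq:
  assumes "t \<in> {0..1}"
  shows "type_dist g t = density lborel (\<lambda>q. ennreal (g0 t q))"
  using assms unfolding type_dist_def g0_def by simp

lemma g0_integral:
  assumes "t \<in> {0..1}"
  shows "(LINT q|lborel. g0 t q) = 1"
proof -
  have "emeasure (type_dist g t) (space (type_dist g t)) = 1"
    using prob_space.emeasure_space_1[OF g_prob[OF assms]] .
  then have "(\<integral>\<^sup>+q. ennreal (g0 t q) \<partial>lborel) = 1"
    unfolding type_dist_eq[OF assms] by (simp add: emeasure_density)
  then show ?thesis by (simp add: integral_eq_nn_integral g0_nonneg)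
qed

text \<open>\<open>tail t q\<close> is the fraction \<open>1 - G'\<^sub>t(q)\<close> of the customers at time \<open>t\<close> with type at least \<open>q\<close>.\<close>

definition tail :: "real \<Rightarrow> real \<Rightarrow> real" where
  "tail t q = (LINT r|lborel. indicator {q..} r * g0 t r)"

definition N :: "real \<Rightarrow> real \<Rightarrow> real" where
  "N q t = lam0 t * tail t q"

lemma indicator_g0_integrable:
  assumes "A \<in> sets borel"
  shows "integrable lborel (\<lambda>r. indicator A r * g0 t r)"
  using integrable_real_mult_indicator[OF _ g0_integrable, of A t] assms by (simp add: mult.commute)

lemma tail_nonneg: "0 \<le> tail t q"
  unfolding tail_def by (intro Bochner_Integration.integral_nonneg mult_nonneg_nonneg g0_nonneg) auto

lemma tail_antimono: "q \<le> q' \<Longrightarrow> tail t q' \<le> tail t q"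
  unfolding tail_def
  by (intro integral_mono indicator_g0_integrable mult_right_mono g0_nonneg) (auto simp: indicator_def)

lemma tail_le_1:
  assumes "t \<in> {0..1}"
  shows "tail t q \<le> 1"
proof -
  have "tail t q \<le> (LINT r|lborel. g0 t r)"
    unfolding tail_def
    by (intro integral_mono indicator_g0_integrable g0_integrable) (auto simp: indicator_def g0_nonneg)
  then show ?thesis using g0_integral[OF assms] by simp
qed

lemma tail_diff:
  assumes "q \<le> q'"
  shows "tail t q - tail t q' = (LINT r|lborel. indicator {q..<q'} r * g0 t r)"
proof -
  have "tail t q - tail t q' = (LINT r|lborel. indicator {q..} r * g0 t r - indicator {q'..} r * g0 t r)"
    unfolding tail_def by (intro Bochner_Integration.integral_diff[symmetric] indicator_g0_integrable) auto
  also have "\<dots> = (LINT r|lborel. indicator {q..<q'} r * g0 t r)"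
    using assms by (intro Bochner_Integration.integral_cong) (auto simp: indicator_def)
  finally show ?thesis .
qed

lemma tail_lipschitz:
  assumes "q \<le> q'"
  shows "\<bar>tail t q - tail t q'\<bar> \<le> gbound * (q' - q)"
proof -
  have "(LINT r|lborel. indicator {q..<q'} r * g0 t r) \<le> (LINT r|lborel. indicator {q..<q'} r * gbound)"
    using assms gbound
    by (intro integral_mono indicator_g0_integrable mult_left_mono integrable_mult_left integrable_real_indicator) auto
  also have "\<dots> = gbound * (q' - q)" using assms by simp
  finally show ?thesis using tail_diff[OF assms, of t] tail_antimono[OF assms, of t] by simp
qed

lemma tail_continuous: "continuous_on UNIV (tail t)"
proof -
  have "\<bar>tail t x - tail t y\<bar> \<le> gbound * \<bar>x - y\<bar>" for x y
    using tail_lipschitz[of x y t] tail_lipschitz[of y x t] by (cases "x \<le> y") (auto simp: abs_minus_commute)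
  then have "gbound-lipschitz_on UNIV (tail t)"
    using gbound by (intro lipschitz_onI) (auto simp: dist_real_def)
  then show ?thesis by (rule lipschitz_on_continuous_on)
qed

lemma tail_1: "tail t 1 = 0"
  unfolding tail_def
proof (rule integral_eq_zero_AE)
  show "AE r in lborel. indicator {1..} r * g0 t r = 0"
    using AE_lborel_singleton[of 1] by eventually_elim (auto simp: g0_def indicator_def)
qed

lemma tail_meas [measurable (raw)]:
  assumes [measurable]: "f \<in> borel_measurable Q" "h \<in> borel_measurable Q"
  shows "(\<lambda>x. tail (f x) (h x)) \<in> borel_measurable Q"
proof -
  have "(\<lambda>(x, r). (if h x \<le> r then 1 else 0) * g0 (f x) r) \<in> borel_measurable (Q \<Otimes>\<^sub>M lborel)"
    by measurable
  then have "(\<lambda>x. LINT r|lborel. (if h x \<le> r then 1 else 0) * g0 (f x) r) \<in> borel_measurable Q"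
    by (rule lborel.borel_measurable_lebesgue_integral)
  moreover have "(LINT r|lborel. (if h x \<le> r then 1 else 0) * g0 (f x) r) = tail (f x) (h x)" for x
    unfolding tail_def by (intro Bochner_Integration.integral_cong) (auto simp: indicator_def)
  ultimately show ?thesis by simp
qed

lemma N_meas_pair [measurable (raw)]:
  assumes [measurable]: "f \<in> borel_measurable Q" "h \<in> borel_measurable Q"
  shows "(\<lambda>x. N (f x) (h x)) \<in> borel_measurable Q"
  unfolding N_def by measurable

lemma cdf_type_dist:
  assumes t: "t \<in> {0..1}"
  shows "1 - cdf (type_dist g t) q = tail t q"
proof -
  have "emeasure (type_dist g t) {..q} = (\<integral>\<^sup>+r. ennreal (g0 t r) * indicator {..q} r \<partial>lborel)"
    unfolding type_dist_eq[OF t] by (rule emeasure_density) auto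
  also have "\<dots> = (\<integral>\<^sup>+r. ennreal (indicator {..q} r * g0 t r) \<partial>lborel)"
    by (intro nn_integral_cong) (auto simp: indicator_def)
  finally have "cdf (type_dist g t) q = (LINT r|lborel. indicator {..q} r * g0 t r)"
    unfolding cdf_def measure_def
    by (subst integral_eq_nn_integral) (auto simp: g0_nonneg)
  moreover have "(LINT r|lborel. g0 t r) = (LINT r|lborel. indicator {..q} r * g0 t r) + tail t q"
  proof -
    have "(LINT r|lborel. g0 t r) = (LINT r|lborel. indicator {..q} r * g0 t r + indicator {q..} r * g0 t r)"
    proof (rule integral_cong_AE)
      show "AE r in lborel. g0 t r = indicator {..q} r * g0 t r + indicator {q..} r * g0 t r"
        using AE_lborel_singleton[of q] by eventually_elim (auto simp: indicator_def)
    qed measurable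
    then show ?thesis unfolding tail_def by (simp add: indicator_g0_integrable)
  qed
  ultimately show ?thesis using g0_integral[OF t] by simp
qed

lemma arrivals_above_eq: "arrivals_above lam g q = (LINT t:{0..1}|lborel. N q t)"
  unfolding arrivals_above_def
  by (intro set_lebesgue_integral_cong) (auto simp: N_def cdf_type_dist lam0_def)

text \<open>
  By Fubini the difference is the integral over \<open>r \<in> [q, q')\<close> of the total density
  \<open>\<integral> lam t * g t r dt\<close>, which is positive for \<open>0 < r < 1\<close>.
\<close>

lemma N_strict:
  assumes q: "0 \<le> q" "q < q'" "q' \<le> 1"
  shows "(LINT t:{0..1}|lborel. N q' t) < (LINT t:{0..1}|lborel. N q t)"
proof -
  have N_le: "\<bar>N p t\<bar> \<le> M" if "t \<in> {0..1}" for p t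
  proof -
    have "lam0 t * tail t p \<le> M * 1"
      using that by (intro mult_mono lam0_le tail_le_1 tail_nonneg order_trans[OF lam0_nonneg lam0_le])
    then show ?thesis unfolding N_def using lam0_nonneg tail_nonneg by (simp add: abs_mult)
  qed
  have intN: "set_integrable lborel {0..1} (N p)" for p
    by (rule set_integrable_bounded[where B=M]) (use N_le in \<open>auto simp: set_borel_measurable_def\<close>)
  define J where "J = (\<lambda>(t, r). lam0 t * (indicator {q..<q'} r * g0 t r))"
  have iJ: "integrable (lborel \<Otimes>\<^sub>M lborel) J"
  proof (rule lborel_pair.Fubini_integrable)
    show "J \<in> borel_measurable (lborel \<Otimes>\<^sub>M lborel)"
      unfolding J_def by measurable
    have inner: "(LINT r|lborel. norm (J (t, r))) = N q t - N q' t" for t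
      unfolding J_def N_def using q lam0_nonneg[of t] tail_diff[of q q' t] g0_nonneg
      by (simp add: abs_mult flip: right_diff_distrib)
    have "N p t = indicator {0..1} t *\<^sub>R N p t" for p t by (simp add: N_def lam0_def indicator_def)
    then have "integrable lborel (N p)" for p using intN[of p] unfolding set_integrable_def by (metis (no_types, lifting) ext)
    then show "integrable lborel (\<lambda>t. LINT r|lborel. norm (J (t, r)))" unfolding inner by simp
    show "AE t in lborel. integrable lborel (\<lambda>r. J (t, r))"
      unfolding J_def by (simp add: indicator_g0_integrable)
  qed
  define \<phi> where "\<phi> r = indicator {q..<q'} r * (LINT t:{0..1}|lborel. lam t * g t r)" for r
  have phi: "(LINT t|lborel. J (t, r)) = \<phi> r" for r
  proof -
    have "J (t, r) = indicator {q..<q'} r * (indicator {0..1} t *\<^sub>R (lam t * g t r))" for t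
      using q by (auto simp: J_def lam0_def g0_def indicator_def)
    then show ?thesis by (simp add: \<phi>_def set_lebesgue_integral_def)
  qed
  have "(LINT t:{0..1}|lborel. N q t) - (LINT t:{0..1}|lborel. N q' t) = (LINT t:{0..1}|lborel. N q t - N q' t)"
    using intN by (simp add: set_integral_diff(2))
  also have "\<dots> = (LINT t|lborel. LINT r|lborel. J (t, r))"
    unfolding set_lebesgue_integral_def J_def
  proof (intro Bochner_Integration.integral_cong refl)
    fix t show "indicator {0..1} t *\<^sub>R (N q t - N q' t)
      = (LINT r|lborel. (case (t, r) of (t, r) \<Rightarrow> lam0 t * (indicator {q..<q'} r * g0 t r)))"
      using q tail_diff[of q q' t] by (simp add: N_def lam0_def indicator_def flip: right_diff_distrib)
  qed
  also have "\<dots> = (LINT r|lborel. LINT t|lborel. J (t, r))"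
    using lborel_pair.Fubini_integral[of "\<lambda>t r. J (t, r)"] iJ by simp
  also have "\<dots> = (LINT r|lborel. \<phi> r)" unfolding phi ..
  finally have eq: "(LINT t:{0..1}|lborel. N q t) - (LINT t:{0..1}|lborel. N q' t) = (LINT r|lborel. \<phi> r)" .
  have phi_int: "integrable lborel \<phi>"
    using lborel_pair.integrable_snd[of "\<lambda>t r. J (t, r)"] iJ unfolding phi by simp
  have J_nonneg: "0 \<le> J p" for p
    using lam0_nonneg g0_nonneg by (auto simp: J_def split: prod.splits)
  have phi_nonneg: "0 \<le> \<phi> r" for r
    unfolding phi[symmetric] by (rule Bochner_Integration.integral_nonneg) (rule J_nonneg)
  have "(LINT r|lborel. \<phi> r) \<noteq> 0"
  proof
    assume "(LINT r|lborel. \<phi> r) = 0"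
    then have "AE r in lborel. \<phi> r = 0"
      using integral_nonneg_eq_0_iff_AE[OF phi_int] phi_nonneg by simp
    then have "AE r in lborel. r \<notin> {q<..<q'}"
    proof eventually_elim
      case (elim r)
      then show ?case using demand_pos[of r] q by (auto simp: \<phi>_def)
    qed
    then have "emeasure lborel {q<..<q'} = 0"
      by (subst (asm) AE_iff_null_sets[symmetric]) auto
    then show False using q by simp
  qed
  moreover have "0 \<le> (LINT r|lborel. \<phi> r)" using phi_nonneg by (rule Bochner_Integration.integral_nonneg)
  ultimately show ?thesis using eq by simp
qed

lemma demand_N:
  assumes "1 \<le> K" and "1 \<le> m" and "switching_vector K m s"
  shows "demand K m M s N"
proof
  show "N q t \<le> M" if "t \<in> {0..1}" for q t
  proof -
    have "lam0 t * tail t q \<le> M * 1"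
      using that by (intro mult_mono lam0_le tail_le_1 tail_nonneg order_trans[OF lam0_nonneg lam0_le])
    then show ?thesis unfolding N_def by simp
  qed
  show "continuous_on UNIV (\<lambda>q. N q t)" for t
    unfolding N_def by (intro continuous_on_mult continuous_on_const tail_continuous)
qed (use assms in \<open>auto simp: N_def lam0_nonneg tail_nonneg tail_1 set_borel_measurable_def
      intro!: mult_left_mono tail_antimono N_strict[unfolded N_def]\<close>)

end

section \<open>Linear programming duality for a fixed policy\<close>

text \<open>
  The value functions \<open>V\<^sup>k\<close> of the primal problem, built up from \<open>V\<^sup>0 = 0\<close>; \<open>c k\<close> stands for the
  inflow of price revenue.
\<close>

primrec value_fun :: "(nat \<Rightarrow> real \<Rightarrow> real) \<Rightarrow> (nat \<Rightarrow> real \<Rightarrow> real) \<Rightarrow> nat \<Rightarrow> real \<Rightarrow> real" where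
  "value_fun a c 0 = (\<lambda>_. 0)"
| "value_fun a c (Suc k) = back_sol (a (Suc k)) (\<lambda>t. - c (Suc k) t - a (Suc k) t * value_fun a c k t)"

lemma value_fun_deriv:
  assumes a: "\<And>k. k \<in> {1..K} \<Longrightarrow> set_integrable lborel {0..1} (a k)"
    and c: "\<And>k. k \<in> {1..K} \<Longrightarrow> set_integrable lborel {0..1} (c k)"
    and k: "k \<in> {1..K}"
  shows "has_time_deriv (value_fun a c k)
    (\<lambda>t. - c k t + a k t * (value_fun a c k t - value_fun a c (k - 1) t))"
proof -
  have cont: "continuous_on {0..1} (value_fun a c k) \<and> (1 \<le> k \<longrightarrow> has_time_deriv (value_fun a c k)
    (\<lambda>t. a k t * value_fun a c k t + (- c k t - a k t * value_fun a c (k - 1) t)))" if "k \<le> K" for k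
    using that
  proof (induction k)
    case (Suc k)
    then have IH: "continuous_on {0..1} (value_fun a c k)" by simp
    have "set_integrable lborel {0..1} (\<lambda>t. - c (Suc k) t - a (Suc k) t * value_fun a c k t)"
      using set_integral_diff(1)[OF _ set_integrable_mult_continuous[OF a[of "Suc k"] IH], of "\<lambda>t. - c (Suc k) t"]
        c[of "Suc k"] Suc.prems by (simp add: set_integrable_def)
    from has_time_deriv_back_sol[OF a[of "Suc k"] this] Suc.prems
    have "has_time_deriv (value_fun a c (Suc k))
      (\<lambda>t. a (Suc k) t * value_fun a c (Suc k) t + (- c (Suc k) t - a (Suc k) t * value_fun a c k t))" by simp
    then show ?case using has_time_deriv_continuous by simp
  qed simp
  have "has_time_deriv (value_fun a c k)
    (\<lambda>t. a k t * value_fun a c k t + (- c k t - a k t * value_fun a c (k - 1) t))"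
    using cont[of k] k by simp
  then show ?thesis by (rule has_time_deriv_cong) (simp_all add: algebra_simps)
qed

lemma value_fun_1: "value_fun a c k 1 = 0"
  by (cases k) (simp_all add: back_sol_1)

locale market_policy = market M lam g for M lam g +
  fixes K m :: nat and s :: "nat \<Rightarrow> nat" and \<tau> :: "nat \<Rightarrow> real"
  assumes K_ge_1: "1 \<le> K" and m_ge_1: "1 \<le> m" and policy: "(\<tau>, s) \<in> policies K m"
begin

lemma sv: "switching_vector K m s"
  using policy unfolding policies_def by auto

sublocale demand K m M s N
  by (rule demand_N[OF K_ge_1 m_ge_1 sv])

lemma tau_range:
  assumes "k \<in> {1..K}"
  shows "0 \<le> \<tau> (seg m s k)" and "\<tau> (seg m s k) \<le> 1"
  using policy seg_props(1)[OF sv assms] unfolding policies_def by auto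

lemma bench_eq: "Pois_min K (arrivals_above lam g q) = bench q"
  by (simp add: bench_def total_def arrivals_above_eq)

text \<open>
  The expression \<open>sales\<close> for an arbitrary family \<open>x\<close> in place of the death chain, since the dual
  problem leaves \<open>x\<close> free to be any solution of the equations.
\<close>

definition revenue :: "(nat \<Rightarrow> real \<Rightarrow> real) \<Rightarrow> real \<Rightarrow> real" where
  "revenue x q = (\<Sum>k=1..K. LINT t:{0..1}|lborel. N (max q (\<tau> (seg m s k))) t * x k t)"

lemma dual_y_eq:
  assumes "t \<in> {0..1}" and "0 \<le> p" and "k \<le> K"
  shows "indicator {p..1} q *\<^sub>R dual_y K m \<tau> s lam g x k t q
    = lam0 t * x k t * (indicator {max p (\<tau> (seg m s k))..} q * g0 t q)"
  using assms by (auto simp: dual_y_def lam0_def g0_def indicator_def)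

lemma dual_y_integrable:
  assumes "t \<in> {0..1}" and "0 \<le> p"
  shows "set_integrable lborel {p..1} (dual_y K m \<tau> s lam g x k t)"
proof (cases "k \<le> K")
  case True
  then show ?thesis unfolding set_integrable_def dual_y_eq[OF assms True]
    by (intro integrable_mult_right indicator_g0_integrable) simp
next
  case False
  then show ?thesis by (simp add: dual_y_def[abs_def] set_integrable_def)
qed

lemma dual_y_integral:
  assumes "t \<in> {0..1}" and "0 \<le> p" and "k \<le> K"
  shows "(LINT q:{p..1}|lborel. dual_y K m \<tau> s lam g x k t q) = N (max p (\<tau> (seg m s k))) t * x k t"
  unfolding set_lebesgue_integral_def dual_y_eq[OF assms] by (simp add: N_def tail_def)

lemma dual_y_beyond: "K < k \<Longrightarrow> dual_y K m \<tau> s lam g x k t q = 0"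
  by (simp add: dual_y_def)

definition flow :: "(nat \<Rightarrow> real \<Rightarrow> real) \<Rightarrow> nat \<Rightarrow> real \<Rightarrow> real" where
  "flow x k t = (if k \<le> K then N (\<tau> (seg m s k)) t * x k t else 0)"

lemma dual_outflow:
  assumes t: "t \<in> {0..1}" and k: "k \<in> {1..K}"
  shows "(LINT q:{0..1}|lborel. dual_y K m \<tau> s lam g x k t q - dual_y K m \<tau> s lam g x (Suc k) t q)
    = flow x k t - flow x (Suc k) t"
proof -
  have one: "(LINT q:{0..1}|lborel. dual_y K m \<tau> s lam g x j t q) = flow x j t" if "1 \<le> j" for j
  proof (cases "j \<le> K")
    case True
    then have "max 0 (\<tau> (seg m s j)) = \<tau> (seg m s j)" using tau_range(1)[of j] that by simp
    then show ?thesis using dual_y_integral[OF t order_refl True, of x] True by (simp add: flow_def)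
  qed (simp add: dual_y_beyond flow_def)
  show ?thesis
    using one[of k] one[of "Suc k"] k
    by (subst set_integral_diff(2)) (auto intro: dual_y_integrable t)
qed

lemma dual_revenue:
  assumes "q \<in> {0..1}"
  shows "(\<Sum>k=1..K. LINT t:{0..1}|lborel. LINT q':{q..1}|lborel. dual_y K m \<tau> s lam g x k t q') = revenue x q"
  unfolding revenue_def using assms
  by (intro sum.cong refl set_lebesgue_integral_cong) (auto simp: dual_y_integral)

lemma dual_feasible_iff:
  "dual_feasible K m \<tau> s lam g \<theta> x \<longleftrightarrow>
     x K 0 = 1 \<and> (\<forall>k\<in>{1..<K}. x k 0 = 0) \<and>
     (\<forall>k\<in>{1..K}. has_time_deriv (x k) (\<lambda>t. - (flow x k t - flow x (Suc k) t))) \<and>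
     (\<forall>q\<in>{0..1}. \<theta> * bench q \<le> revenue x q)"
proof -
  have "has_time_deriv (x k) (\<lambda>t. - (LINT q:{0..1}|lborel. dual_y K m \<tau> s lam g x k t q - dual_y K m \<tau> s lam g x (Suc k) t q))
      \<longleftrightarrow> has_time_deriv (x k) (\<lambda>t. - (flow x k t - flow x (Suc k) t))" if "k \<in> {1..K}" for k
    using dual_outflow[OF _ that] by (auto elim!: has_time_deriv_cong)
  then show ?thesis unfolding dual_feasible_def Let_def bench_eq
    by (simp add: dual_revenue del: One_nat_def)
qed

lemma revenue_occ: "revenue (occ \<tau>) q = sales \<tau> q"
  by (simp add: revenue_def sales_def)

lemma dual_feasible_occ:
  assumes "\<And>q. q \<in> {0..1} \<Longrightarrow> \<theta> * bench q \<le> sales \<tau> q"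
  shows "dual_feasible K m \<tau> s lam g \<theta> (occ \<tau>)"
proof -
  interpret death_rates K M "rate \<tau>" by (rule death_rates_rate)
  have "exit_flow k = flow (occ \<tau>) k" for k
    by (auto simp: exit_flow_def flow_def rate_def fun_eq_iff)
  then show ?thesis
    unfolding dual_feasible_iff revenue_occ using assms death_0 death_deriv K_ge_1 by auto
qed

text \<open>The price schedule enters the value equation only through this average.\<close>

definition price_flow :: "real measure \<Rightarrow> nat \<Rightarrow> real \<Rightarrow> real" where
  "price_flow F k t = (LINT q|F. N (max q (\<tau> (seg m s k))) t)"

context
  fixes F :: "real measure"
  assumes sets_F: "sets F = sets (restrict_space borel {0..1})" and fin: "finite_measure F"
begin

interpretation F: finite_measure F by (rule fin)
interpretation FL: pair_sigma_finite F lborel ..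

lemma space_F: "space F = {0..1}"
  using sets_eq_imp_space_eq[OF sets_F] by (simp add: space_restrict_space)

lemma meas_F [measurable (raw)]: "f \<in> borel_measurable borel \<Longrightarrow> f \<in> borel_measurable F"
  using measurable_restrict_space1[of f borel borel "{0..1}"] measurable_cong_sets[OF sets_F refl] by blast

lemma id_meas_F [measurable]: "(\<lambda>q. q) \<in> borel_measurable F"
  by (rule meas_F) simp

lemma N_bound: "\<bar>N q t\<bar> \<le> M"
  using N_nonneg[of t q] N_le[of t q] M_nonneg by (cases "t \<in> {0..1}") (auto simp: N_def lam0_def)

text \<open>
  \<open>F[0,q]\<close> is the \<open>F\<close>-integral of the indicator of \<open>p \<le> q\<close>. Exchanging this integral with the one
  over the types turns the price part into an average of the demand curve.
\<close>

lemma utility_integral: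
  assumes t: "t \<in> {0..1}" and k: "k \<in> {1..K}"
  shows "- lam t * (LINT q:{\<tau> (seg m s k)..1}|type_dist g t. utility F V k t q)
    = - price_flow F k t + N (\<tau> (seg m s k)) t * (V k t - V (k - 1) t)"
proof -
  let ?\<tau> = "\<tau> (seg m s k)" and ?v = "V k t - V (k - 1) t"
  have cum: "measure F {0..q} = (LINT p|F. indicator {p..} q)" if "q \<in> {0..1}" for q
  proof -
    have "(LINT p|F. indicator {p..} q) = (LINT p|F. indicator {0..q} p)"
      by (intro Bochner_Integration.integral_cong refl) (auto simp: space_F indicator_def)
    also have "\<dots> = measure F {0..q}"
    proof -
      have "{0..q} \<in> sets F" unfolding sets_F using that by (auto simp: sets_restrict_space)
      then show ?thesis by simp
    qed
    finally show ?thesis ..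
  qed
  \<comment> \<open>Types that are both served in state \<open>k\<close> and charged by the mass of \<open>F\<close> at \<open>p\<close>.\<close>
  define J where "J = (\<lambda>(p, q). indicator {max p ?\<tau>..} q * g0 t q)"
  have J_meas: "J \<in> borel_measurable (F \<Otimes>\<^sub>M lborel)"
  proof -
    have "(\<lambda>(p, q). (if max p ?\<tau> \<le> q then 1 else 0) * g0 t q) \<in> borel_measurable (F \<Otimes>\<^sub>M lborel)"
      by measurable
    moreover have "J = (\<lambda>(p, q). (if max p ?\<tau> \<le> q then 1 else 0) * g0 t q)"
      by (auto simp: J_def indicator_def fun_eq_iff)
    ultimately show ?thesis by simp
  qed
  have inner: "(LINT q|lborel. J (p, q)) = tail t (max p ?\<tau>)" for p by (simp add: J_def tail_def)
  have J_int: "integrable (F \<Otimes>\<^sub>M lborel) J"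
  proof (rule FL.Fubini_integrable[OF J_meas])
    have "norm (J (p, q)) = J (p, q)" for p q by (simp add: J_def g0_nonneg abs_mult)
    then have "(LINT q|lborel. norm (J (p, q))) = tail t (max p ?\<tau>)" for p by (simp add: inner)
    moreover have "integrable F (\<lambda>p. tail t (max p ?\<tau>))"
      by (rule F.integrable_const_bound[of _ 1]) (auto simp: tail_nonneg tail_le_1[OF t])
    ultimately show "integrable F (\<lambda>p. LINT q|lborel. norm (J (p, q)))" by simp
    show "AE p in F. integrable lborel (\<lambda>q. J (p, q))" by (simp add: J_def indicator_g0_integrable)
  qed
  have cum_int: "integrable lborel (\<lambda>q. LINT p|F. J (p, q))"
    using FL.integrable_snd[of "\<lambda>p q. J (p, q)"] J_int by simp
  have sec: "(LINT p|F. J (p, q)) = indicator {?\<tau>..1} q * g0 t q * measure F {0..q}" for q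
  proof (cases "q \<in> {0..1}")
    case True
    have "(LINT p|F. J (p, q)) = (LINT p|F. (indicator {?\<tau>..1} q * g0 t q) * indicator {p..} q)"
      using True by (intro Bochner_Integration.integral_cong) (auto simp: J_def indicator_def)
    then show ?thesis using cum[OF True] by simp
  next
    case False
    then show ?thesis by (auto simp: J_def g0_def)
  qed
  have "(LINT q:{?\<tau>..1}|type_dist g t. utility F V k t q)
      = (LINT q|lborel. (LINT p|F. J (p, q)) - indicator {?\<tau>..} q * g0 t q * ?v)"
  proof -
    have "(\<lambda>q. (indicator {?\<tau>..1} q :: real) *\<^sub>R (\<lambda>q. indicator {0..1} q * utility F V k t q) q) \<in> borel_measurable lborel"
    proof -
      have "(\<lambda>(q, p). (if p \<le> q then 1 else 0 :: real)) \<in> borel_measurable (lborel \<Otimes>\<^sub>M F)"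
        by measurable
      then have "(\<lambda>q. LINT p|F. (if p \<le> q then 1 else 0 :: real)) \<in> borel_measurable lborel"
        by (rule F.borel_measurable_lebesgue_integral)
      moreover have "(LINT p|F. (if p \<le> q then 1 else 0 :: real)) = measure F {0..q}" if "q \<in> {0..1}" for q
        unfolding cum[OF that] by (intro Bochner_Integration.integral_cong) (auto simp: indicator_def)
      ultimately have "(\<lambda>q. indicator {0..1} q * measure F {0..q}) \<in> borel_measurable lborel"
        by (subst measurable_cong[where g="\<lambda>q. indicator {0..1} q * (LINT p|F. (if p \<le> q then 1 else 0 :: real))"])
           (auto simp: indicator_def)
      then have "(\<lambda>q. indicator {?\<tau>..1} q *\<^sub>R (indicator {0..1} q * measure F {0..q} - indicator {0..1} q * ?v)) \<in> borel_measurable lborel"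
        by measurable
      then show ?thesis by (simp add: utility_def right_diff_distrib)
    qed
    moreover have "(\<lambda>q. indicator {?\<tau>..1} q *\<^sub>R (\<lambda>q. indicator {0..1} q * utility F V k t q) q)
        = (\<lambda>q. indicator {?\<tau>..1} q *\<^sub>R utility F V k t q)"
      using tau_range(1)[OF k] by (auto simp: fun_eq_iff indicator_def)
    ultimately have meas: "(\<lambda>q. indicator {?\<tau>..1} q *\<^sub>R utility F V k t q) \<in> borel_measurable lborel"
      by (simp only:)
    have "(LINT q:{?\<tau>..1}|type_dist g t. utility F V k t q)
        = (LINT q|lborel. g0 t q *\<^sub>R (indicator {?\<tau>..1} q *\<^sub>R utility F V k t q))"
      unfolding set_lebesgue_integral_def type_dist_eq[OF t]
      by (rule integral_density[OF meas]) (auto simp: g0_nonneg)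
    also have "\<dots> = (LINT q|lborel. (LINT p|F. J (p, q)) - indicator {?\<tau>..} q * g0 t q * ?v)"
      unfolding sec utility_def
      by (intro Bochner_Integration.integral_cong refl) (auto simp: g0_def indicator_def algebra_simps)
    finally show ?thesis .
  qed
  also have "\<dots> = (LINT q|lborel. LINT p|F. J (p, q)) - tail t ?\<tau> * ?v"
    unfolding tail_def using cum_int
    by (subst Bochner_Integration.integral_diff) (auto intro!: indicator_g0_integrable integrable_mult_left)
  also have "(LINT q|lborel. LINT p|F. J (p, q)) = (LINT p|F. tail t (max p ?\<tau>))"
    using FL.Fubini_integral[of "\<lambda>p q. J (p, q)"] J_int by (simp add: inner)
  finally have util: "(LINT q:{?\<tau>..1}|type_dist g t. utility F V k t q)
    = (LINT p|F. tail t (max p ?\<tau>)) - tail t ?\<tau> * ?v" .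
  have "price_flow F k t = lam t * (LINT p|F. tail t (max p ?\<tau>))"
    using t by (simp add: price_flow_def N_def lam0_def)
  moreover have "N ?\<tau> t = lam t * tail t ?\<tau>" using t by (simp add: N_def lam0_def)
  ultimately show ?thesis unfolding util by (simp only: right_diff_distrib mult.assoc minus_mult_left[symmetric] minus_diff_eq)
qed

lemma flow_prices_integrable:
  assumes x: "has_time_deriv x x'"
  shows "integrable (F \<Otimes>\<^sub>M lborel) (\<lambda>(q, t). indicator {0..1} t * (N (max q c) t * x t))"
proof -
  obtain B where B: "0 \<le> B" "\<forall>t\<in>{0..1}. \<bar>x t\<bar> \<le> B"
    using continuous_on_01_bounded[OF has_time_deriv_continuous[OF x]] by blast
  have xm: "(\<lambda>t. indicator {0..1} t * x t) \<in> borel_measurable borel"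
    using has_time_deriv_measurable[OF x] by (simp add: set_borel_measurable_def)
  have bnd: "\<bar>indicator {0..1} t * (N (max q c) t * x t)\<bar> \<le> indicator {0..1} t * (M * B)" for q t :: real
    using B N_bound[of "max q c" t] M_nonneg by (auto simp: indicator_def abs_mult intro!: mult_mono)
  have m: "(\<lambda>(q, t). indicator {0..1} t * (N (max q c) t * x t)) \<in> borel_measurable (F \<Otimes>\<^sub>M lborel)"
  proof -
    have "(\<lambda>p. N (max (fst p) c) (snd p) * (indicator {0..1} (snd p) * x (snd p))) \<in> borel_measurable (F \<Otimes>\<^sub>M lborel)"
      using measurable_compose[OF measurable_snd xm, of F] by measurable
    then show ?thesis by (simp add: case_prod_beta mult.left_commute)
  qed
  have iw: "integrable lborel (\<lambda>t::real. indicator {0..1} t * (M * B) :: real)"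
    by (intro integrable_mult_left integrable_real_indicator) auto
  have inner: "integrable lborel (\<lambda>t. indicator {0..1} t * (N (max q c) t * x t))" if "q \<in> space F" for q
  proof (rule Bochner_Integration.integrable_bound[OF iw])
    show "(\<lambda>t. indicator {0..1} t * (N (max q c) t * x t)) \<in> borel_measurable lborel"
      using measurable_Pair2[OF m that] by simp
    show "AE t in lborel. norm (indicator {0..1} t * (N (max q c) t * x t)) \<le> norm (indicator {0..1} t * (M * B))"
      using bnd[of _ q] by (auto intro!: AE_I2 intro: order_trans[OF _ abs_ge_self])
  qed
  show ?thesis
  proof (rule FL.Fubini_integrable[OF m])
    show "AE q in F. integrable lborel (\<lambda>t. case (q, t) of (q, t) \<Rightarrow> indicator {0..1} t * (N (max q c) t * x t))"
      using inner by (auto intro!: AE_I2)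
    show "integrable F (\<lambda>q. LINT t|lborel. norm (case (q, t) of (q, t) \<Rightarrow> indicator {0..1} t * (N (max q c) t * x t)))"
    proof (rule F.integrable_const_bound[of _ "M * B"])
      have "(\<lambda>(q, t). norm (indicator {0..1} t * (N (max q c) t * x t))) \<in> borel_measurable (F \<Otimes>\<^sub>M lborel)"
        using measurable_compose[OF m borel_measurable_norm] by (simp add: case_prod_beta)
      then show "(\<lambda>q. LINT t|lborel. norm (case (q, t) of (q, t) \<Rightarrow> indicator {0..1} t * (N (max q c) t * x t))) \<in> borel_measurable F"
        using lborel.borel_measurable_lebesgue_integral[of "\<lambda>q t. norm (indicator {0..1} t * (N (max q c) t * x t))" F] by simp
      show "AE q in F. norm (LINT t|lborel. norm (case (q, t) of (q, t) \<Rightarrow> indicator {0..1} t * (N (max q c) t * x t))) \<le> M * B"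
      proof (rule AE_I2)
        fix q assume q: "q \<in> space F"
        have "(LINT t|lborel. \<bar>indicator {0..1} t * (N (max q c) t * x t)\<bar>) \<le> (LINT t|lborel. indicator {0..1::real} t * (M * B))"
          using inner[OF q] bnd[of _ q] iw by (intro integral_mono) auto
        moreover have "0 \<le> (LINT t|lborel. \<bar>indicator {0..1} t * (N (max q c) t * x t)\<bar>)"
          by (intro Bochner_Integration.integral_nonneg) simp
        ultimately show "norm (LINT t|lborel. norm (case (q, t) of (q, t) \<Rightarrow> indicator {0..1} t * (N (max q c) t * x t))) \<le> M * B"
          by simp
      qed
    qed
  qed
qed

lemma price_flow_swap:
  assumes x: "has_time_deriv x x'"
  shows "(LINT t:{0..1}|lborel. price_flow F k t * x t)
      = (LINT q|F. (LINT t:{0..1}|lborel. N (max q (\<tau> (seg m s k))) t * x t))"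
    and "integrable F (\<lambda>q. LINT t:{0..1}|lborel. N (max q (\<tau> (seg m s k))) t * x t)"
    and "set_integrable lborel {0..1} (\<lambda>t. price_flow F k t * x t)"
proof -
  let ?J = "\<lambda>q t. indicator {0..1} t * (N (max q (\<tau> (seg m s k))) t * x t)"
  note J = flow_prices_integrable[OF x, of "\<tau> (seg m s k)"]
  have snd: "(LINT q|F. ?J q t) = indicator {0..1} t *\<^sub>R (price_flow F k t * x t)" for t
    unfolding price_flow_def by (simp add: mult.assoc[symmetric] mult.commute[of _ "x t"])
  have "(LINT t|lborel. LINT q|F. ?J q t) = (LINT q|F. LINT t|lborel. ?J q t)"
    using FL.Fubini_integral[of ?J] J by simp
  then show "(LINT t:{0..1}|lborel. price_flow F k t * x t)
      = (LINT q|F. (LINT t:{0..1}|lborel. N (max q (\<tau> (seg m s k))) t * x t))"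
    unfolding snd by (simp add: set_lebesgue_integral_def)
  show "integrable F (\<lambda>q. LINT t:{0..1}|lborel. N (max q (\<tau> (seg m s k))) t * x t)"
    using FL.integrable_fst[of ?J] J by (simp add: set_lebesgue_integral_def)
  show "set_integrable lborel {0..1} (\<lambda>t. price_flow F k t * x t)"
    using FL.integrable_snd[of ?J] J unfolding snd set_integrable_def .
qed

text \<open>
  In the derivative of \<open>\<Sum>k. x k t * V k t\<close> the flow out of state \<open>k\<close> meets \<open>V (k - 1)\<close> twice with
  opposite signs, so the sum telescopes and only the prices remain. Integration from \<open>0\<close>, where the sum
  is \<open>V K 0\<close>, to \<open>1\<close>, where it vanishes, gives the identity.
\<close>

lemma value_eq_revenue:
  assumes x0: "x K 0 = 1" "\<And>k. k \<in> {1..<K} \<Longrightarrow> x k 0 = 0"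
    and x: "\<And>k. k \<in> {1..K} \<Longrightarrow> has_time_deriv (x k) (\<lambda>t. - (flow x k t - flow x (Suc k) t))"
    and V1: "\<And>k. k \<in> {1..K} \<Longrightarrow> V k 1 = 0" and V0: "\<And>t. t \<in> {0..1} \<Longrightarrow> V 0 t = 0"
    and V: "\<And>k. k \<in> {1..K} \<Longrightarrow> has_time_deriv (V k)
      (\<lambda>t. - price_flow F k t + N (\<tau> (seg m s k)) t * (V k t - V (k - 1) t))"
  shows "V K 0 = (LINT q|F. revenue x q)" and "integrable F (revenue x)"
proof -
  have W: "has_time_deriv (\<lambda>t. \<Sum>k=1..K. x k t * V k t) (\<lambda>t. - (\<Sum>k=1..K. price_flow F k t * x k t))"
  proof (rule has_time_deriv_cong[OF has_time_deriv_sum[OF _ has_time_deriv_mult[OF x V]]])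
    fix t :: real assume t: "t \<in> {0..1}"
    let ?f = "\<lambda>k. flow x k t * V (k - 1) t"
    have "(\<Sum>k=1..K. - (flow x k t - flow x (Suc k) t) * V k t
        + (- price_flow F k t + N (\<tau> (seg m s k)) t * (V k t - V (k - 1) t)) * x k t)
      = (\<Sum>k=1..K. (?f (Suc k) - ?f k) - price_flow F k t * x k t)"
      by (intro sum.cong refl) (auto simp: flow_def algebra_simps)
    also have "\<dots> = (?f (Suc K) - ?f 1) - (\<Sum>k=1..K. price_flow F k t * x k t)"
      using K_ge_1 by (subst sum_subtractf, subst sum_Suc_diff) auto
    also have "\<dots> = - (\<Sum>k=1..K. price_flow F k t * x k t)"
      using V0[OF t] by (simp add: flow_def)
    finally show "(\<Sum>k=1..K. - (flow x k t - flow x (Suc k) t) * V k t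
        + (- price_flow F k t + N (\<tau> (seg m s k)) t * (V k t - V (k - 1) t)) * x k t)
      = - (\<Sum>k=1..K. price_flow F k t * x k t)" .
  qed auto
  have end1: "(\<Sum>k=1..K. x k 1 * V k 1) = 0" using V1 by (intro sum.neutral) auto
  have "(\<Sum>k=1..K. x k 0 * V k 0) = (\<Sum>k=1..K. if k = K then V K 0 else 0)"
    using x0 by (intro sum.cong) auto
  then have start: "(\<Sum>k=1..K. x k 0 * V k 0) = V K 0" using K_ge_1 by simp
  have "V K 0 = - (LINT t:{0..1}|lborel. - (\<Sum>k=1..K. price_flow F k t * x k t))"
    using has_time_deriv_eq[OF W, of 1] end1 start by simp
  also have "\<dots> = (LINT t:{0..1}|lborel. \<Sum>k=1..K. price_flow F k t * x k t)"
    by (simp add: set_lebesgue_integral_def)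
  also have "\<dots> = (\<Sum>k=1..K. LINT t:{0..1}|lborel. price_flow F k t * x k t)"
    by (rule set_integral_sum(2)) (rule price_flow_swap(3)[OF x])
  also have "\<dots> = (\<Sum>k=1..K. LINT q|F. (LINT t:{0..1}|lborel. N (max q (\<tau> (seg m s k))) t * x k t))"
    by (intro sum.cong refl price_flow_swap(1)[OF x])
  also have "\<dots> = (LINT q|F. revenue x q)"
    unfolding revenue_def
    by (rule Bochner_Integration.integral_sum[symmetric]) (rule price_flow_swap(2)[OF x])
  finally show "V K 0 = (LINT q|F. revenue x q)" .
  show "integrable F (revenue x)"
    unfolding revenue_def[abs_def]
    by (rule Bochner_Integration.integrable_sum) (rule price_flow_swap(2)[OF x])
qed

lemma primal_feasible_iff:
  "primal_feasible K m \<tau> s lam g F V \<longleftrightarrow>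
     (\<forall>k\<in>{1..K}. V k 1 = 0) \<and> (\<forall>t\<in>{0..1}. V 0 t = 0) \<and>
     (\<forall>k\<in>{1..K}. has_time_deriv (V k)
       (\<lambda>t. - price_flow F k t + N (\<tau> (seg m s k)) t * (V k t - V (k - 1) t))) \<and>
     (LINT q|F. bench q) = 1"
proof -
  have "has_time_deriv (V k) (\<lambda>t. - lam t * (LINT q:{\<tau> (seg m s k)..1}|type_dist g t. utility F V k t q))
      \<longleftrightarrow> has_time_deriv (V k) (\<lambda>t. - price_flow F k t + N (\<tau> (seg m s k)) t * (V k t - V (k - 1) t))"
    if "k \<in> {1..K}" for k
    using utility_integral[OF _ that] by (auto elim!: has_time_deriv_cong)
  then show ?thesis unfolding primal_feasible_def bench_eq using sets_F fin by simp
qed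

end

end

context market_policy begin

lemma bench_continuous: "continuous_on {0..1} bench"
  unfolding continuous_on_sequentially by (auto simp: o_def intro!: bench_tendsto)

lemma weak_duality: "Dual K m \<tau> s lam g \<le> OP K m \<tau> s lam g"
  unfolding Dual_def OP_def
proof (intro SUP_least INF_greatest)
  fix \<theta> FV assume "\<theta> \<in> {\<theta>. \<exists>x. dual_feasible K m \<tau> s lam g \<theta> x}"
    and FV: "FV \<in> {(F, V). primal_feasible K m \<tau> s lam g F V}"
  then obtain x where x: "dual_feasible K m \<tau> s lam g \<theta> x" by blast
  obtain F V where FV': "FV = (F, V)" by (cases FV)
  have P: "primal_feasible K m \<tau> s lam g F V" using FV FV' by simp
  then have sF: "sets F = sets (restrict_space borel {0..1})" and fF: "finite_measure F"
    unfolding primal_feasible_def by auto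
  note P' = P[unfolded primal_feasible_iff[OF sF fF]]
  note x' = x[unfolded dual_feasible_iff]
  have V: "V K 0 = (LINT q|F. revenue x q)" and ri: "integrable F (revenue x)"
    using value_eq_revenue[OF sF fF, of x V] P' x' by auto
  have one: "(LINT q|F. bench q) = 1" using P' by blast
  then have bi: "integrable F bench" using not_integrable_integral_eq by fastforce
  have "\<theta> = (LINT q|F. \<theta> * bench q)" using one by simp
  also have "\<dots> \<le> (LINT q|F. revenue x q)"
    using bi ri x' space_F[OF sF fF] by (intro integral_mono) auto
  finally show "ereal \<theta> \<le> (case FV of (F, V) \<Rightarrow> ereal (V K 0))" using V FV' by simp
qed

text \<open>
  A point mass at \<open>q\<close>, scaled so as to satisfy the normalisation, is a feasible \<open>F\<close>, and its objective
  value is the ratio at \<open>q\<close>.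
\<close>

lemma OP_le_ratio:
  assumes q: "0 \<le> q" "q < 1"
  shows "OP K m \<tau> s lam g \<le> ereal (ratio \<tau> q)"
proof -
  define w where "w = 1 / bench q"
  have w: "0 \<le> w" "w * bench q = 1" using bench_pos[OF q] by (auto simp: w_def)
  define F where "F = density (return (restrict_space borel {0..1}) q) (\<lambda>_. ennreal w)"
  have sF: "sets F = sets (restrict_space borel {0..1})" by (simp add: F_def)
  have fF: "finite_measure F"
  proof (rule finite_measureI)
    have S: "{0..1} \<in> sets (restrict_space borel {0..1::real})"
      using sets.top[of "restrict_space borel {0..1::real}"] by (simp add: space_restrict_space)
    then have "emeasure F {0..1} = ennreal w * indicator {0..1} q"
      unfolding F_def by (simp add: emeasure_density_const)
    then show "emeasure F (space F) \<noteq> \<infinity>"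
      by (simp add: F_def space_restrict_space ennreal_mult_eq_top_iff indicator_def)
  qed
  have int: "(LINT p|F. f p) = w * f q" if "f \<in> borel_measurable F" for f :: "real \<Rightarrow> real"
  proof -
    have f: "f \<in> borel_measurable (restrict_space borel {0..1})"
      using that measurable_cong_sets[OF sF refl] by blast
    have f': "f \<in> borel_measurable (return (restrict_space borel {0..1}) q)"
      using f by simp
    have "(LINT p|F. f p) = (LINT p|return (restrict_space borel {0..1}) q. w *\<^sub>R f p)"
      unfolding F_def by (rule integral_density[OF f']) (use w in auto)
    also have "\<dots> = w * f q"
      using q f by (subst integral_return) (auto simp: space_restrict_space)
    finally show ?thesis .
  qed
  let ?a = "\<lambda>k. N (\<tau> (seg m s k))" and ?c = "price_flow F"
  have c: "?c k = (\<lambda>t. w * N (max q (\<tau> (seg m s k))) t)" for k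
    unfolding price_flow_def fun_eq_iff
    by (intro allI int meas_F[OF sF fF]) measurable
  define V where "V = value_fun ?a ?c"
  have V: "has_time_deriv (V k) (\<lambda>t. - ?c k t + ?a k t * (V k t - V (k - 1) t))" if "k \<in> {1..K}" for k
    unfolding V_def
    by (rule value_fun_deriv[OF N_integrable _ that]) (simp add: c N_integrable)
  have V1: "V k 1 = 0" and V0: "V 0 t = 0" for k t by (simp_all add: V_def value_fun_1)
  have "bench \<in> borel_measurable F"
    using borel_measurable_continuous_on_restrict[OF bench_continuous] measurable_cong_sets[OF sF refl] by blast
  then have "(LINT p|F. bench p) = 1" using int w by simp
  then have P: "primal_feasible K m \<tau> s lam g F V"
    unfolding primal_feasible_iff[OF sF fF] using V V1 V0 by simp
  interpret death_rates K M "rate \<tau>" by (rule death_rates_rate)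
  have ef: "exit_flow k = flow (occ \<tau>) k" for k
    by (auto simp: exit_flow_def flow_def rate_def fun_eq_iff)
  have x: "has_time_deriv (occ \<tau> k) (\<lambda>t. - (flow (occ \<tau>) k t - flow (occ \<tau>) (Suc k) t))" if "k \<in> {1..K}" for k
    using death_deriv[OF that] unfolding ef .
  have x0: "occ \<tau> K 0 = 1" "\<And>k. k \<in> {1..<K} \<Longrightarrow> occ \<tau> k 0 = 0"
    using death_0 K_ge_1 by auto
  have "V K 0 = (LINT p|F. revenue (occ \<tau>) p)" and "integrable F (revenue (occ \<tau>))"
    using value_eq_revenue[OF sF fF x0 x V1 V0 V] by blast+
  then have "V K 0 = w * sales \<tau> q" using int[of "revenue (occ \<tau>)"] by (simp add: revenue_occ)
  then have "V K 0 = ratio \<tau> q" by (simp add: ratio_def w_def)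
  moreover have "OP K m \<tau> s lam g \<le> ereal (V K 0)"
    unfolding OP_def by (rule INF_lower2[of "(F, V)"]) (use P in auto)
  ultimately show ?thesis by simp
qed

text \<open>
  A number below the primal value is below every ratio, so it is dual feasible together with the actual
  state probabilities.
\<close>

theorem strong_duality: "OP K m \<tau> s lam g = Dual K m \<tau> s lam g"
proof (rule antisym[OF _ weak_duality], rule ccontr)
  assume "\<not> OP K m \<tau> s lam g \<le> Dual K m \<tau> s lam g"
  then obtain r where r: "Dual K m \<tau> s lam g < ereal r" "ereal r < OP K m \<tau> s lam g"
    using ereal_dense2 by (auto simp: not_le)
  have "r * bench q \<le> sales \<tau> q" if q: "q \<in> {0..1}" for q
  proof (cases "q = 1")
    case False
    then have "0 \<le> q" "q < 1" using q by auto
    moreover have "ereal r < ereal (ratio \<tau> q)"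
      using r(2) OP_le_ratio[OF calculation] by (rule less_le_trans)
    ultimately show ?thesis using le_ratio_iff[of q r \<tau>] by (simp add: less_imp_le)
  qed (simp add: sales_nonneg)
  then have "dual_feasible K m \<tau> s lam g r (occ \<tau>)" by (rule dual_feasible_occ)
  then have "ereal r \<le> Dual K m \<tau> s lam g"
    unfolding Dual_def by (intro SUP_upper) blast
  with r(1) show False by simp
qed

end

section \<open>The lower bound over all environments\<close>

theorem theorem1:
  fixes K m :: nat and M :: real and s :: "nat \<Rightarrow> nat"
  assumes "1 \<le> m" and "m \<le> K" and "0 < M" and "switching_vector K m s"
  shows
    "PoisOPTRe K m s M
       \<le> (INF (lam, g)\<in>environments M. SUP (\<tau>', s')\<in>policies K m. OP K m \<tau>' s' lam g) \<and>
     (INF (lam, g)\<in>environments M. SUP (\<tau>', s')\<in>policies K m. OP K m \<tau>' s' lam g)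
       = (INF (lam, g)\<in>environments M. SUP (\<tau>', s')\<in>policies K m. Dual K m \<tau>' s' lam g)"
proof -
  have K: "1 \<le> K" using assms by simp
  have eq: "OP K m \<tau>' s' lam g = Dual K m \<tau>' s' lam g"
    if "(lam, g) \<in> environments M" "(\<tau>', s') \<in> policies K m" for lam g \<tau>' s'
  proof -
    interpret market_policy M lam g K m s' \<tau>'
      by unfold_locales (use that K assms in auto)
    show ?thesis by (rule strong_duality)
  qed
  have EQ: "(INF (lam, g)\<in>environments M. SUP (\<tau>', s')\<in>policies K m. OP K m \<tau>' s' lam g)
      = (INF (lam, g)\<in>environments M. SUP (\<tau>', s')\<in>policies K m. Dual K m \<tau>' s' lam g)"
    using eq by (intro INF_cong refl) (auto intro!: SUP_cong)
  have LE: "PoisOPTRe K m s M \<le> (SUP (\<tau>', s')\<in>policies K m. Dual K m \<tau>' s' lam g)" (is "_ \<le> ?W")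
    if e: "(lam, g) \<in> environments M" for lam g
  proof -
    interpret market M lam g by unfold_locales (rule e)
    interpret demand K m M s N by (rule demand_N[OF K assms(1,4)])
    show ?thesis
    proof (rule PoisOPTRe_le_policy_bound)
      fix \<tau> :: "nat \<Rightarrow> real" and \<theta> :: real
      assume t01: "\<And>i. i \<in> {1..m} \<Longrightarrow> 0 \<le> \<tau> i \<and> \<tau> i \<le> 1"
        and mono: "\<And>i j. 1 \<le> i \<Longrightarrow> i \<le> j \<Longrightarrow> j \<le> m \<Longrightarrow> \<tau> i \<le> \<tau> j"
        and le: "\<And>q. q \<in> {0..1} \<Longrightarrow> \<theta> * bench q \<le> sales \<tau> q"
      have pol: "(\<tau>, s) \<in> policies K m"
        unfolding policies_def using t01 mono assms(4) by auto
      interpret market_policy M lam g K m s \<tau>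
        by unfold_locales (use pol K assms in auto)
      have "ereal \<theta> \<le> Dual K m \<tau> s lam g"
        unfolding Dual_def using dual_feasible_occ[OF le] by (intro SUP_upper) blast
      also have "\<dots> \<le> ?W" using pol by (intro SUP_upper2[of "(\<tau>, s)"]) auto
      finally show "ereal \<theta> \<le> ?W" .
    qed
  qed
  have "PoisOPTRe K m s M
      \<le> (INF (lam, g)\<in>environments M. SUP (\<tau>', s')\<in>policies K m. Dual K m \<tau>' s' lam g)"
    by (rule INF_greatest) (use LE in auto)
  then show ?thesis using EQ by simp
qed

end
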